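(* Let $p,q$ be constants with $1\le p<d$ and $p\le q\le\frac{dp}{d-p}$. There exists a constant $S(\Omega,\eta)>0$, depending only on $\Omega$ and $\eta$, such that the following holds. Assume: (i) for some $K\le S(\Omega,\eta)$ (with $K>0$) there is a sequence of Borel maps $T_n:\Omega\to V_n$ with $T_n\#\mu=\mu_n$ and $\sup_{x\in\Omega}|T_n(x)-x|\le K\varepsilon_n$ for every $n\in\mathbb N$; (ii) $\eta$ is continuous at $0$, non-increasing, and $\eta(0)>0$; (iii) there is $D>0$ with $\frac1D\le\rho(x)\le D$ for all $x\in\Omega$. Additionally assume there exists $t>q$ such that $\aleph_\eta^t<+\infty$, and that the sequence $$\left(\frac{\varepsilon_n(\Lambda_n^+)^{1/q+1/p}}{(\Lambda_n^-)^{2/p}}\right)_{n\in\mathbb N}$$ is bounded. Let $(u_n)_{n\in\mathbb N}$ be a sequence of functions $u_n:V_n\to\mathbb R$ such that $(\|u_n\|_{L^p(V_n;\mu_n)})_{n\in\mathbb N}$ and $(\mathcal{GE}_n^p(u_n))_{n\in\mathbb N}$ are bounded. Then, for any $r\in[1,q)$, the sequence $\big((u_n,\mu_n)\big)_{n\in\mathbb N}$ is relatively compact in $TL^r(\Omega)$.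
   Context: $\mathbb N=\{1,2,\dots\}$; $d\in\mathbb N$; $\Omega\subset\mathbb R^d$ is open and bounded with Lipschitz boundary (near each boundary point, in suitable orthonormal coordinates, $\Omega$ is the region on one side of the graph of a Lipschitz function). $\mu$ is a probability measure on $\Omega$ with continuous density $\rho:\Omega\to\mathbb R$ with respect to Lebesgue measure. For $n\in\mathbb N$, $V_n\subset\Omega$ is a finite set, $\mu_n$ is a probability measure on $V_n$ (also regarded as a measure on $\Omega$, so that functions on $V_n$ are elements of $L^r(\Omega;\mu_n)$), $\mu_n(x):=\mu_n(\{x\})$, $\Lambda_n^-:=\min_{x\in V_n}\mu_n(x)$, $\Lambda_n^+:=\max_{x\in V_n}\mu_n(x)$. $(\varepsilon_n)_{n\in\mathbb N}$ is a sequence of positive reals with $\varepsilon_n\to0$. The kernel is a function $\eta:[0,\infty)\to[0,\infty)$, and $\eta_\varepsilon(r):=\varepsilon^{-d}\eta(r/\varepsilon)$ for $\varepsilon>0$. For $t\ge0$, $\aleph_\eta^t:=\int_0^\infty\eta(r)r^{d+t-1}\,dr$. The push-forward is $T\#\mu(A):=\mu(T^{-1}(A))$. For $u:V_n\to\mathbb R$ and $p\ge1$, $$\|u\|_{L^p(V_n;\mu_n)}:=\Big(\sum_{x\in V_n}|u(x)|^p\mu_n(x)\Big)^{1/p},\qquad \mathcal{GE}_n^p(u):=\frac1{\varepsilon_n^p}\sum_{x\in V_n}\sum_{y\in V_n}\eta_{\varepsilon_n}(|x-y|)|u(x)-u(y)|^p\mu_n(x)\mu_n(y).$$ For $r\ge1$,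 $TL^r(\Omega)$ is the set of pairs $(f,\nu)$ with $\nu$ a Borel probability measure on $\Omega$ with finite $r$-th moment and $f\in L^r(\Omega;\nu)$, with the metric $$d_{TL^r(\Omega)}\big((f,\nu),(g,\lambda)\big):=\inf_{\gamma\in\Gamma(\nu,\lambda)}\Big(\int_{\Omega\times\Omega}|x-y|^r+|f(x)-g(y)|^r\,d\gamma(x,y)\Big)^{1/r},$$ where $\Gamma(\nu,\lambda)$ is the set of couplings of $\nu$ and $\lambda$. A sequence is relatively compact if every subsequence has a further subsequence converging in $TL^r(\Omega)$. *)

theory Defs
  imports "HOL-Probability.Probability"
begin

text \<open>
  The space \<open>\<real>\<^sup>d\<close> is \<^typ>\<open>real ^ 'd\<close>, so \<open>d\<close> is \<open>CARD('d)\<close>.  Sequences are indexed by all of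
  \<^typ>\<open>nat\<close>, with \<open>0\<close> as the first index.
\<close>

text \<open>
  A unit vector \<open>e\<close> is the last vector of some orthonormal basis.  In such coordinates \<open>y \<bullet> e\<close> is
  the last coordinate of \<open>y\<close>, and the hyperplane orthogonal to \<open>e\<close> carries the remaining ones.
\<close>

definition lipschitz_boundary :: "(real ^ 'd) set \<Rightarrow> bool" where
  "lipschitz_boundary \<Omega> \<longleftrightarrow>
     (\<forall>x\<in>frontier \<Omega>. \<exists>\<delta>>0. \<exists>e L. \<exists>\<phi> :: real ^ 'd \<Rightarrow> real.
        norm e = 1 \<and> L-lipschitz_on {v. v \<bullet> e = 0} \<phi> \<and>
        \<Omega> \<inter> ball x \<delta> = {y \<in> ball x \<delta>. \<phi> (y - (y \<bullet> e) *\<^sub>R e) < y \<bullet> e})"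

abbreviation borel_on :: "(real ^ 'd) set \<Rightarrow> (real ^ 'd) measure" where
  "borel_on \<Omega> \<equiv> restrict_space borel \<Omega>"

text \<open>A kernel on the half-line is a function on \<^typ>\<open>real\<close> whose values at negative arguments
  are irrelevant.\<close>

definition kernel_moment :: "nat \<Rightarrow> (real \<Rightarrow> real) \<Rightarrow> real \<Rightarrow> ennreal" where
  "kernel_moment d \<eta> t =
     (\<integral>\<^sup>+ r. ennreal (\<eta> r * r powr (real d + t - 1)) * indicator {0..} r \<partial>lborel)"

definition scaled_kernel :: "nat \<Rightarrow> (real \<Rightarrow> real) \<Rightarrow> real \<Rightarrow> real \<Rightarrow> real" where
  "scaled_kernel d \<eta> \<epsilon> r = \<eta> (r / \<epsilon>) / \<epsilon> ^ d"

definition min_weight :: "(real ^ 'd) set \<Rightarrow> (real ^ 'd) measure \<Rightarrow> real" where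
  "min_weight V m = Min ((\<lambda>x. measure m {x}) ` V)"

definition max_weight :: "(real ^ 'd) set \<Rightarrow> (real ^ 'd) measure \<Rightarrow> real" where
  "max_weight V m = Max ((\<lambda>x. measure m {x}) ` V)"

definition graph_Lp_norm ::
  "real \<Rightarrow> (real ^ 'd) set \<Rightarrow> (real ^ 'd) measure \<Rightarrow> (real ^ 'd \<Rightarrow> real) \<Rightarrow> real" where
  "graph_Lp_norm p V m u = (\<Sum>x\<in>V. \<bar>u x\<bar> powr p * measure m {x}) powr (1 / p)"

definition graph_energy ::
  "(real \<Rightarrow> real) \<Rightarrow> real \<Rightarrow> real \<Rightarrow> (real ^ 'd) set \<Rightarrow> (real ^ 'd) measure \<Rightarrow> (real ^ 'd \<Rightarrow> real) \<Rightarrow> real"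
  where
  "graph_energy \<eta> p \<epsilon> V m u =
     1 / \<epsilon> powr p *
     (\<Sum>x\<in>V. \<Sum>y\<in>V. scaled_kernel CARD('d) \<eta> \<epsilon> (norm (x - y)) * \<bar>u x - u y\<bar> powr p *
        measure m {x} * measure m {y})"

text \<open>
  Functions in \<open>L\<^sup>r\<close> are represented by Borel functions rather than by classes modulo null sets, so
  the distance below is a pseudometric.  Between elements of \<open>TL_space r \<Omega>\<close> the cost is integrable
  for every coupling, so the Bochner integral never takes its default value there.
\<close>

definition TL_space ::
  "real \<Rightarrow> (real ^ 'd) set \<Rightarrow> ((real ^ 'd \<Rightarrow> real) \<times> (real ^ 'd) measure) set" where
  "TL_space r \<Omega> =
     {(f, \<nu>). prob_space \<nu> \<and> sets \<nu> = sets (borel_on \<Omega>) \<and>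
        integrable \<nu> (\<lambda>x. norm x powr r) \<and>
        f \<in> borel_measurable \<nu> \<and> integrable \<nu> (\<lambda>x. \<bar>f x\<bar> powr r)}"

definition couplings ::
  "(real ^ 'd) set \<Rightarrow> (real ^ 'd) measure \<Rightarrow> (real ^ 'd) measure \<Rightarrow>
     ((real ^ 'd) \<times> (real ^ 'd)) measure set" where
  "couplings \<Omega> \<nu> \<kappa> =
     {\<gamma>. prob_space \<gamma> \<and> sets \<gamma> = sets (borel_on \<Omega> \<Otimes>\<^sub>M borel_on \<Omega>) \<and>
        distr \<gamma> (borel_on \<Omega>) fst = \<nu> \<and> distr \<gamma> (borel_on \<Omega>) snd = \<kappa>}"

definition TL_dist ::
  "real \<Rightarrow> (real ^ 'd) set \<Rightarrow> (real ^ 'd \<Rightarrow> real) \<times> (real ^ 'd) measure \<Rightarrow>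
     (real ^ 'd \<Rightarrow> real) \<times> (real ^ 'd) measure \<Rightarrow> real" where
  "TL_dist r \<Omega> = (\<lambda>(f, \<nu>) (g, \<kappa>).
     INF \<gamma>\<in>couplings \<Omega> \<nu> \<kappa>.
       (\<integral>(x, y). norm (x - y) powr r + \<bar>f x - g y\<bar> powr r \<partial>\<gamma>) powr (1 / r))"

definition TL_converges ::
  "real \<Rightarrow> (real ^ 'd) set \<Rightarrow> (nat \<Rightarrow> (real ^ 'd \<Rightarrow> real) \<times> (real ^ 'd) measure) \<Rightarrow>
     (real ^ 'd \<Rightarrow> real) \<times> (real ^ 'd) measure \<Rightarrow> bool" where
  "TL_converges r \<Omega> X l \<longleftrightarrow>
     (\<forall>n. X n \<in> TL_space r \<Omega>) \<and> l \<in> TL_space r \<Omega> \<and> (\<lambda>n. TL_dist r \<Omega> (X n) l) \<longlonglongrightarrow> 0"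

definition TL_relatively_compact ::
  "real \<Rightarrow> (real ^ 'd) set \<Rightarrow> (nat \<Rightarrow> (real ^ 'd \<Rightarrow> real) \<times> (real ^ 'd) measure) \<Rightarrow> bool" where
  "TL_relatively_compact r \<Omega> X \<longleftrightarrow>
     (\<forall>s. strict_mono (s :: nat \<Rightarrow> nat) \<longrightarrow>
        (\<exists>s' l. strict_mono (s' :: nat \<Rightarrow> nat) \<and> TL_converges r \<Omega> (X \<circ> s \<circ> s') l))"

text \<open>
  Only the values of \<open>u\<close> on \<open>V\<close> matter for a function on \<open>V\<close>.  Its class modulo null sets of a
  measure concentrated on \<open>V\<close> is represented by the extension by zero, which is Borel when \<open>V\<close> is
  finite.
\<close>

definition extend_zero :: "(real ^ 'd) set \<Rightarrow> (real ^ 'd \<Rightarrow> real) \<Rightarrow> real ^ 'd \<Rightarrow> real" where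
  "extend_zero V u = (\<lambda>x. if x \<in> V then u x else 0)"

end

theory Submission
  imports Defs "HOL-Complex_Analysis.Great_Picard"
begin

text \<open>
  The weighted graphs are pulled back to the domain: \<open>f\<^sub>n = u\<^sub>n \<circ> T\<^sub>n\<close> on \<open>\<Omega>\<close>.  Near \<open>0\<close> the kernel is
  bounded below, say by \<open>\<eta> 0 / 2\<close> on \<open>[0, b]\<close>.  If the maps move points by at most \<open>b / 4 \<sqdot> \<epsilon>\<^sub>n\<close>, then
  points of \<open>\<Omega>\<close> closer than \<open>\<tau>\<^sub>n = b / 2 \<sqdot> \<epsilon>\<^sub>n\<close> have images that interact, so the graph energy bounds
  \<open>\<integral>\<integral> \<bar>f\<^sub>n x - f\<^sub>n y\<bar>\<^sup>p\<close> over the pairs in \<open>\<Omega>\<close> at distance less than \<open>\<tau>\<^sub>n\<close> by a multiple of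
  \<open>\<tau>\<^sub>n\<^bsup>d+p\<^esup>\<close> (lemma \<open>pullback_pair_energy\<close>).  The constant \<open>S\<close> is therefore \<open>b / 4\<close>.  The graph enters the
  rest of the argument only through this short-range estimate, its pointwise variant
  \<open>pullback_pointwise\<close> and the bound in \<open>L\<^sup>p\<close>.

  The estimate propagates to larger scales.  In a convex set the segment between two points splits
  into \<open>N\<close> steps of equal length, and this multiplies the energy by at most \<open>N\<^bsup>p+d\<^esup>\<close>
  (\<open>pair_energy_chain\<close>): a chain of difference quotients replaces the gradient.

  Subcritical integrability follows without Sobolev spaces.  A Lipschitz domain is a finite union of
  sets \<open>W\<close> for which one truncated open cone or ball \<open>K\<close> satisfies \<open>x + K \<subseteq> \<Omega>\<close> for all \<open>x \<in> W\<close>.  With \<open>A\<^sub>t f x\<close>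
  the average of \<open>f\<close> over \<open>x + t K\<close>, the chain inequality bounds \<open>A\<^sub>t f - A\<^bsub>2t\<^esub> f\<close> on \<open>W\<close> by \<open>C t\<close> in
  \<open>L\<^sup>p\<close> and by \<open>C t\<^bsup>1-d/p\<^esup>\<close> uniformly, hence by a positive power of \<open>t\<close> in \<open>L\<^sup>s\<close> if \<open>p \<le> s < dp/(d-p)\<close>.
  Summing over dyadic \<open>t\<close> between \<open>\<tau>\<^sub>n\<close> and \<open>1\<close> gives a bound for \<open>f\<^sub>n\<close> in \<open>L\<^sup>s\<close>, apart from the first
  difference \<open>f\<^sub>n - A\<^sub>t f\<^sub>n\<close> at the scale \<open>t \<sim> \<tau>\<^sub>n\<close>.  There the uniform bound is a multiple of
  \<open>\<epsilon>\<^sub>n (\<Lambda>\<^sub>n\<^sup>-)\<^bsup>-1/p\<^esup>\<close>, because one vertex carries mass at least \<open>\<Lambda>\<^sub>n\<^sup>-\<close>; the hypothesis on the weights makes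
  it sufficient for \<open>s \<le> q\<close> (\<open>nonlocal_higher_integrability\<close>, \<open>weight_condition\<close>).

  Compactness in \<open>L\<^sup>r\<close> for \<open>r < s\<close> is then an interior statement, since the \<open>L\<^sup>s\<close> bound makes small sets
  negligible.  By Vitali's theorem, finitely many disjoint small balls in \<open>\<Omega>\<close> fill it up to small
  measure, on each of them the chain inequality bounds the oscillation of \<open>f\<^sub>n\<close>, and a diagonal
  subsequence makes all the countably many averages converge (\<open>Lr_Cauchy_subsequence\<close>, \<open>Lr_limit\<close>).
  Given \<open>r < q\<close> there is always an admissible \<open>s > r\<close> (\<open>intermediate_exponent\<close>).  Finally, the coupling
  of \<open>\<mu>\<^sub>n\<close> and \<open>\<mu>\<close> given by \<open>x \<mapsto> (T\<^sub>n x, x)\<close> turns convergence of \<open>f\<^sub>n\<close> in \<open>L\<^sup>r\<close> into convergence in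
  \<open>TL\<^sup>r\<close>.
\<close>

section \<open>Convexity of powers and the chain inequality\<close>

lemma nn_integral_affine:
  fixes g :: "'a::euclidean_space \<Rightarrow> ennreal"
  assumes [measurable]: "g \<in> borel_measurable borel" and c: "c \<noteq> 0"
  shows "(\<integral>\<^sup>+x. g x \<partial>lborel) = ennreal (\<bar>c\<bar> ^ DIM('a)) * (\<integral>\<^sup>+h. g (x0 + c *\<^sub>R h) \<partial>lborel)"
  by (subst lborel_affine[OF c, of x0])
     (simp add: nn_integral_density nn_integral_distr nn_integral_cmult)

abbreviation power_integral :: "real \<Rightarrow> 'a::euclidean_space set \<Rightarrow> ('a \<Rightarrow> real) \<Rightarrow> ennreal" where
  "power_integral r A h \<equiv> (\<integral>\<^sup>+x. indicator A x * ennreal (\<bar>h x\<bar> powr r) \<partial>lborel)"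

abbreviation abs_integral :: "'a::euclidean_space set \<Rightarrow> ('a \<Rightarrow> real) \<Rightarrow> ennreal" where
  "abs_integral A h \<equiv> (\<integral>\<^sup>+x. indicator A x * ennreal \<bar>h x\<bar> \<partial>lborel)"

abbreviation point_energy ::
  "real \<Rightarrow> real \<Rightarrow> ('a::euclidean_space \<Rightarrow> real) \<Rightarrow> 'a set \<Rightarrow> 'a \<Rightarrow> ennreal" where
  "point_energy p \<tau> f A x \<equiv>
     (\<integral>\<^sup>+z. indicator A z * indicator {v. norm v < \<tau>} (z - x) * ennreal (\<bar>f x - f z\<bar> powr p) \<partial>lborel)"

text \<open>
  The short-range nonlocal energy, which plays the role of the \<open>p\<close>-th power of the norm of a gradient:
  for smooth \<open>f\<close> and small \<open>\<tau>\<close> it is comparable to \<open>\<tau>\<^bsup>d+p\<^esup> \<integral>\<^sub>Q \<bar>\<nabla> f\<bar>\<^sup>p\<close>.  Extended nonnegative integrals are used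
  throughout, so that Tonelli's theorem applies without integrability side conditions.
\<close>
definition pair_energy :: "real \<Rightarrow> real \<Rightarrow> ('a::euclidean_space \<Rightarrow> real) \<Rightarrow> 'a set \<Rightarrow> ennreal" where
  "pair_energy p \<tau> f Q =
     (\<integral>\<^sup>+x. \<integral>\<^sup>+y. indicator Q x * indicator Q y * indicator {v. norm v < \<tau>} (y - x)
        * ennreal (\<bar>f x - f y\<bar> powr p) \<partial>lborel \<partial>lborel)"

lemma pair_energy_mono:
  assumes "P \<subseteq> Q" "\<sigma> \<le> \<tau>"
  shows "pair_energy p \<sigma> f P \<le> pair_energy p \<tau> f Q"
  unfolding pair_energy_def using assms
  by (intro nn_integral_mono mult_right_mono mult_mono) (auto simp: indicator_def)

lemma convex_on_abs_powr:
  assumes p: "p \<ge> 1"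
  shows "convex_on UNIV (\<lambda>x::real. \<bar>x\<bar> powr p)"
proof (rule convex_onI)
  fix t x y :: real assume t: "0 < t" "t < 1"
  have pos: "((1 - t) * a + t * b) powr p \<le> (1 - t) * a powr p + t * b powr p"
    if "a \<ge> 0" "b \<ge> 0" for a b
  proof (cases "a = 0 \<or> b = 0")
    case True
    have "c powr p \<le> c" if "0 < c" "c < 1" for c :: real
      using that p powr_mono'[of 1 p c] by simp
    from this[of t] this[of "1 - t"] t True that p show ?thesis
      by (auto simp: powr_mult intro!: mult_right_mono)
  next
    case False
    then show ?thesis
      using convex_onD[OF powr_convex[OF p], of t a b] that t by simp
  qed
  have "\<bar>(1 - t) *\<^sub>R x + t *\<^sub>R y\<bar> \<le> (1 - t) * \<bar>x\<bar> + t * \<bar>y\<bar>"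
    using abs_triangle_ineq[of "(1 - t) * x" "t * y"] t by (simp add: abs_mult)
  then have "\<bar>(1 - t) *\<^sub>R x + t *\<^sub>R y\<bar> powr p \<le> ((1 - t) * \<bar>x\<bar> + t * \<bar>y\<bar>) powr p"
    using p by (intro powr_mono2) auto
  also have "\<dots> \<le> (1 - t) * \<bar>x\<bar> powr p + t * \<bar>y\<bar> powr p"
    by (rule pos) auto
  finally show "\<bar>(1 - t) *\<^sub>R x + t *\<^sub>R y\<bar> powr p \<le> (1 - t) * \<bar>x\<bar> powr p + t * \<bar>y\<bar> powr p" .
qed simp

text \<open>
  Jensen's inequality for the convex combination \<open>\<Sum> (a\<^sub>i / A) (A g\<^sub>i / a\<^sub>i)\<close> with \<open>A = \<Sum> a\<^sub>i\<close>.  The free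
  weights allow sums with geometrically decaying terms to be estimated independently of their length.
\<close>
lemma abs_sum_powr_le:
  fixes g :: "'i \<Rightarrow> real"
  assumes I: "finite I" and a: "\<And>i. i \<in> I \<Longrightarrow> a i > 0" and s: "s \<ge> 1"
  shows "\<bar>\<Sum>i\<in>I. g i\<bar> powr s
    \<le> (\<Sum>i\<in>I. a i) powr (s - 1) * (\<Sum>i\<in>I. a i powr (1 - s) * \<bar>g i\<bar> powr s)"
proof (cases "I = {}")
  case False
  define A where "A = (\<Sum>i\<in>I. a i)"
  have A: "A > 0" unfolding A_def using I False a by (intro sum_pos) auto
  have "(\<Sum>i\<in>I. g i) = (\<Sum>i\<in>I. (a i / A) *\<^sub>R (A * g i / a i))"
    using a A by (intro sum.cong) (auto simp: less_imp_neq[symmetric])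
  then have "\<bar>\<Sum>i\<in>I. g i\<bar> powr s = \<bar>\<Sum>i\<in>I. (a i / A) *\<^sub>R (A * g i / a i)\<bar> powr s"
    by simp
  also have "\<dots> \<le> (\<Sum>i\<in>I. (a i / A) * \<bar>A * g i / a i\<bar> powr s)"
  proof (rule convex_on_sum[OF I False convex_on_abs_powr[OF s]])
    show "(\<Sum>i\<in>I. a i / A) = 1" using A by (simp add: sum_divide_distrib[symmetric] A_def)
    show "a i / A \<ge> 0" if "i \<in> I" for i using a[OF that] A by simp
  qed simp
  also have "\<dots> = (\<Sum>i\<in>I. A powr (s - 1) * (a i powr (1 - s) * \<bar>g i\<bar> powr s))"
  proof (intro sum.cong refl)
    fix i assume "i \<in> I"
    with a have ai: "a i > 0" by blast
    have "\<bar>A * g i / a i\<bar> powr s = A powr s * \<bar>g i\<bar> powr s / a i powr s"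
      using A ai by (simp add: abs_mult powr_mult powr_divide)
    moreover have "A powr (s - 1) = A powr s / A" "a i powr (1 - s) = a i / a i powr s"
      using A ai by (simp_all add: powr_diff)
    ultimately show "(a i / A) * \<bar>A * g i / a i\<bar> powr s
        = A powr (s - 1) * (a i powr (1 - s) * \<bar>g i\<bar> powr s)"
      by simp
  qed
  finally show ?thesis by (simp add: A_def sum_distrib_left)
qed simp

lemma abs_sum_powr_le_card:
  fixes g :: "'i \<Rightarrow> real"
  assumes I: "finite I" and s: "s \<ge> 1"
  shows "\<bar>\<Sum>i\<in>I. g i\<bar> powr s \<le> real (card I) powr (s - 1) * (\<Sum>i\<in>I. \<bar>g i\<bar> powr s)"
  using abs_sum_powr_le[OF I, of "\<lambda>_. 1" s g] s by simp

text \<open>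
  For \<open>x\<close> and \<open>x + N h\<close> in \<open>Q\<close>, convexity puts all the points \<open>x + j h\<close> into \<open>Q\<close>, and
  \<open>\<bar>f x - f (x + N h)\<bar>\<^sup>p \<le> N\<^bsup>p-1\<^esup> \<Sum>\<^sub>j \<bar>f (x + j h) - f (x + (j+1) h)\<bar>\<^sup>p\<close>.  For fixed \<open>h\<close> each of the \<open>N\<close>
  terms integrates over \<open>x\<close>, after a translation, to the same quantity; the factor \<open>N\<^sup>d\<close> is the Jacobian
  of \<open>h \<mapsto> N h\<close>.
\<close>
lemma pair_energy_chain:
  fixes f :: "'a::euclidean_space \<Rightarrow> real"
  assumes [measurable]: "f \<in> borel_measurable borel" "Q \<in> sets borel"
    and Q: "convex Q" and p: "p \<ge> 1" and N: "N > 0"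
  shows "pair_energy p (real N * \<tau>) f Q
     \<le> ennreal (real N powr p * real N ^ DIM('a)) * pair_energy p \<tau> f Q"
proof -
  let ?d = "DIM('a)"
  \<comment> \<open>\<open>F \<sigma> x h\<close> is the integrand in the variables base point and increment.\<close>
  define F where "F \<sigma> x h = indicator Q x * indicator Q (x + h) * indicator {v. norm v < \<sigma>} h
        * ennreal (\<bar>f x - f (x + h)\<bar> powr p)" for \<sigma> and x h :: 'a
  define G where "G = F \<tau>"
  have [measurable]: "case_prod (F \<sigma>) \<in> borel_measurable (borel \<Otimes>\<^sub>M borel)" for \<sigma>
    unfolding F_def by measurable
  have [measurable]: "case_prod G \<in> borel_measurable (borel \<Otimes>\<^sub>M borel)"
    unfolding G_def by measurable
  have scaled: "pair_energy p \<sigma> f Q = ennreal (c ^ ?d) * (\<integral>\<^sup>+x. \<integral>\<^sup>+h. F \<sigma> x (c *\<^sub>R h) \<partial>lborel \<partial>lborel)"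
    if c: "c > 0" for c \<sigma>
  proof -
    have "(\<integral>\<^sup>+y. indicator Q x * indicator Q y * indicator {v. norm v < \<sigma>} (y - x)
          * ennreal (\<bar>f x - f y\<bar> powr p) \<partial>lborel) = ennreal (c ^ ?d) * (\<integral>\<^sup>+h. F \<sigma> x (c *\<^sub>R h) \<partial>lborel)"
      for x :: 'a
      unfolding F_def using c by (subst nn_integral_affine[where c=c and ?x0.0=x]) simp_all
    then show ?thesis by (simp add: pair_energy_def nn_integral_cmult)
  qed
  have pe: "pair_energy p \<tau> f Q = (\<integral>\<^sup>+h. \<integral>\<^sup>+x. G x h \<partial>lborel \<partial>lborel)"
  proof -
    have "pair_energy p \<tau> f Q = (\<integral>\<^sup>+x. \<integral>\<^sup>+h. G x h \<partial>lborel \<partial>lborel)"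
      using scaled[of 1 \<tau>] by (simp add: G_def)
    also have "\<dots> = (\<integral>\<^sup>+h. \<integral>\<^sup>+x. G x h \<partial>lborel \<partial>lborel)"
      by (rule lborel_pair.Fubini') simp
    finally show ?thesis .
  qed
  have transl: "(\<integral>\<^sup>+x. G (x + real j *\<^sub>R h) h \<partial>lborel) = (\<integral>\<^sup>+x. G x h \<partial>lborel)" for h j
    using nn_integral_affine[of "\<lambda>x. G x h" 1 "real j *\<^sub>R h"] by (simp add: add.commute)
  have step: "F (real N * \<tau>) x (real N *\<^sub>R h) \<le> ennreal (real N powr (p - 1)) * (\<Sum>j<N. G (x + real j *\<^sub>R h) h)"
    for x h :: 'a
  proof (cases "x \<in> Q \<and> x + real N *\<^sub>R h \<in> Q \<and> norm (real N *\<^sub>R h) < real N * \<tau>")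
    case True
    have seg: "x + real j *\<^sub>R h \<in> Q" if "j \<le> N" for j
    proof -
      have "(1 - real j / real N) *\<^sub>R x + (real j / real N) *\<^sub>R (x + real N *\<^sub>R h) \<in> Q"
        using True Q that N by (intro convexD) auto
      moreover have "(1 - real j / real N) *\<^sub>R x + (real j / real N) *\<^sub>R (x + real N *\<^sub>R h)
          = x + real j *\<^sub>R h"
        using N by (simp add: algebra_simps)
      ultimately show ?thesis by simp
    qed
    have h: "norm h < \<tau>" using True N by simp
    have G_eq: "G (x + real j *\<^sub>R h) h
        = ennreal (\<bar>f (x + real j *\<^sub>R h) - f (x + real (Suc j) *\<^sub>R h)\<bar> powr p)" if "j < N" for j
    proof -
      have eq: "x + real j *\<^sub>R h + h = x + real (Suc j) *\<^sub>R h" by (simp add: algebra_simps)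
      show ?thesis
        unfolding G_def F_def eq using seg[of j] seg[of "Suc j"] that h by simp
    qed
    have tel: "f x - f (x + real N *\<^sub>R h)
        = (\<Sum>j<N. f (x + real j *\<^sub>R h) - f (x + real (Suc j) *\<^sub>R h))"
      by (subst sum_lessThan_telescope') simp
    have "\<bar>f x - f (x + real N *\<^sub>R h)\<bar> powr p
       \<le> real N powr (p - 1) * (\<Sum>j<N. \<bar>f (x + real j *\<^sub>R h) - f (x + real (Suc j) *\<^sub>R h)\<bar> powr p)"
      unfolding tel using abs_sum_powr_le_card[of "{..<N}" p] p by simp
    then have "ennreal (\<bar>f x - f (x + real N *\<^sub>R h)\<bar> powr p)
       \<le> ennreal (real N powr (p - 1) * (\<Sum>j<N. \<bar>f (x + real j *\<^sub>R h) - f (x + real (Suc j) *\<^sub>R h)\<bar> powr p))"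
      by (rule ennreal_leI)
    also have "\<dots> = ennreal (real N powr (p - 1)) * (\<Sum>j<N. G (x + real j *\<^sub>R h) h)"
      by (simp add: ennreal_mult sum_nonneg G_eq)
    finally show ?thesis using True by (simp add: F_def)
  qed (auto simp: F_def indicator_def)
  have "pair_energy p (real N * \<tau>) f Q = ennreal (real N ^ ?d) *
      (\<integral>\<^sup>+x. \<integral>\<^sup>+h. F (real N * \<tau>) x (real N *\<^sub>R h) \<partial>lborel \<partial>lborel)"
    using N by (intro scaled) simp
  also have "\<dots> \<le> ennreal (real N ^ ?d) *
      (\<integral>\<^sup>+x. \<integral>\<^sup>+h. ennreal (real N powr (p - 1)) * (\<Sum>j<N. G (x + real j *\<^sub>R h) h) \<partial>lborel \<partial>lborel)"
    by (intro mult_left_mono nn_integral_mono step) auto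
  also have "(\<integral>\<^sup>+x. \<integral>\<^sup>+h. ennreal (real N powr (p - 1)) * (\<Sum>j<N. G (x + real j *\<^sub>R h) h) \<partial>lborel \<partial>lborel)
     = (\<integral>\<^sup>+h. \<integral>\<^sup>+x. ennreal (real N powr (p - 1)) * (\<Sum>j<N. G (x + real j *\<^sub>R h) h) \<partial>lborel \<partial>lborel)"
    by (rule lborel_pair.Fubini') measurable
  also have "\<dots> = (\<integral>\<^sup>+h. ennreal (real N powr (p - 1)) * (\<Sum>j<N. \<integral>\<^sup>+x. G (x + real j *\<^sub>R h) h \<partial>lborel) \<partial>lborel)"
    by (simp add: nn_integral_cmult nn_integral_sum)
  also have "\<dots> = (\<integral>\<^sup>+h. ennreal (real N powr (p - 1)) * (\<Sum>j<N. \<integral>\<^sup>+x. G x h \<partial>lborel) \<partial>lborel)"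
    by (simp add: transl)
  also have "\<dots> = ennreal (real N powr (p - 1)) * (ennreal (real N) * pair_energy p \<tau> f Q)"
    unfolding pe by (simp add: nn_integral_cmult ennreal_of_nat_eq_real_of_nat)
  also have "ennreal (real N ^ ?d) * (ennreal (real N powr (p - 1)) * (ennreal (real N) * pair_energy p \<tau> f Q))
    = ennreal (real N powr p * real N ^ ?d) * pair_energy p \<tau> f Q"
  proof -
    have "real N powr p = real N powr (p - 1) * real N"
      using N by (simp add: powr_diff)
    then show ?thesis by (simp add: ennreal_mult mult_ac)
  qed
  finally show ?thesis .
qed

section \<open>Averages over scaled copies of a convex set\<close>

definition mean :: "('a::euclidean_space \<Rightarrow> real) \<Rightarrow> 'a set \<Rightarrow> real" where
  "mean f A = (\<integral>y. indicator A y * f y \<partial>lborel) / measure lborel A"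

lemma integrable_indicator_bounded:
  fixes f :: "'a::euclidean_space \<Rightarrow> real"
  assumes [measurable]: "f \<in> borel_measurable borel" "A \<in> sets borel"
    and fin: "emeasure lborel A < \<infinity>" and bd: "\<And>x. \<bar>f x\<bar> \<le> M"
  shows "integrable lborel (\<lambda>y. indicator A y * f y)"
  by (rule integrableI_bounded_set_indicator[where B=M, of A lborel f, simplified])
     (use fin bd in auto)

text \<open>
  Jensen's inequality for the uniform measure on \<open>A\<close>; multiplying by the measure of \<open>A\<close> avoids division
  of extended reals.
\<close>
lemma mean_diff_powr_le:
  fixes f :: "'a::euclidean_space \<Rightarrow> real"
  assumes [measurable]: "f \<in> borel_measurable borel" "A \<in> sets borel"
    and fin: "emeasure lborel A < \<infinity>" and pos: "emeasure lborel A > 0"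
    and bd: "\<And>x. \<bar>f x\<bar> \<le> M" and p: "p \<ge> 1"
  shows "emeasure lborel A * ennreal (\<bar>c - mean f A\<bar> powr p)
    \<le> power_integral p A (\<lambda>z. c - f z)"
proof -
  let ?U = "uniform_measure lborel A"
  let ?m = "measure lborel A"
  interpret U: prob_space ?U
    using fin pos by (intro prob_space_uniform_measure) auto
  have em: "emeasure lborel A = ennreal ?m" using fin by (simp add: emeasure_eq_ennreal_measure)
  have m: "?m > 0" using pos fin by (simp add: em)
  have bd': "\<bar>c - f x\<bar> \<le> \<bar>c\<bar> + M" for x using bd[of x] by linarith
  have int1: "integrable ?U (\<lambda>x. c - f x)"
    by (rule U.integrable_const_bound[where B="\<bar>c\<bar> + M"]) (use bd' in auto)
  have int1f: "integrable ?U f"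
    by (rule U.integrable_const_bound[where B="M"]) (use bd in auto)
  have int2: "integrable ?U (\<lambda>x. \<bar>c - f x\<bar> powr p)"
    by (rule U.integrable_const_bound[where B="(\<bar>c\<bar> + M) powr p"])
       (use bd' p in \<open>auto intro!: powr_mono2\<close>)
  have "U.expectation f = mean f A"
  proof -
    have "U.expectation f = (\<integral>x. (indicator A x / ?m) *\<^sub>R f x \<partial>lborel)"
      unfolding uniform_measure_def
      apply (subst integral_density[symmetric])
         apply simp_all
      apply (simp add: em ennreal_indicator[symmetric] divide_ennreal m)
      done
    also have "\<dots> = (\<integral>x. (indicator A x * f x) / ?m \<partial>lborel)"
      by (intro Bochner_Integration.integral_cong) auto
    finally show ?thesis by (simp add: mean_def)
  qed
  then have ex: "U.expectation (\<lambda>x. c - f x) = c - mean f A"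
    using int1f U.prob_space by simp
  have "\<bar>c - mean f A\<bar> powr p \<le> U.expectation (\<lambda>x. \<bar>c - f x\<bar> powr p)"
    unfolding ex[symmetric]
    by (rule U.jensens_inequality[where I=UNIV, OF int1 _ _ int2 convex_on_abs_powr[OF p]]) auto
  then have "ennreal (\<bar>c - mean f A\<bar> powr p) \<le> (\<integral>\<^sup>+x. ennreal (\<bar>c - f x\<bar> powr p) \<partial>?U)"
    by (subst nn_integral_eq_integral[OF int2]) (auto intro: ennreal_leI)
  also have "\<dots> = (\<integral>\<^sup>+x. ennreal (\<bar>c - f x\<bar> powr p) * indicator A x \<partial>lborel) / emeasure lborel A"
    by (rule nn_integral_uniform_measure) auto
  finally have "emeasure lborel A * ennreal (\<bar>c - mean f A\<bar> powr p)
    \<le> emeasure lborel A * ((\<integral>\<^sup>+x. ennreal (\<bar>c - f x\<bar> powr p) * indicator A x \<partial>lborel) / emeasure lborel A)"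
    by (rule mult_left_mono) simp
  also have "\<dots> = (\<integral>\<^sup>+x. ennreal (\<bar>c - f x\<bar> powr p) * indicator A x \<partial>lborel)"
    using pos fin by (simp add: ennreal_times_divide mult.commute[of "emeasure lborel A"] mult_divide_eq_ennreal)
  finally show ?thesis by (simp add: mult.commute)
qed

lemma mean_diff_mean_powr_le:
  fixes f :: "'a::euclidean_space \<Rightarrow> real"
  assumes [measurable]: "f \<in> borel_measurable borel" "P \<in> sets borel" "Q \<in> sets borel"
    and P: "emeasure lborel P < \<infinity>" "emeasure lborel P > 0"
    and Q: "emeasure lborel Q < \<infinity>" "emeasure lborel Q > 0"
    and bd: "\<And>x. \<bar>f x\<bar> \<le> M" and p: "p \<ge> 1"
  shows "emeasure lborel P * emeasure lborel Q * ennreal (\<bar>mean f P - mean f Q\<bar> powr p)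
    \<le> (\<integral>\<^sup>+w. \<integral>\<^sup>+z. indicator Q w * indicator P z * ennreal (\<bar>f w - f z\<bar> powr p) \<partial>lborel \<partial>lborel)"
proof -
  have "emeasure lborel P * (emeasure lborel Q * ennreal (\<bar>mean f P - mean f Q\<bar> powr p))
     \<le> emeasure lborel P * power_integral p Q (\<lambda>w. mean f P - f w)"
    by (intro mult_left_mono mean_diff_powr_le[where M=M] assms) auto
  also have "\<dots> = (\<integral>\<^sup>+w. indicator Q w * (emeasure lborel P * ennreal (\<bar>f w - mean f P\<bar> powr p)) \<partial>lborel)"
    by (subst nn_integral_cmult[symmetric]) (auto simp: mult_ac abs_minus_commute)
  also have "\<dots> \<le> (\<integral>\<^sup>+w. indicator Q w * power_integral p P (\<lambda>z. f w - f z) \<partial>lborel)"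
    by (intro nn_integral_mono mult_left_mono mean_diff_powr_le[where M=M] assms) auto
  also have "\<dots> = (\<integral>\<^sup>+w. \<integral>\<^sup>+z. indicator Q w * indicator P z * ennreal (\<bar>f w - f z\<bar> powr p) \<partial>lborel \<partial>lborel)"
    by (subst nn_integral_cmult[symmetric]) (auto simp: mult_ac)
  finally show ?thesis by (simp add: mult_ac)
qed

text \<open>
  The set \<open>x + t K\<close> for \<open>t > 0\<close>.  Written as a preimage it is visibly measurable, jointly in \<open>x\<close> and
  its point.
\<close>
definition copy :: "'a::euclidean_space set \<Rightarrow> 'a \<Rightarrow> real \<Rightarrow> 'a set" where
  "copy K x t = {y. (1 / t) *\<^sub>R (y - x) \<in> K}"

lemma indicator_copy: "indicator (copy K x t) y = indicator K ((1 / t) *\<^sub>R (y - x))"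
  by (simp add: copy_def indicator_def)

lemma measurable_copy [measurable]:
  assumes [measurable]: "K \<in> sets borel"
  shows "copy K x t \<in> sets borel"
  unfolding copy_def by measurable

text \<open>
  A point \<open>y\<close> lies in \<open>x + t K\<close> iff \<open>x\<close> lies in the reflected copy \<open>y - t K\<close>, which has the same volume.
\<close>
lemma nn_integral_copy_center:
  fixes K :: "'a::euclidean_space set"
  assumes [measurable]: "K \<in> sets borel" and t: "t > 0"
  shows "(\<integral>\<^sup>+x. indicator (copy K x t) y \<partial>lborel) = ennreal (t ^ DIM('a)) * emeasure lborel K"
proof -
  have "(\<integral>\<^sup>+x. indicator (copy K x t) y \<partial>lborel)
      = ennreal (\<bar>-t\<bar> ^ DIM('a)) * (\<integral>\<^sup>+v. indicator K ((1 / t) *\<^sub>R (y - (y + (- t) *\<^sub>R v))) \<partial>lborel)"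
    unfolding indicator_copy using t by (intro nn_integral_affine) auto
  also have "(\<lambda>v. (1 / t) *\<^sub>R (y - (y + (- t) *\<^sub>R v))) = (\<lambda>v. v)" using t by auto
  finally show ?thesis using t by simp
qed

lemma emeasure_copy:
  fixes K :: "'a::euclidean_space set"
  assumes [measurable]: "K \<in> sets borel" and t: "t > 0"
  shows "emeasure lborel (copy K x t) = ennreal (t ^ DIM('a)) * emeasure lborel K"
proof -
  have "emeasure lborel (copy K x t) = (\<integral>\<^sup>+y. indicator (copy K x t) y \<partial>lborel)"
    by simp
  also have "\<dots> = ennreal (\<bar>t\<bar> ^ DIM('a)) * (\<integral>\<^sup>+v. indicator K ((1 / t) *\<^sub>R ((x + t *\<^sub>R v) - x)) \<partial>lborel)"
    unfolding indicator_copy using t by (intro nn_integral_affine) auto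
  also have "(\<lambda>v. (1 / t) *\<^sub>R ((x + t *\<^sub>R v) - x)) = (\<lambda>v. v)" using t by auto
  finally show ?thesis using t by simp
qed

lemma convex_copy:
  assumes "convex K"
  shows "convex (copy K x t)"
proof (rule convexI)
  fix y z and u v :: real
  assume yz: "y \<in> copy K x t" "z \<in> copy K x t" and uv: "0 \<le> u" "0 \<le> v" "u + v = 1"
  have "(1 / t) *\<^sub>R (u *\<^sub>R y + v *\<^sub>R z - x) = u *\<^sub>R ((1 / t) *\<^sub>R (y - x)) + v *\<^sub>R ((1 / t) *\<^sub>R (z - x))"
  proof -
    have "x = u *\<^sub>R x + v *\<^sub>R x" using uv by (simp add: scaleR_left_distrib[symmetric])
    then have "u *\<^sub>R y + v *\<^sub>R z - x = u *\<^sub>R (y - x) + v *\<^sub>R (z - x)"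
      by (simp add: algebra_simps)
    then show ?thesis by (simp add: scaleR_right_distrib mult.commute)
  qed
  then show "u *\<^sub>R y + v *\<^sub>R z \<in> copy K x t"
    using yz uv convexD[OF assms, of "(1 / t) *\<^sub>R (y - x)" "(1 / t) *\<^sub>R (z - x)" u v]
    unfolding copy_def by simp
qed

lemma measurable_mean_copy [measurable]:
  fixes f :: "'a::euclidean_space \<Rightarrow> real"
  assumes [measurable]: "f \<in> borel_measurable borel" "K \<in> sets borel" and t: "t > 0"
  shows "(\<lambda>x. mean f (copy K x t)) \<in> borel_measurable borel"
proof -
  define m where "m = measure lborel (copy K 0 t)"
  have "measure lborel (copy K x t) = m" for x
    unfolding m_def measure_def by (simp add: emeasure_copy[OF _ t])
  moreover have "(\<lambda>x. \<integral>y. indicator K ((1 / t) *\<^sub>R (y - x)) * f y \<partial>lborel) \<in> borel_measurable borel"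
    by measurable
  ultimately show ?thesis
    unfolding mean_def indicator_copy by simp
qed

lemma measurable_pair_energy_copy [measurable]:
  fixes f :: "'a::euclidean_space \<Rightarrow> real"
  assumes [measurable]: "f \<in> borel_measurable borel" "K \<in> sets borel"
  shows "(\<lambda>x. pair_energy p \<tau> f (copy K x t)) \<in> borel_measurable borel"
  unfolding pair_energy_def indicator_copy by measurable

text \<open>
  Every pair of points of \<open>\<Omega>\<close> is counted for the centres \<open>x\<close> of the copies containing its first point,
  and by the previous computation these centres have volume \<open>t\<^sup>d\<close> times that of \<open>K\<close>.
\<close>
lemma nn_integral_pair_energy_copy_le:
  fixes f :: "'a::euclidean_space \<Rightarrow> real"
  assumes [measurable]: "f \<in> borel_measurable borel" "K \<in> sets borel" "W \<in> sets borel" "\<Omega> \<in> sets borel"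
    and t: "t > 0" and sub: "\<And>x. x \<in> W \<Longrightarrow> copy K x t \<subseteq> \<Omega>"
  shows "(\<integral>\<^sup>+x. indicator W x * pair_energy p \<tau> f (copy K x t) \<partial>lborel)
    \<le> ennreal (t ^ DIM('a)) * emeasure lborel K * pair_energy p \<tau> f \<Omega>"
proof -
  define w where "w y z = indicator {v. norm v < \<tau>} (z - y) * ennreal (\<bar>f y - f z\<bar> powr p)" for y z
  have [measurable]: "case_prod w \<in> borel_measurable (borel \<Otimes>\<^sub>M borel)" unfolding w_def by measurable
  have pe: "pair_energy p \<tau> f Q = (\<integral>\<^sup>+y. \<integral>\<^sup>+z. indicator Q y * indicator Q z * w y z \<partial>lborel \<partial>lborel)" for Q
    unfolding pair_energy_def w_def by (simp add: mult_ac)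
  define H where "H y = (\<integral>\<^sup>+z. indicator \<Omega> y * indicator \<Omega> z * w y z \<partial>lborel)" for y
  have [measurable]: "H \<in> borel_measurable borel" unfolding H_def by measurable
  have "(\<integral>\<^sup>+x. indicator W x * pair_energy p \<tau> f (copy K x t) \<partial>lborel)
     \<le> (\<integral>\<^sup>+x. \<integral>\<^sup>+y. indicator K ((1 / t) *\<^sub>R (y - x)) * H y \<partial>lborel \<partial>lborel)"
  proof (rule nn_integral_mono)
    fix x
    show "indicator W x * pair_energy p \<tau> f (copy K x t)
      \<le> (\<integral>\<^sup>+y. indicator K ((1 / t) *\<^sub>R (y - x)) * H y \<partial>lborel)"
    proof (cases "x \<in> W")
      case True
      have "pair_energy p \<tau> f (copy K x t) \<le> (\<integral>\<^sup>+y. indicator K ((1 / t) *\<^sub>R (y - x)) * H y \<partial>lborel)"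
        unfolding pe
      proof (rule nn_integral_mono)
        fix y
        have "(\<integral>\<^sup>+z. indicator (copy K x t) y * indicator (copy K x t) z * w y z \<partial>lborel)
          \<le> (\<integral>\<^sup>+z. indicator (copy K x t) y * (indicator \<Omega> y * indicator \<Omega> z * w y z) \<partial>lborel)"
          using sub[OF True] by (intro nn_integral_mono) (auto simp: indicator_def)
        also have "\<dots> = indicator K ((1 / t) *\<^sub>R (y - x)) * H y"
          unfolding H_def by (subst nn_integral_cmult) (auto simp: indicator_copy)
        finally show "(\<integral>\<^sup>+z. indicator (copy K x t) y * indicator (copy K x t) z * w y z \<partial>lborel) \<le> \<dots>" .
      qed
      then show ?thesis using True by simp
    qed simp
  qed
  also have "\<dots> = (\<integral>\<^sup>+y. \<integral>\<^sup>+x. indicator K ((1 / t) *\<^sub>R (y - x)) * H y \<partial>lborel \<partial>lborel)"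
    by (rule lborel_pair.Fubini') measurable
  also have "\<dots> = (\<integral>\<^sup>+y. (\<integral>\<^sup>+x. indicator (copy K x t) y \<partial>lborel) * H y \<partial>lborel)"
    by (simp add: nn_integral_multc indicator_copy)
  also have "\<dots> = ennreal (t ^ DIM('a)) * emeasure lborel K * pair_energy p \<tau> f \<Omega>"
    unfolding nn_integral_copy_center[OF assms(2) t]
    by (simp add: nn_integral_cmult pe H_def)
  finally show ?thesis .
qed

text \<open>
  Interpolation between \<open>L\<^sup>p\<close> and \<open>L\<^sup>\<infinity>\<close>, from \<open>\<bar>g\<bar>\<^sup>s = (\<bar>g\<bar>\<^sup>p)\<^bsup>(s-p)/p\<^esup> \<bar>g\<bar>\<^sup>p\<close>.
\<close>
lemma nn_integral_powr_interpolate: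
  fixes g :: "'a::euclidean_space \<Rightarrow> real"
  assumes [measurable]: "g \<in> borel_measurable borel" "W \<in> sets borel"
    and p: "1 \<le> p" "p \<le> s" and A: "\<And>x. x \<in> W \<Longrightarrow> \<bar>g x\<bar> powr p \<le> A"
  shows "power_integral s W g
    \<le> ennreal (A powr ((s - p) / p)) * power_integral p W g"
proof -
  have "power_integral s W g
    \<le> (\<integral>\<^sup>+x. ennreal (A powr ((s - p) / p)) * (indicator W x * ennreal (\<bar>g x\<bar> powr p)) \<partial>lborel)"
  proof (rule nn_integral_mono)
    fix x
    have "\<bar>g x\<bar> powr s = (\<bar>g x\<bar> powr p) powr ((s - p) / p) * \<bar>g x\<bar> powr p"
      using p by (simp add: powr_powr powr_add[symmetric])
    also have "\<dots> \<le> A powr ((s - p) / p) * \<bar>g x\<bar> powr p" if "x \<in> W"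
      using A[OF that] p by (intro mult_right_mono powr_mono2) auto
    finally show "indicator W x * ennreal (\<bar>g x\<bar> powr s)
       \<le> ennreal (A powr ((s - p) / p)) * (indicator W x * ennreal (\<bar>g x\<bar> powr p))"
      by (auto simp: indicator_def ennreal_mult[symmetric] intro!: ennreal_leI)
  qed
  then show ?thesis by (simp add: nn_integral_cmult)
qed

section \<open>Comparing averages at scales t and 2t inside a cone\<close>

lemma ennreal_le_divideI:
  assumes "a > 0" "ennreal a * X \<le> ennreal b"
  shows "X \<le> ennreal (b / a)"
proof -
  have "X = ennreal (1 / a) * (ennreal a * X)"
    using assms(1) by (simp add: mult.assoc[symmetric] ennreal_mult[symmetric])
  also have "\<dots> \<le> ennreal (1 / a) * ennreal b"
    using assms(2) by (rule mult_left_mono) simp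
  also have "\<dots> = ennreal (b / a)"
    using assms(1) by (simp add: ennreal_mult'[symmetric])
  finally show ?thesis .
qed

text \<open>
  The bound does not depend on the number of scales, because only the largest one is bounded.  As
  \<open>t\<^bsub>k+1\<^esub>\<^sup>\<gamma> = 2\<^sup>\<gamma> t\<^sub>k\<^sup>\<gamma>\<close>, the sum telescopes.
\<close>
lemma sum_geometric_scales_le:
  fixes t :: "nat \<Rightarrow> real"
  assumes t: "\<And>k. t k > 0" "\<And>k. t (Suc k) = 2 * t k" and M: "t M \<le> 1" and \<gamma>: "\<gamma> > 0"
  shows "(\<Sum>k<M. t k powr \<gamma>) \<le> 1 / (2 powr \<gamma> - 1)"
proof -
  have g: "2 powr \<gamma> > 1" using \<gamma> by simp
  have "(\<Sum>k<M. t k powr \<gamma>) = (\<Sum>k<M. (t (Suc k) powr \<gamma> - t k powr \<gamma>) / (2 powr \<gamma> - 1))"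
  proof (intro sum.cong refl)
    fix k
    have "t (Suc k) powr \<gamma> = 2 powr \<gamma> * t k powr \<gamma>"
      unfolding t(2) using t(1)[of k] by (simp add: powr_mult)
    then show "t k powr \<gamma> = (t (Suc k) powr \<gamma> - t k powr \<gamma>) / (2 powr \<gamma> - 1)"
      using g t(1)[of k] \<gamma> by (simp add: eq_divide_eq algebra_simps)
  qed
  also have "\<dots> = (t M powr \<gamma> - t 0 powr \<gamma>) / (2 powr \<gamma> - 1)"
    unfolding sum_divide_distrib[symmetric]
    using sum_lessThan_telescope[of "\<lambda>k. t k powr \<gamma>" M] by simp
  also have "\<dots> \<le> 1 / (2 powr \<gamma> - 1)"
  proof (rule divide_right_mono)
    have "t M powr \<gamma> \<le> 1 powr \<gamma>" using M t(1)[of M] \<gamma> by (intro powr_mono2) auto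
    then show "t M powr \<gamma> - t 0 powr \<gamma> \<le> 1" using powr_ge_zero[of "t 0" \<gamma>] by (simp add: algebra_simps del: powr_ge_zero)
  qed (use g in simp)
  finally show ?thesis .
qed

lemma ex_dyadic_scale:
  fixes t0 :: real
  assumes "0 < t0" "t0 \<le> 1"
  obtains M :: nat where "t0 * 2 ^ M \<le> 1" "1 / 2 < t0 * 2 ^ M"
proof -
  obtain n where n: "1 / t0 < 2 ^ n" using real_arch_pow[of 2 "1 / t0"] by auto
  define k where "k = (LEAST n. 1 / t0 < (2::real) ^ n)"
  have k: "1 / t0 < 2 ^ k" unfolding k_def using n by (rule LeastI)
  have "k \<noteq> 0" using k assms by (intro notI) (simp add: field_simps)
  then obtain M where M: "k = Suc M" by (cases k) auto
  have "\<not> 1 / t0 < 2 ^ M" unfolding k_def using M k_def by (intro not_less_Least) auto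
  then have "t0 * 2 ^ M \<le> 1" using assms by (simp add: field_simps)
  moreover have "1 / 2 < t0 * 2 ^ M" using k assms unfolding M by (simp add: field_simps)
  ultimately show ?thesis using that by blast
qed

text \<open>
  The set \<open>K\<close> is in practice a truncated open cone with apex \<open>0\<close>, or a ball around \<open>0\<close>, which fits into
  \<open>\<Omega>\<close> when attached to any point of \<open>W\<close>.  The condition \<open>shrink\<close> makes the copies \<open>x + t K\<close> increase
  with \<open>t\<close>, so that all of them with \<open>t \<le> 1\<close> lie in \<open>\<Omega>\<close> and two consecutive ones lie in a common
  convex set.
\<close>
locale interior_cone =
  fixes \<Omega> W K :: "'a::euclidean_space set" and R :: real
  assumes borel [measurable]: "\<Omega> \<in> sets borel" "W \<in> sets borel"
    and bounded_\<Omega>: "bounded \<Omega>" and W_subset: "W \<subseteq> \<Omega>"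
    and open_K: "open K" and convex_K: "convex K" and nonempty: "K \<noteq> {}" and K_ball: "K \<subseteq> ball 0 R"
    and shrink: "\<And>v t. v \<in> K \<Longrightarrow> 0 < t \<Longrightarrow> t \<le> 1 \<Longrightarrow> t *\<^sub>R v \<in> K"
    and into: "\<And>x v. x \<in> W \<Longrightarrow> v \<in> K \<Longrightarrow> x + v \<in> \<Omega>"
begin

abbreviation "V \<equiv> measure lborel K"

lemma R_pos: "R > 0"
proof -
  obtain v where "v \<in> K" using nonempty by blast
  then have "norm v < R" using K_ball by auto
  then show ?thesis using norm_ge_zero[of v] by linarith
qed

lemma K_borel [measurable]: "K \<in> sets borel"
  using open_K by simp

lemma emeasure_K: "emeasure lborel K = ennreal V"
proof -
  have "emeasure lborel K < \<infinity>"
    using K_ball bounded_ball bounded_subset emeasure_bounded_finite by blast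
  then show ?thesis by (simp add: emeasure_eq_ennreal_measure)
qed

lemma V_pos: "V > 0"
proof -
  obtain v e where "e > 0" "ball v e \<subseteq> K" using nonempty open_K openE by blast
  moreover have "K \<in> fmeasurable lborel"
    by (rule fmeasurableI) (simp_all add: emeasure_K)
  ultimately have "measure lborel (ball v e) \<le> V"
    by (intro measure_mono_fmeasurable) auto
  moreover have "measure lborel (ball v e) > 0" using \<open>e > 0\<close> by simp
  ultimately show ?thesis by linarith
qed

lemma emeasure_copy_K: "t > 0 \<Longrightarrow> emeasure lborel (copy K x t) = ennreal (t ^ DIM('a) * V)"
  by (simp add: emeasure_copy emeasure_K ennreal_mult')

lemma copy_fin_pos:
  assumes "t > 0"
  shows "emeasure lborel (copy K x t) < \<infinity>" "emeasure lborel (copy K x t) > 0"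
  using assms V_pos by (simp_all add: emeasure_copy_K)

lemma copy_subset_copy:
  assumes "0 < t" "t \<le> u"
  shows "copy K x t \<subseteq> copy K x u"
proof
  fix y assume "y \<in> copy K x t"
  then have "(1 / t) *\<^sub>R (y - x) \<in> K" by (simp only: copy_def mem_Collect_eq)
  then have "(t / u) *\<^sub>R ((1 / t) *\<^sub>R (y - x)) \<in> K"
    by (rule shrink) (use assms in auto)
  moreover have "(t / u) *\<^sub>R ((1 / t) *\<^sub>R (y - x)) = (1 / u) *\<^sub>R (y - x)" using assms by simp
  ultimately show "y \<in> copy K x u" by (simp only: copy_def mem_Collect_eq)
qed

lemma copy_subset:
  assumes "x \<in> W" "0 < t" "t \<le> 1"
  shows "copy K x t \<subseteq> \<Omega>"
proof
  fix y assume "y \<in> copy K x t"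
  then have "y \<in> copy K x 1" using copy_subset_copy assms by blast
  then show "y \<in> \<Omega>" using into[OF assms(1), of "y - x"] unfolding copy_def by simp
qed

lemma copy_dist:
  assumes "y \<in> copy K x t" "t > 0"
  shows "norm (y - x) < R * t"
proof -
  have "norm ((1 / t) *\<^sub>R (y - x)) < R" using assms K_ball unfolding copy_def by auto
  then have "norm (y - x) / t < R" using assms(2) unfolding norm_scaleR by simp
  then show ?thesis using assms(2) by (simp add: pos_divide_less_eq)
qed

text \<open>
  Both averages are taken over parts of the convex set \<open>x + 2t K\<close>, whose diameter is at most \<open>4 R t = N \<tau>\<close>.
  Hence all of its pairs are counted in its energy at distance \<open>N \<tau>\<close>, and the chain inequality reduces
  this to distance \<open>\<tau>\<close>.
\<close>
lemma mean_double_pointwise: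
  fixes N :: nat and p E \<tau> M :: real
  assumes [measurable]: "f \<in> borel_measurable borel" and bd: "\<And>x. \<bar>f x\<bar> \<le> M" and p: "p \<ge> 1"
    and t: "t > 0" and N: "N > 0" "4 * R * t = real N * \<tau>"
  shows "ennreal (t ^ DIM('a) * V * ((2 * t) ^ DIM('a) * V))
      * ennreal (\<bar>mean f (copy K x t) - mean f (copy K x (2 * t))\<bar> powr p)
    \<le> ennreal (real N powr (p + DIM('a))) * pair_energy p \<tau> f (copy K x (2 * t))"
proof -
  let ?P = "copy K x t" and ?Q = "copy K x (2 * t)"
  have "emeasure lborel ?P * emeasure lborel ?Q * ennreal (\<bar>mean f ?P - mean f ?Q\<bar> powr p)
    \<le> (\<integral>\<^sup>+w. \<integral>\<^sup>+z. indicator ?Q w * indicator ?P z * ennreal (\<bar>f w - f z\<bar> powr p) \<partial>lborel \<partial>lborel)"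
    using t by (intro mean_diff_mean_powr_le[where M=M] copy_fin_pos bd p) auto
  also have "\<dots> \<le> pair_energy p (real N * \<tau>) f ?Q"
    unfolding pair_energy_def
  proof (intro nn_integral_mono)
    fix w z
    show "indicator ?Q w * indicator ?P z * ennreal (\<bar>f w - f z\<bar> powr p)
      \<le> indicator ?Q w * indicator ?Q z * indicator {v. norm v < real N * \<tau>} (z - w)
        * ennreal (\<bar>f w - f z\<bar> powr p)"
    proof (cases "w \<in> ?Q \<and> z \<in> ?P")
      case True
      then have z: "z \<in> ?Q" using copy_subset_copy[of t "2 * t"] t by auto
      have "norm (z - w) \<le> norm (z - x) + norm (w - x)"
        using norm_triangle_ineq4[of "z - x" "w - x"] by simp
      also have "\<dots> < R * (2 * t) + R * (2 * t)"
        using copy_dist[OF z] copy_dist[of w x "2 * t"] True t by (intro add_strict_mono) auto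
      finally have "norm (z - w) < real N * \<tau>" using N by simp
      then show ?thesis using True z by simp
    qed auto
  qed
  also have "\<dots> \<le> ennreal (real N powr p * real N ^ DIM('a)) * pair_energy p \<tau> f ?Q"
    by (intro pair_energy_chain convex_copy convex_K p N) auto
  also have "real N powr p * real N ^ DIM('a) = real N powr (p + DIM('a))"
    using N by (simp add: powr_add powr_realpow)
  finally show ?thesis using t V_pos by (simp add: emeasure_copy_K ennreal_mult)
qed

text \<open>
  The constants of the uniform estimate and of the \<open>L\<^sup>p\<close> estimate for the difference of the averages at
  the scales \<open>t\<close> and \<open>2 t\<close>.
\<close>
definition C_sup :: "real \<Rightarrow> real \<Rightarrow> real" where "C_sup p E = E * (4 * R) powr (p + DIM('a)) / (2 ^ DIM('a) * V\<^sup>2)"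
definition C_int :: "real \<Rightarrow> real \<Rightarrow> real" where "C_int p E = E * (4 * R) powr (p + DIM('a)) / V"

text \<open>
  With the energy of \<open>x + 2t K\<close> bounded by the total energy of \<open>\<Omega>\<close>, the difference is at most a multiple of
  \<open>t\<^bsup>1-d/p\<^esup>\<close>, as in Morrey's argument.
\<close>
lemma mean_double_sup:
  fixes N :: nat and p E \<tau> M :: real
  assumes [measurable]: "f \<in> borel_measurable borel" and bd: "\<And>x. \<bar>f x\<bar> \<le> M" and p: "p \<ge> 1"
    and t: "t > 0" "2 * t \<le> 1" and N: "N > 0" "4 * R * t = real N * \<tau>" and x: "x \<in> W"
    and E: "pair_energy p \<tau> f \<Omega> \<le> ennreal (E * \<tau> powr (p + DIM('a)))" "E \<ge> 0" and \<tau>: "\<tau> > 0"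
  shows "\<bar>mean f (copy K x t) - mean f (copy K x (2 * t))\<bar> powr p \<le> C_sup p E * t powr (p - DIM('a))"
proof -
  let ?d = "DIM('a)"
  define g where "g = \<bar>mean f (copy K x t) - mean f (copy K x (2 * t))\<bar> powr p"
  have "ennreal (t ^ ?d * V * ((2 * t) ^ ?d * V)) * ennreal g
    \<le> ennreal (real N powr (p + ?d)) * pair_energy p \<tau> f (copy K x (2 * t))"
    unfolding g_def by (rule mean_double_pointwise[where f=f and M=M, OF assms(1) bd p t(1) N])
  also have "\<dots> \<le> ennreal (real N powr (p + ?d)) * ennreal (E * \<tau> powr (p + ?d))"
    using pair_energy_mono[OF copy_subset[OF x, of "2 * t"] order.refl, of p \<tau> f] t E
    by (intro mult_left_mono) auto
  also have "\<dots> = ennreal (E * (4 * R * t) powr (p + ?d))"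
    unfolding N(2) using E \<tau> N by (simp add: ennreal_mult'[symmetric] powr_mult mult_ac)
  finally have "ennreal g \<le> ennreal (E * (4 * R * t) powr (p + ?d) / (t ^ ?d * V * ((2 * t) ^ ?d * V)))"
    using t V_pos by (intro ennreal_le_divideI) auto
  moreover have "E * (4 * R * t) powr (p + ?d) / (t ^ ?d * V * ((2 * t) ^ ?d * V)) = C_sup p E * t powr (p - ?d)"
    using t R_pos V_pos unfolding C_sup_def
    by (simp add: powr_mult powr_add powr_diff powr_realpow power_mult_distrib power2_eq_square mult_ac)
  ultimately show ?thesis
    using R_pos E(2) unfolding g_def by (simp add: C_sup_def ennreal_le_iff)
qed

text \<open>
  Integrating over \<open>x\<close> first gains the volume \<open>t\<^sup>d\<close> of the copies compared to the uniform estimate, which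
  gives the order \<open>t\<close> in \<open>L\<^sup>p\<close>.
\<close>
lemma mean_double_int:
  fixes N :: nat and p E \<tau> M :: real
  assumes [measurable]: "f \<in> borel_measurable borel" and bd: "\<And>x. \<bar>f x\<bar> \<le> M" and p: "p \<ge> 1"
    and t: "t > 0" "2 * t \<le> 1" and N: "N > 0" "4 * R * t = real N * \<tau>"
    and E: "pair_energy p \<tau> f \<Omega> \<le> ennreal (E * \<tau> powr (p + DIM('a)))" "E \<ge> 0" and \<tau>: "\<tau> > 0"
  shows "(\<integral>\<^sup>+x. indicator W x *
      ennreal (\<bar>mean f (copy K x t) - mean f (copy K x (2 * t))\<bar> powr p) \<partial>lborel)
     \<le> ennreal (C_int p E * t powr p)" (is "?I \<le> _")
proof -
  let ?d = "DIM('a)"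
  have [measurable]: "(\<lambda>x. mean f (copy K x t)) \<in> borel_measurable borel"
    "(\<lambda>x. mean f (copy K x (2 * t))) \<in> borel_measurable borel" using t by auto
  have "ennreal (t ^ ?d * V * ((2 * t) ^ ?d * V)) * ?I
     = (\<integral>\<^sup>+x. indicator W x * (ennreal (t ^ ?d * V * ((2 * t) ^ ?d * V)) *
      ennreal (\<bar>mean f (copy K x t) - mean f (copy K x (2 * t))\<bar> powr p)) \<partial>lborel)"
    by (subst nn_integral_cmult[symmetric]) (measurable, simp add: mult.left_commute)
  also have "\<dots> \<le> (\<integral>\<^sup>+x. indicator W x * (ennreal (real N powr (p + ?d)) *
      pair_energy p \<tau> f (copy K x (2 * t))) \<partial>lborel)"
    by (intro nn_integral_mono mult_left_mono mean_double_pointwise[where f=f and M=M, OF assms(1) bd p t(1) N]) auto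
  also have "\<dots> = ennreal (real N powr (p + ?d)) *
      (\<integral>\<^sup>+x. indicator W x * pair_energy p \<tau> f (copy K x (2 * t)) \<partial>lborel)"
    by (subst nn_integral_cmult[symmetric]) (auto simp: mult_ac)
  also have "\<dots> \<le> ennreal (real N powr (p + ?d)) *
      (ennreal ((2 * t) ^ ?d) * emeasure lborel K * pair_energy p \<tau> f \<Omega>)"
    using t by (intro mult_left_mono nn_integral_pair_energy_copy_le copy_subset) auto
  also have "\<dots> \<le> ennreal (real N powr (p + ?d)) *
      (ennreal ((2 * t) ^ ?d) * ennreal V * ennreal (E * \<tau> powr (p + ?d)))"
    unfolding emeasure_K by (intro mult_left_mono E) auto
  also have "\<dots> = ennreal ((2 * t) ^ ?d * V * (E * (4 * R * t) powr (p + ?d)))"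
    unfolding N(2) using E \<tau> N t by (simp add: ennreal_mult'[symmetric] powr_mult mult_ac)
  finally have "?I \<le> ennreal ((2 * t) ^ ?d * V * (E * (4 * R * t) powr (p + ?d)) / (t ^ ?d * V * ((2 * t) ^ ?d * V)))"
    using t V_pos by (intro ennreal_le_divideI) auto
  also have "(2 * t) ^ ?d * V * (E * (4 * R * t) powr (p + ?d)) / (t ^ ?d * V * ((2 * t) ^ ?d * V)) = C_int p E * t powr p"
    using t R_pos V_pos unfolding C_int_def
    by (simp add: powr_mult powr_add powr_realpow power_mult_distrib)
  finally show ?thesis .
qed

text \<open>
  At the finest scale no chain is needed: the copy already lies within distance \<open>\<tau>\<close> of \<open>x\<close>.
\<close>
lemma base_pointwise:
  assumes [measurable]: "f \<in> borel_measurable borel" and bd: "\<And>x. \<bar>f x\<bar> \<le> M" and p: "p \<ge> 1"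
    and t: "t > 0" "t \<le> 1" "R * t \<le> \<tau>" and x: "x \<in> W"
  shows "ennreal (t ^ DIM('a) * V) * ennreal (\<bar>f x - mean f (copy K x t)\<bar> powr p)
    \<le> point_energy p \<tau> f \<Omega> x"
proof -
  have "ennreal (t ^ DIM('a) * V) * ennreal (\<bar>f x - mean f (copy K x t)\<bar> powr p)
     \<le> power_integral p (copy K x t) (\<lambda>z. f x - f z)"
    unfolding emeasure_copy_K[OF t(1), of x, symmetric]
    using t by (intro mean_diff_powr_le[where M=M] copy_fin_pos bd p) auto
  also have "\<dots> \<le> point_energy p \<tau> f \<Omega> x"
    using copy_subset[OF x t(1,2)] copy_dist[of _ x t] t
    by (intro nn_integral_mono mult_right_mono) (force simp: indicator_def)+
  finally show ?thesis .
qed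

lemma top_pointwise:
  assumes [measurable]: "f \<in> borel_measurable borel" and bd: "\<And>x. \<bar>f x\<bar> \<le> M" and p: "p \<ge> 1"
    and t: "1 / 2 < t" "t \<le> 1" and x: "x \<in> W"
    and B: "power_integral p \<Omega> f \<le> ennreal B" and B0: "B \<ge> 0"
  shows "\<bar>mean f (copy K x t)\<bar> powr p \<le> B * 2 ^ DIM('a) / V"
proof -
  have t0: "t > 0" using t by simp
  have "ennreal (t ^ DIM('a) * V) * ennreal (\<bar>0 - mean f (copy K x t)\<bar> powr p)
     \<le> power_integral p (copy K x t) (\<lambda>z. 0 - f z)"
    unfolding emeasure_copy_K[OF t0, of x, symmetric]
    using t by (intro mean_diff_powr_le[where M=M] copy_fin_pos bd p) auto
  also have "\<dots> \<le> power_integral p \<Omega> f"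
    using copy_subset[OF x, of t] t
    by (intro nn_integral_mono) (auto simp: indicator_def)
  also note B
  finally have "ennreal (\<bar>mean f (copy K x t)\<bar> powr p) \<le> ennreal (B / (t ^ DIM('a) * V))"
    using t V_pos by (intro ennreal_le_divideI) auto
  then have "\<bar>mean f (copy K x t)\<bar> powr p \<le> B / (t ^ DIM('a) * V)"
    using t V_pos B0 by (simp add: ennreal_le_iff)
  also have "\<dots> \<le> B / ((1 / 2) ^ DIM('a) * V)"
    using t V_pos B0 by (intro divide_left_mono mult_right_mono power_mono mult_pos_pos) auto
  also have "\<dots> = B * 2 ^ DIM('a) / V" by (simp add: power_divide)
  finally show ?thesis .
qed

end

section \<open>Higher integrability on a set with an interior cone\<close>

text \<open>
  The number \<open>A\<close> measures how concentrated the energy can be at a single point.  It may blow up as \<open>\<tau>\<close>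
  tends to \<open>0\<close>, at a rate limited by \<open>B0\<close>.
\<close>
definition nonlocal_bounds ::
  "real \<Rightarrow> real \<Rightarrow> real \<Rightarrow> real \<Rightarrow> real \<Rightarrow> 'a::euclidean_space set \<Rightarrow> ('a \<Rightarrow> real) \<Rightarrow> real \<Rightarrow> bool" where
  "nonlocal_bounds p s E B B0 \<Omega> f \<tau> \<longleftrightarrow>
     f \<in> borel_measurable borel \<and> (\<exists>M. \<forall>x. \<bar>f x\<bar> \<le> M) \<and> 0 < \<tau> \<and>
     pair_energy p \<tau> f \<Omega> \<le> ennreal (E * \<tau> powr (p + DIM('a))) \<and>
     power_integral p \<Omega> f \<le> ennreal B \<and>
     (\<exists>A\<ge>0. A powr ((s - p) / p) * \<tau> powr p \<le> B0 \<and>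
        (\<forall>x\<in>\<Omega>. point_energy p \<tau> f \<Omega> x
          \<le> ennreal (A * \<tau> ^ DIM('a))))"

context interior_cone
begin

text \<open>
  With \<open>a\<^sub>k x\<close> the average over \<open>x + t\<^sub>k K\<close> and \<open>t\<^sub>k = 2\<^sup>k \<tau> / (4 R)\<close>, the function is the sum of \<open>f - a\<^sub>0\<close>, of the
  differences \<open>a\<^sub>k - a\<^bsub>k+1\<^esub>\<close> and of an average \<open>a\<^sub>m\<close> at a scale of order \<open>1\<close>.  Interpolation gives
  \<open>\<integral>\<^sub>W \<bar>a\<^sub>k - a\<^bsub>k+1\<^esub>\<bar>\<^sup>s \<le> C t\<^sub>k\<^sup>\<beta>\<close>, where \<open>\<beta> = (p - d) (s - p) / p + p\<close> is positive, for \<open>p < d\<close>, exactly when \<open>s\<close>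
  is below the Sobolev exponent \<open>dp/(d-p)\<close>.  The pointwise bound \<open>A \<tau>\<^sup>d\<close> for \<open>\<integral> \<bar>f x - f z\<bar>\<^sup>p dz\<close> over the points at
  distance less than \<open>\<tau>\<close> does for \<open>f - a\<^sub>0\<close> what the uniform estimate does for the other differences.
\<close>
theorem powr_integral_bound:
  fixes p s E B B0 :: real
  assumes p: "1 \<le> p" "p \<le> s" and \<beta>: "(p - DIM('a)) * ((s - p) / p) + p > 0"
    and nonneg: "E \<ge> 0" "B \<ge> 0" "B0 \<ge> 0"
  shows "\<exists>C\<ge>0. \<forall>f \<tau>. nonlocal_bounds p s E B B0 \<Omega> f \<tau> \<longrightarrow> \<tau> \<le> 4 * R \<longrightarrow>
      power_integral s W f \<le> ennreal C"
proof -
  let ?d = "DIM('a)"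
  define \<theta> where "\<theta> = (s - p) / p"
  define \<beta>' where "\<beta>' = (p - ?d) * \<theta> + p"
  define \<gamma> where "\<gamma> = \<beta>' / s"
  have \<gamma>: "\<gamma> > 0" and \<theta>0: "\<theta> \<ge> 0" using \<beta> p by (auto simp: \<gamma>_def \<beta>'_def \<theta>_def)
  have \<gamma>\<beta>: "\<gamma> * (1 - s) + \<beta>' = \<gamma>" using p by (simp add: \<gamma>_def field_simps)
  \<comment> \<open>\<open>\<tau>\<^sup>d / c\<close> is the volume of a copy at the finest scale \<open>t\<^sub>0 = \<tau> / (4 R)\<close>.\<close>
  define c where "c = (4 * R) ^ ?d / V"
  have c: "c > 0" using R_pos V_pos by (simp add: c_def)
  define C1 where "C1 = c powr \<theta> * (E * c * B0)"
  define C2 where "C2 = C_sup p E powr \<theta> * C_int p E"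
  define Z where "Z = 1 / (2 powr \<gamma> - 1)"
  have Z: "Z \<ge> 0" using \<gamma> ge_one_powr_ge_zero[of 2 \<gamma>] by (simp add: Z_def)
  define Ctop where "Ctop = (B * 2 ^ ?d / V) powr (s / p)"
  define VO where "VO = measure lborel \<Omega>"
  have VO: "emeasure lborel \<Omega> = ennreal VO"
    using emeasure_bounded_finite[OF bounded_\<Omega>] by (simp add: VO_def emeasure_eq_ennreal_measure)
  have C_sup0: "C_sup p E \<ge> 0" "C_int p E \<ge> 0" using nonneg R_pos V_pos by (auto simp: C_sup_def C_int_def)
  have C12: "C1 \<ge> 0" "C2 \<ge> 0" "Ctop \<ge> 0" "VO \<ge> 0"
    using nonneg c C_sup0 by (auto simp: C1_def C2_def Ctop_def VO_def)
  define C where "C = 3 powr (s - 1) * (C1 + (Z powr (s - 1) * (C2 * Z) + Ctop * VO))"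
  have C0: "C \<ge> 0" using C12 Z by (simp add: C_def)
  show ?thesis
  proof (intro exI[of _ C] conjI allI impI C0)
    fix f \<tau>
    assume nb: "nonlocal_bounds p s E B B0 \<Omega> f \<tau>" and \<tau>_le: "\<tau> \<le> 4 * R"
    have [measurable]: "f \<in> borel_measurable borel"
      and PE: "pair_energy p \<tau> f \<Omega> \<le> ennreal (E * \<tau> powr (p + ?d))"
      and FB: "power_integral p \<Omega> f \<le> ennreal B"
      and \<tau>: "0 < \<tau>" "\<tau> \<le> 4 * R"
      using nb \<tau>_le unfolding nonlocal_bounds_def by blast+
    obtain M where bd': "\<forall>x. \<bar>f x\<bar> \<le> M" using nb unfolding nonlocal_bounds_def by blast
    obtain A where A0: "0 \<le> A" and AB: "A powr ((s - p) / p) * \<tau> powr p \<le> B0"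
      and A: "\<forall>x\<in>\<Omega>. point_energy p \<tau> f \<Omega> x
          \<le> ennreal (A * \<tau> ^ ?d)"
      using nb unfolding nonlocal_bounds_def by blast
    have bd: "\<bar>f x\<bar> \<le> M" for x using bd' by blast
    define t0 where "t0 = \<tau> / (4 * R)"
    have t0: "0 < t0" "t0 \<le> 1" using \<tau> R_pos by (auto simp: t0_def)
    obtain m where m: "t0 * 2 ^ m \<le> 1" "1 / 2 < t0 * 2 ^ m" using ex_dyadic_scale[OF t0] .
    define t where "t k = t0 * 2 ^ k" for k :: nat
    have t_pos: "t k > 0" for k using t0 by (simp add: t_def)
    have t_Suc: "t (Suc k) = 2 * t k" for k by (simp add: t_def)
    have t_le: "t k \<le> 1" if "k \<le> m" for k
    proof -
      have "t k \<le> t m" unfolding t_def using that t0 by (intro mult_left_mono power_increasing) auto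
      then show ?thesis using m by (simp add: t_def)
    qed
    define a where "a k x = mean f (copy K x (t k))" for k x
    have [measurable]: "a k \<in> borel_measurable borel" for k
      unfolding a_def using t_pos by measurable
    define g where "g k x = a k x - a (Suc k) x" for k x
    have [measurable]: "g k \<in> borel_measurable borel" for k
      unfolding g_def by measurable

    have base: "power_integral s W (\<lambda>x. f x - a 0 x) \<le> ennreal C1"
    proof -
      have tV: "t 0 ^ ?d * V = \<tau> ^ ?d / c"
        using R_pos V_pos by (simp add: t_def t0_def c_def power_divide)
      have ptw: "ennreal (\<tau> ^ ?d / c) * ennreal (\<bar>f x - a 0 x\<bar> powr p)
        \<le> point_energy p \<tau> f \<Omega> x"
        if "x \<in> W" for x
        unfolding a_def tV[symmetric] using t_pos t_le[of 0] bd p that R_pos \<tau>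
        by (intro base_pointwise[where M=M]) (auto simp: t_def t0_def)
      have sup: "\<bar>f x - a 0 x\<bar> powr p \<le> c * A" if "x \<in> W" for x
      proof -
        have "ennreal (\<tau> ^ ?d / c) * ennreal (\<bar>f x - a 0 x\<bar> powr p) \<le> ennreal (A * \<tau> ^ ?d)"
          using order.trans[OF ptw[OF that]] A W_subset that by blast
        then have "ennreal (\<bar>f x - a 0 x\<bar> powr p) \<le> ennreal (A * \<tau> ^ ?d / (\<tau> ^ ?d / c))"
          using \<tau> c by (intro ennreal_le_divideI) auto
        also have "A * \<tau> ^ ?d / (\<tau> ^ ?d / c) = c * A" using \<tau> by simp
        finally show ?thesis using c A0 by (simp add: ennreal_le_iff)
      qed
      have int: "power_integral p W (\<lambda>x. f x - a 0 x) \<le> ennreal (E * c * \<tau> powr p)"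
      proof -
        have "ennreal (\<tau> ^ ?d / c) * power_integral p W (\<lambda>x. f x - a 0 x)
          = (\<integral>\<^sup>+x. indicator W x * (ennreal (\<tau> ^ ?d / c) * ennreal (\<bar>f x - a 0 x\<bar> powr p)) \<partial>lborel)"
          by (subst nn_integral_cmult[symmetric]) (measurable, simp add: mult.left_commute)
        also have "\<dots> \<le> pair_energy p \<tau> f \<Omega>"
          unfolding pair_energy_def
        proof (rule nn_integral_mono)
          fix x
          show "indicator W x * (ennreal (\<tau> ^ ?d / c) * ennreal (\<bar>f x - a 0 x\<bar> powr p))
            \<le> (\<integral>\<^sup>+y. indicator \<Omega> x * indicator \<Omega> y * indicator {v. norm v < \<tau>} (y - x) * ennreal (\<bar>f x - f y\<bar> powr p) \<partial>lborel)"
            using ptw[of x] W_subset by (cases "x \<in> W") auto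
        qed
        also note PE
        finally have "power_integral p W (\<lambda>x. f x - a 0 x)
            \<le> ennreal (E * \<tau> powr (p + ?d) / (\<tau> ^ ?d / c))"
          using \<tau> c by (intro ennreal_le_divideI) auto
        also have "E * \<tau> powr (p + ?d) / (\<tau> ^ ?d / c) = E * c * \<tau> powr p"
          using \<tau> by (simp add: powr_add powr_realpow)
        finally show ?thesis .
      qed
      have "power_integral s W (\<lambda>x. f x - a 0 x)
        \<le> ennreal ((c * A) powr \<theta>) * power_integral p W (\<lambda>x. f x - a 0 x)"
        unfolding \<theta>_def using p sup by (intro nn_integral_powr_interpolate) auto
      also have "\<dots> \<le> ennreal ((c * A) powr \<theta>) * ennreal (E * c * \<tau> powr p)"
        by (intro mult_left_mono int) simp
      also have "\<dots> = ennreal (c powr \<theta> * (E * c * (A powr \<theta> * \<tau> powr p)))"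
        using c A0 nonneg by (simp add: ennreal_mult'[symmetric] powr_mult mult_ac)
      also have "\<dots> \<le> ennreal C1"
        unfolding C1_def using AB c nonneg by (intro ennreal_leI mult_left_mono) (auto simp: \<theta>_def)
      finally show ?thesis .
    qed

    have step: "power_integral s W (g k) \<le> ennreal (C2 * t k powr \<beta>')"
      if k: "k < m" for k
    proof -
      \<comment> \<open>Here \<open>4 R t\<^sub>k = 2\<^sup>k \<tau>\<close>, so chains of \<open>2\<^sup>k\<close> steps of length less than \<open>\<tau>\<close> suffice.\<close>
      have N: "(2::nat) ^ k > 0" "4 * R * t k = real (2 ^ k) * \<tau>"
        using R_pos by (auto simp: t_def t0_def)
      have t2: "2 * t k \<le> 1" using t_le[of "Suc k"] k by (simp add: t_Suc)
      have sup: "\<bar>g k x\<bar> powr p \<le> C_sup p E * t k powr (p - ?d)" if "x \<in> W" for x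
        unfolding g_def a_def t_Suc using bd that
        by (intro mean_double_sup[OF _ _ p(1) t_pos t2 N _ PE nonneg(1) \<tau>(1), where M=M]) auto
      have int: "power_integral p W (g k) \<le> ennreal (C_int p E * t k powr p)"
        unfolding g_def a_def t_Suc using bd
        by (intro mean_double_int[OF _ _ p(1) t_pos t2 N PE nonneg(1) \<tau>(1), where M=M]) auto
      have "power_integral s W (g k)
        \<le> ennreal ((C_sup p E * t k powr (p - ?d)) powr \<theta>) * power_integral p W (g k)"
        unfolding \<theta>_def using p sup by (intro nn_integral_powr_interpolate) auto
      also have "\<dots> \<le> ennreal ((C_sup p E * t k powr (p - ?d)) powr \<theta>) * ennreal (C_int p E * t k powr p)"
        by (intro mult_left_mono int) simp
      also have "\<dots> = ennreal (C2 * t k powr \<beta>')"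
        using C_sup0 by (simp add: ennreal_mult'[symmetric] powr_mult powr_powr C2_def \<beta>'_def powr_add mult_ac)
      finally show ?thesis .
    qed

    have Zsum: "(\<Sum>k<m. t k powr \<gamma>) \<le> Z"
      unfolding Z_def using t_pos t_Suc t_le[of m] \<gamma> by (intro sum_geometric_scales_le) auto
    have tele: "power_integral s W (\<lambda>x. \<Sum>k<m. g k x)
        \<le> ennreal (Z powr (s - 1) * (C2 * Z))"
    proof -
      have "power_integral s W (\<lambda>x. \<Sum>k<m. g k x)
        \<le> (\<integral>\<^sup>+x. ennreal (Z powr (s - 1)) * (\<Sum>k<m. ennreal (t k powr (\<gamma> * (1 - s))) * (indicator W x * ennreal (\<bar>g k x\<bar> powr s))) \<partial>lborel)"
      proof (rule nn_integral_mono)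
        fix x
        \<comment> \<open>Jensen with the weights \<open>t\<^sub>k\<^sup>\<gamma>\<close>, \<open>\<gamma> = \<beta> / s\<close>: they are summable uniformly in \<open>m\<close>, and the powers
           of \<open>t\<^sub>k\<close> combine to \<open>t\<^sub>k\<^sup>\<gamma>\<close> again.\<close>
        have "\<bar>\<Sum>k<m. g k x\<bar> powr s
            \<le> (\<Sum>k<m. t k powr \<gamma>) powr (s - 1) * (\<Sum>k<m. (t k powr \<gamma>) powr (1 - s) * \<bar>g k x\<bar> powr s)"
          using p t_pos by (intro abs_sum_powr_le) (auto simp: less_imp_neq[symmetric])
        also have "\<dots> \<le> Z powr (s - 1) * (\<Sum>k<m. t k powr (\<gamma> * (1 - s)) * \<bar>g k x\<bar> powr s)"
          using p Zsum unfolding powr_powr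
          by (intro mult_right_mono powr_mono2 sum_nonneg) (auto intro!: sum_nonneg)
        finally have "ennreal (\<bar>\<Sum>k<m. g k x\<bar> powr s)
           \<le> ennreal (Z powr (s - 1)) * (\<Sum>k<m. ennreal (t k powr (\<gamma> * (1 - s))) * ennreal (\<bar>g k x\<bar> powr s))"
          by (simp add: ennreal_mult'[symmetric] sum_nonneg ennreal_leI)
        then show "indicator W x * ennreal (\<bar>\<Sum>k<m. g k x\<bar> powr s)
          \<le> ennreal (Z powr (s - 1)) * (\<Sum>k<m. ennreal (t k powr (\<gamma> * (1 - s))) * (indicator W x * ennreal (\<bar>g k x\<bar> powr s)))"
          by (cases "x \<in> W") auto
      qed
      also have "\<dots> = ennreal (Z powr (s - 1)) * (\<Sum>k<m. ennreal (t k powr (\<gamma> * (1 - s))) *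
          power_integral s W (g k))"
        by (simp add: nn_integral_cmult nn_integral_sum)
      also have "\<dots> \<le> ennreal (Z powr (s - 1)) * (\<Sum>k<m. ennreal (t k powr (\<gamma> * (1 - s))) * ennreal (C2 * t k powr \<beta>'))"
        by (intro mult_left_mono sum_mono step) auto
      also have "\<dots> = ennreal (Z powr (s - 1) * (\<Sum>k<m. C2 * t k powr \<gamma>))"
      proof -
        have eq: "t k powr (\<gamma> * (1 - s)) * (C2 * t k powr \<beta>') = C2 * t k powr \<gamma>" for k
          using powr_add[of "t k" "\<gamma> * (1 - s)" \<beta>'] unfolding \<gamma>\<beta> by (simp add: mult_ac)
        have "ennreal (t k powr (\<gamma> * (1 - s))) * ennreal (C2 * t k powr \<beta>') = ennreal (C2 * t k powr \<gamma>)" for k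
          unfolding eq[of k, symmetric] by (rule ennreal_mult'[symmetric]) simp
        then have "(\<Sum>k<m. ennreal (t k powr (\<gamma> * (1 - s))) * ennreal (C2 * t k powr \<beta>'))
            = ennreal (\<Sum>k<m. C2 * t k powr \<gamma>)"
          using C12 by (simp only: sum_ennreal mult_nonneg_nonneg powr_ge_zero)
        then show ?thesis by (simp only: ennreal_mult' powr_ge_zero)
      qed
      also have "\<dots> \<le> ennreal (Z powr (s - 1) * (C2 * Z))"
        unfolding sum_distrib_left[symmetric]
        using Zsum C12 by (intro ennreal_leI mult_left_mono) auto
      finally show ?thesis .
    qed

    have top: "power_integral s W (a m) \<le> ennreal (Ctop * VO)"
    proof -
      have "power_integral s W (a m) \<le> (\<integral>\<^sup>+x. ennreal Ctop * indicator \<Omega> x \<partial>lborel)"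
      proof (rule nn_integral_mono)
        fix x
        show "indicator W x * ennreal (\<bar>a m x\<bar> powr s) \<le> ennreal Ctop * indicator \<Omega> x"
        proof (cases "x \<in> W")
          case True
          have "\<bar>a m x\<bar> powr p \<le> B * 2 ^ ?d / V"
            unfolding a_def using m t_le[of m] p bd True FB nonneg
            by (intro top_pointwise[where M=M]) (auto simp: t_def)
          then have "(\<bar>a m x\<bar> powr p) powr (s / p) \<le> Ctop"
            unfolding Ctop_def using p by (intro powr_mono2) auto
          moreover have "(\<bar>a m x\<bar> powr p) powr (s / p) = \<bar>a m x\<bar> powr s" using p by (simp add: powr_powr)
          ultimately show ?thesis using True W_subset by (auto intro!: ennreal_leI)
        qed simp
      qed
      also have "\<dots> = ennreal (Ctop * VO)"
        using C12 by (simp add: nn_integral_cmult_indicator VO ennreal_mult)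
      finally show ?thesis .
    qed

    have "power_integral s W f
      \<le> (\<integral>\<^sup>+x. ennreal (3 powr (s - 1)) * (indicator W x * ennreal (\<bar>f x - a 0 x\<bar> powr s)
          + (indicator W x * ennreal (\<bar>\<Sum>k<m. g k x\<bar> powr s) + indicator W x * ennreal (\<bar>a m x\<bar> powr s))) \<partial>lborel)"
    proof (rule nn_integral_mono)
      fix x
      define h where "h i = (if i = 0 then f x - a 0 x else if i = Suc 0 then \<Sum>k<m. g k x else a m x)" for i :: nat
      have "(\<Sum>k<m. g k x) = a 0 x - a m x"
        unfolding g_def by (rule sum_lessThan_telescope')
      then have hs: "(\<Sum>i<3. h i) = f x" by (simp add: h_def numeral_3_eq_3)
      have "\<bar>f x\<bar> powr s \<le> 3 powr (s - 1) * (\<Sum>i<3. \<bar>h i\<bar> powr s)"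
        using abs_sum_powr_le_card[of "{..<3::nat}" s h] p unfolding hs by simp
      also have "(\<Sum>i<3. \<bar>h i\<bar> powr s) = \<bar>f x - a 0 x\<bar> powr s + (\<bar>\<Sum>k<m. g k x\<bar> powr s + \<bar>a m x\<bar> powr s)"
        by (simp add: h_def numeral_3_eq_3)
      finally show "indicator W x * ennreal (\<bar>f x\<bar> powr s) \<le> ennreal (3 powr (s - 1)) * (indicator W x * ennreal (\<bar>f x - a 0 x\<bar> powr s)
          + (indicator W x * ennreal (\<bar>\<Sum>k<m. g k x\<bar> powr s) + indicator W x * ennreal (\<bar>a m x\<bar> powr s)))"
        by (cases "x \<in> W") (simp_all add: ennreal_plus[symmetric] ennreal_mult'[symmetric] ennreal_leI del: ennreal_plus)
    qed
    also have "\<dots> = ennreal (3 powr (s - 1)) * (power_integral s W (\<lambda>x. f x - a 0 x)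
          + (power_integral s W (\<lambda>x. \<Sum>k<m. g k x)
            + power_integral s W (a m)))"
      by (subst nn_integral_cmult, measurable, subst nn_integral_add, measurable, subst nn_integral_add, measurable)
    also have "\<dots> \<le> ennreal (3 powr (s - 1)) * (ennreal C1 + (ennreal (Z powr (s - 1) * (C2 * Z)) + ennreal (Ctop * VO)))"
      by (intro mult_left_mono add_mono base tele top) simp
    also have "\<dots> = ennreal C"
      using C12 Z unfolding C_def by (simp add: ennreal_plus[symmetric] ennreal_mult'[symmetric] del: ennreal_plus)
    finally show "power_integral s W f \<le> ennreal C" .
  qed
qed

end

section \<open>Interior cones of a Lipschitz domain\<close>

lemma interior_cone_at_interior:
  fixes x :: "'a::euclidean_space"
  assumes "open \<Omega>" "bounded \<Omega>" "ball x \<delta> \<subseteq> \<Omega>" "\<delta> > 0"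
  shows "interior_cone \<Omega> (\<Omega> \<inter> ball x (\<delta> / 2)) (ball 0 (\<delta> / 2)) (\<delta> / 2)"
proof
  fix v :: 'a and t :: real assume "v \<in> ball 0 (\<delta> / 2)" "0 < t" "t \<le> 1"
  then show "t *\<^sub>R v \<in> ball 0 (\<delta> / 2)"
    using mult_mono[of t 1 "norm v" "norm v"] by simp
next
  fix y v :: 'a assume y: "y \<in> \<Omega> \<inter> ball x (\<delta> / 2)" and v: "v \<in> ball 0 (\<delta> / 2)"
  have "dist x (y + v) \<le> dist x y + norm v"
    using norm_triangle_ineq4[of "x - y" v] by (simp add: dist_norm algebra_simps)
  then have "y + v \<in> ball x \<delta>" using y v by simp
  then show "y + v \<in> \<Omega>" using assms by blast
qed (use assms in auto)

text \<open>
  In coordinates with last axis \<open>e\<close>, the cone consists of the vectors whose horizontal part is shorter than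
  \<open>1 / (L + 1)\<close> times their height.  Moving along such a vector raises the graph of an \<open>L\<close>-Lipschitz function
  by less than the height gained, so a point above the graph stays above it.  The truncation keeps the point in
  the ball where \<open>\<Omega>\<close> is described by the graph.
\<close>
lemma interior_cone_at_boundary:
  fixes x e :: "'a::euclidean_space"
  assumes \<Omega>: "open \<Omega>" "bounded \<Omega>" and \<delta>: "\<delta> > 0" and e: "norm e = 1"
    and L: "L-lipschitz_on {v. v \<bullet> e = 0} \<phi>"
    and graph: "\<Omega> \<inter> ball x \<delta> = {y \<in> ball x \<delta>. \<phi> (y - (y \<bullet> e) *\<^sub>R e) < y \<bullet> e}"
  shows "interior_cone \<Omega> (\<Omega> \<inter> ball x (\<delta> / 2))
    {v. norm (v - (v \<bullet> e) *\<^sub>R e) < (1 / (L + 1)) * (v \<bullet> e) \<and> v \<bullet> e < \<delta> / 4} (\<delta> / 2)"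
proof -
  define \<kappa> where "\<kappa> = 1 / (L + 1)"
  define P where "P v = v - (v \<bullet> e) *\<^sub>R e" for v
  define K where "K = {v. norm (P v) < \<kappa> * (v \<bullet> e) \<and> v \<bullet> e < \<delta> / 4}"
  have L0: "L \<ge> 0" using L by (rule lipschitz_on_nonneg)
  have \<kappa>: "0 < \<kappa>" "\<kappa> \<le> 1" "L * \<kappa> \<le> 1" using L0 by (auto simp: \<kappa>_def field_simps)
  have ee: "e \<bullet> e = 1" using e by (simp add: norm_eq_sqrt_inner)
  have P_lin: "P (u *\<^sub>R v + w *\<^sub>R z) = u *\<^sub>R P v + w *\<^sub>R P z" for u w :: real and v z
    by (simp add: P_def algebra_simps inner_add_left)
  have P_orth: "P v \<bullet> e = 0" for v by (simp add: P_def inner_diff_left ee)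
  have pos: "v \<bullet> e > 0" if "v \<in> K" for v
  proof -
    have "0 < \<kappa> * (v \<bullet> e)" using le_less_trans[OF norm_ge_zero, of "P v" "\<kappa> * (v \<bullet> e)"] that unfolding K_def by blast
    then show ?thesis using \<kappa> by (simp add: zero_less_mult_iff)
  qed
  have norm_K: "norm v < \<delta> / 2" if "v \<in> K" for v
  proof -
    have "norm v \<le> norm (P v) + norm ((v \<bullet> e) *\<^sub>R e)"
      using norm_triangle_ineq[of "P v" "(v \<bullet> e) *\<^sub>R e"] by (simp add: P_def)
    also have "norm ((v \<bullet> e) *\<^sub>R e) = v \<bullet> e" using pos[OF that] e by simp
    also have "norm (P v) < v \<bullet> e"
    proof -
      have "\<kappa> * (v \<bullet> e) \<le> 1 * (v \<bullet> e)" using pos[OF that] \<kappa> by (intro mult_right_mono) auto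
      then show ?thesis using that unfolding K_def by auto
    qed
    finally show ?thesis using that unfolding K_def by auto
  qed
  have "interior_cone \<Omega> (\<Omega> \<inter> ball x (\<delta> / 2)) K (\<delta> / 2)"
  proof
    show "open K"
      unfolding K_def P_def by (intro open_Collect_conj open_Collect_less continuous_intros)
    show "convex K"
    proof (rule convexI)
      fix v z and u w :: real
      assume vz: "v \<in> K" "z \<in> K" and uw: "0 \<le> u" "0 \<le> w" "u + w = 1"
      have strict: "u * a + w * b < u * a' + w * b'" if "a < a'" "b < b'" for a b a' b' :: real
      proof (cases "u = 0")
        case False
        then show ?thesis using that uw by (intro add_less_le_mono mult_strict_left_mono mult_left_mono) auto
      qed (use that uw in simp)
      have "norm (P (u *\<^sub>R v + w *\<^sub>R z)) \<le> u * norm (P v) + w * norm (P z)"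
        unfolding P_lin using norm_triangle_ineq[of "u *\<^sub>R P v" "w *\<^sub>R P z"] uw by simp
      also have "\<dots> < u * (\<kappa> * (v \<bullet> e)) + w * (\<kappa> * (z \<bullet> e))"
        using vz by (intro strict) (auto simp: K_def)
      also have "\<dots> = \<kappa> * ((u *\<^sub>R v + w *\<^sub>R z) \<bullet> e)" by (simp add: inner_add_left algebra_simps)
      finally have 1: "norm (P (u *\<^sub>R v + w *\<^sub>R z)) < \<kappa> * ((u *\<^sub>R v + w *\<^sub>R z) \<bullet> e)" .
      have "(u *\<^sub>R v + w *\<^sub>R z) \<bullet> e = u * (v \<bullet> e) + w * (z \<bullet> e)" by (simp add: inner_add_left)
      also have "\<dots> < u * (\<delta> / 4) + w * (\<delta> / 4)" using vz by (intro strict) (auto simp: K_def)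
      also have "\<dots> = \<delta> / 4" using uw by (simp add: distrib_right[symmetric])
      finally show "u *\<^sub>R v + w *\<^sub>R z \<in> K" using 1 by (simp add: K_def)
    qed
    have "(\<delta> / 8) *\<^sub>R e \<in> K" using \<kappa> \<delta> by (simp add: K_def P_def ee)
    then show "K \<noteq> {}" by blast
    show "K \<subseteq> ball 0 (\<delta> / 2)" using norm_K by auto
  next
    fix v :: 'a and t :: real assume v: "v \<in> K" and t: "0 < t" "t \<le> 1"
    have "t * norm (P v) < t * (\<kappa> * (v \<bullet> e))"
      using v t unfolding K_def by (intro mult_strict_left_mono) auto
    moreover have "P (t *\<^sub>R v) = t *\<^sub>R P v" using P_lin[of t v 0 v] by simp
    moreover have "t * (v \<bullet> e) \<le> 1 * (v \<bullet> e)" using t pos[OF v] by (intro mult_right_mono) auto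
    ultimately show "t *\<^sub>R v \<in> K" using v t by (simp add: K_def mult_ac)
  next
    fix y v :: 'a assume y: "y \<in> \<Omega> \<inter> ball x (\<delta> / 2)" and v: "v \<in> K"
    have "dist x (y + v) \<le> dist x y + norm v"
      using norm_triangle_ineq4[of "x - y" v] by (simp add: dist_norm algebra_simps)
    then have yv: "y + v \<in> ball x \<delta>" using y norm_K[OF v] by simp
    have "y \<in> ball x \<delta>" using y \<delta> by auto
    then have gy: "\<phi> (P y) < y \<bullet> e" using y graph unfolding P_def by blast
    have Pyv: "P (y + v) = P y + P v" using P_lin[of 1 y 1 v] by simp
    have "dist (\<phi> (P (y + v))) (\<phi> (P y)) \<le> L * dist (P (y + v)) (P y)"
      using L P_orth by (intro lipschitz_onD) auto
    then have "\<phi> (P (y + v)) \<le> \<phi> (P y) + L * norm (P v)"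
      unfolding Pyv by (simp add: dist_norm abs_le_iff)
    also have "\<dots> < y \<bullet> e + L * norm (P v)" using gy by simp
    also have "L * norm (P v) \<le> L * (\<kappa> * (v \<bullet> e))"
      using v L0 by (intro mult_left_mono) (auto simp: K_def)
    also have "\<dots> \<le> 1 * (v \<bullet> e)"
      unfolding mult.assoc[symmetric] using \<kappa> pos[OF v] by (intro mult_right_mono) auto
    finally have "\<phi> (P (y + v)) < (y + v) \<bullet> e" by (simp add: inner_add_left)
    then show "y + v \<in> \<Omega>" using yv graph unfolding P_def by blast
  qed (use \<Omega> in auto)
  then show ?thesis by (simp add: K_def P_def \<kappa>_def)
qed

text \<open>
  Interior and boundary points have neighbourhoods with a common cone, and the closure of \<open>\<Omega>\<close> is compact.
\<close>
lemma finite_cone_cover: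
  fixes \<Omega> :: "(real ^ 'd) set"
  assumes \<Omega>: "open \<Omega>" "bounded \<Omega>" "lipschitz_boundary \<Omega>"
  obtains I :: "(real ^ 'd) set set" and K R
  where "finite I" "\<Omega> = \<Union>I" "\<And>W. W \<in> I \<Longrightarrow> interior_cone \<Omega> W (K W) (R W)"
proof -
  have "\<exists>U. x \<in> U \<and> open U \<and> (\<exists>K R. interior_cone \<Omega> (\<Omega> \<inter> U) K R)" if x: "x \<in> closure \<Omega>" for x
  proof (cases "x \<in> \<Omega>")
    case True
    then obtain \<delta> where \<delta>: "\<delta> > 0" "ball x \<delta> \<subseteq> \<Omega>" using \<Omega> openE by blast
    show ?thesis
      using interior_cone_at_interior[OF \<Omega>(1,2) \<delta>(2,1)] \<delta> by (intro exI[of _ "ball x (\<delta> / 2)"]) auto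
  next
    case False
    then have "x \<in> frontier \<Omega>" using x \<Omega>(1) by (simp add: frontier_def interior_open)
    then obtain \<delta> e L \<phi> where h: "\<delta> > 0" "norm e = 1" "L-lipschitz_on {v. v \<bullet> e = 0} \<phi>"
        "\<Omega> \<inter> ball x \<delta> = {y \<in> ball x \<delta>. \<phi> (y - (y \<bullet> e) *\<^sub>R e) < y \<bullet> e}"
      using \<Omega>(3)[unfolded lipschitz_boundary_def, rule_format, of x] by blast
    show ?thesis
      using interior_cone_at_boundary[OF \<Omega>(1,2) h] h(1) by (intro exI[of _ "ball x (\<delta> / 2)"]) auto
  qed
  then have "\<forall>x\<in>closure \<Omega>. \<exists>U. x \<in> U \<and> open U \<and> (\<exists>K R. interior_cone \<Omega> (\<Omega> \<inter> U) K R)"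
    by blast
  from bchoice[OF this] obtain U where
    U: "\<And>x. x \<in> closure \<Omega> \<Longrightarrow> x \<in> U x \<and> open (U x) \<and> (\<exists>K R. interior_cone \<Omega> (\<Omega> \<inter> U x) K R)"
    by blast
  have "compact (closure \<Omega>)" using \<Omega>(2) by simp
  then obtain D where D: "D \<subseteq> closure \<Omega>" "finite D" "closure \<Omega> \<subseteq> (\<Union>x\<in>D. U x)"
    using U by (elim compactE_image[where C="closure \<Omega>" and f=U]) auto
  define I where "I = (\<lambda>x. \<Omega> \<inter> U x) ` D"
  have "\<forall>W\<in>I. \<exists>KR. interior_cone \<Omega> W (fst KR) (snd KR)"
    using U D(1) unfolding I_def by fastforce
  from bchoice[OF this] obtain KR where "\<And>W. W \<in> I \<Longrightarrow> interior_cone \<Omega> W (fst (KR W)) (snd (KR W))"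
    by blast
  moreover have "finite I" using D by (simp add: I_def)
  moreover have "\<Omega> = \<Union>I" using D(3) closure_subset[of \<Omega>] by (fastforce simp: I_def)
  ultimately show ?thesis using that[of I "\<lambda>W. fst (KR W)" "\<lambda>W. snd (KR W)"] by blast
qed

text \<open>
  A nonlocal substitute for the subcritical Sobolev embedding: the constants depend on \<open>\<Omega>\<close>, the exponents
  and the bounds only, and not on \<open>f\<close> or on the interaction radius \<open>\<tau>\<close>.
\<close>
theorem nonlocal_higher_integrability:
  fixes \<Omega> :: "(real ^ 'd) set" and p s E B B0 :: real
  assumes \<Omega>: "open \<Omega>" "bounded \<Omega>" "lipschitz_boundary \<Omega>"
    and p: "1 \<le> p" "p \<le> s" and \<beta>: "(p - CARD('d)) * ((s - p) / p) + p > 0"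
    and nonneg: "E \<ge> 0" "B \<ge> 0" "B0 \<ge> 0"
  obtains C \<tau>0 where "C \<ge> 0" "\<tau>0 > 0"
    "\<And>f \<tau>. nonlocal_bounds p s E B B0 \<Omega> f \<tau> \<Longrightarrow> \<tau> \<le> \<tau>0 \<Longrightarrow>
      power_integral s \<Omega> f \<le> ennreal C"
proof -
  obtain I :: "(real ^ 'd) set set" and K R
    where I: "finite I" "\<Omega> = \<Union>I" and cone: "\<And>W. W \<in> I \<Longrightarrow> interior_cone \<Omega> W (K W) (R W)"
    by (rule finite_cone_cover[OF \<Omega>]) blast
  have dim: "DIM(real ^ 'd) = CARD('d)" by simp
  have Rpos: "R W > 0" if "W \<in> I" for W using interior_cone.R_pos[OF cone[OF that]] .
  have "\<forall>W\<in>I. \<exists>C. C \<ge> 0 \<and> (\<forall>f \<tau>. nonlocal_bounds p s E B B0 \<Omega> f \<tau> \<longrightarrow> \<tau> \<le> 4 * R W \<longrightarrow>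
      power_integral s W f \<le> ennreal C)"
    using interior_cone.powr_integral_bound[OF cone p, unfolded dim, OF _ \<beta> nonneg] by blast
  from bchoice[OF this] obtain C where C: "\<And>W. W \<in> I \<Longrightarrow> C W \<ge> 0 \<and>
      (\<forall>f \<tau>. nonlocal_bounds p s E B B0 \<Omega> f \<tau> \<longrightarrow> \<tau> \<le> 4 * R W \<longrightarrow>
        power_integral s W f \<le> ennreal (C W))"
    by blast
  define \<tau>0 where "\<tau>0 = Min (insert 1 ((\<lambda>W. 4 * R W) ` I))"
  have \<tau>0: "\<tau>0 > 0" "\<And>W. W \<in> I \<Longrightarrow> \<tau>0 \<le> 4 * R W" using I Rpos by (auto simp: \<tau>0_def)
  show ?thesis
  proof (rule that[of "\<Sum>W\<in>I. C W" \<tau>0])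
    show "0 \<le> (\<Sum>W\<in>I. C W)" using C by (intro sum_nonneg) auto
    fix f :: "real ^ 'd \<Rightarrow> real" and \<tau>
    assume nb: "nonlocal_bounds p s E B B0 \<Omega> f \<tau>" and \<tau>_le: "\<tau> \<le> \<tau>0"
    have [measurable]: "f \<in> borel_measurable borel" using nb unfolding nonlocal_bounds_def by blast
    have mW [measurable]: "W \<in> sets borel" if "W \<in> I" for W
      using cone[OF that] unfolding interior_cone_def by blast
    have "power_integral s \<Omega> f
      \<le> (\<integral>\<^sup>+x. (\<Sum>W\<in>I. indicator W x * ennreal (\<bar>f x\<bar> powr s)) \<partial>lborel)"
    proof (rule nn_integral_mono)
      fix x
      show "indicator \<Omega> x * ennreal (\<bar>f x\<bar> powr s) \<le> (\<Sum>W\<in>I. indicator W x * ennreal (\<bar>f x\<bar> powr s))"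
      proof (cases "x \<in> \<Omega>")
        case True
        then obtain W where W: "W \<in> I" "x \<in> W" using I by blast
        have "indicator W x * ennreal (\<bar>f x\<bar> powr s) \<le> (\<Sum>W\<in>I. indicator W x * ennreal (\<bar>f x\<bar> powr s))"
          using W I by (intro member_le_sum) auto
        then show ?thesis using W True by simp
      qed simp
    qed
    also have "\<dots> = (\<Sum>W\<in>I. \<integral>\<^sup>+x. indicator W x * ennreal (\<bar>f x\<bar> powr s) \<partial>lborel)"
      by (intro nn_integral_sum) measurable
    also have "\<dots> \<le> (\<Sum>W\<in>I. ennreal (C W))"
    proof (rule sum_mono)
      fix W assume W: "W \<in> I"
      have "\<tau> \<le> 4 * R W" using \<tau>0(2)[OF W] \<tau>_le by linarith
      then show "power_integral s W f \<le> ennreal (C W)"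
        using C[OF W] nb by blast
    qed
    also have "\<dots> = ennreal (\<Sum>W\<in>I. C W)" using C by (simp add: sum_ennreal)
    finally show "power_integral s \<Omega> f \<le> ennreal (\<Sum>W\<in>I. C W)" .
  qed (rule \<tau>0)
qed

section \<open>Oscillation on disjoint balls\<close>

text \<open>
  Vitali's covering theorem gives countably many disjoint balls that fill \<open>\<Omega>\<close> up to a null set, and finitely
  many of them suffice up to measure \<open>e\<close>.  Disjointness matters later: it allows the energies of the
  balls to be added.
\<close>
lemma finite_ball_packing:
  fixes \<Omega> :: "'a::euclidean_space set"
  assumes \<Omega>: "open \<Omega>" "bounded \<Omega>" and \<delta>: "\<delta> > 0" and e: "e > 0"
  obtains F :: "('a \<times> real) set"
  where "finite F" "\<And>a r. (a, r) \<in> F \<Longrightarrow> 0 < r \<and> r < \<delta> \<and> ball a r \<subseteq> \<Omega>"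
    "pairwise (\<lambda>i j. disjnt (ball (fst i) (snd i)) (ball (fst j) (snd j))) F"
    "emeasure lborel (\<Omega> - (\<Union>i\<in>F. ball (fst i) (snd i))) < ennreal e"
proof -
  let ?b = "\<lambda>i :: 'a \<times> real. ball (fst i) (snd i)"
  define K where "K = {(a, r). 0 < r \<and> r < \<delta> \<and> ball a r \<subseteq> \<Omega>}"
  have cov: "\<exists>i. i \<in> K \<and> x \<in> ?b i \<and> snd i < d" if xd: "x \<in> \<Omega>" "0 < d" for x d
  proof -
    obtain \<epsilon> where \<epsilon>: "\<epsilon> > 0" "ball x \<epsilon> \<subseteq> \<Omega>" using openE[OF \<Omega>(1) xd(1)] by blast
    define r where "r = min \<epsilon> (min d \<delta>) / 2"
    have "r > 0" "r < \<epsilon>" "r < d" "r < \<delta>" using \<epsilon> xd \<delta> by (auto simp: r_def)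
    moreover have "ball x r \<subseteq> \<Omega>" using subset_ball[of r \<epsilon> x] \<epsilon>(2) \<open>r < \<epsilon>\<close> by simp
    ultimately have "(x, r) \<in> K" "x \<in> ?b (x, r)" "snd (x, r) < d" by (simp_all add: K_def)
    then show ?thesis by blast
  qed
  have "\<exists>C. countable C \<and> C \<subseteq> K \<and> pairwise (\<lambda>i j. disjnt (?b i) (?b j)) C \<and>
      negligible (\<Omega> - (\<Union>i\<in>C. ?b i))"
    by (rule Vitali_covering_theorem_balls[of \<Omega> K fst snd], rule cov, assumption+, blast)
  then obtain C where C: "countable C" "C \<subseteq> K"
     "pairwise (\<lambda>i j. disjnt (?b i) (?b j)) C" "negligible (\<Omega> - (\<Union>i\<in>C. ?b i))"
    by blast
  have inC: "0 < r \<and> r < \<delta> \<and> ball a r \<subseteq> \<Omega>" if "(a, r) \<in> C" for a r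
    using that C(2) by (auto simp: K_def)
  have "\<Omega> - (\<Union>i\<in>C. ?b i) \<in> null_sets lebesgue"
    using C(4) by (simp add: negligible_iff_null_sets)
  moreover have "open (\<Union>i\<in>C. ?b i)" by auto
  then have "\<Omega> - (\<Union>i\<in>C. ?b i) \<in> sets borel" using \<Omega> by (intro sets.Diff) (simp_all only: borel_open)
  ultimately have "\<Omega> - (\<Union>i\<in>C. ?b i) \<in> null_sets lborel"
    using null_sets_completion_iff[of "\<Omega> - (\<Union>i\<in>C. ?b i)" lborel] by simp
  then have null: "emeasure lborel (\<Omega> - (\<Union>i\<in>C. ?b i)) = 0"
    by (rule null_setsD1)
  show ?thesis
  proof (cases "C = {}")
    case True
    show ?thesis using null e True by (intro that[of "{}"]) auto
  next
    case False
    define c where "c = from_nat_into C"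
    have c: "range c = C" unfolding c_def using False C(1) by (rule range_from_nat_into)
    define A where "A n = \<Omega> - (\<Union>i<n. ?b (c i))" for n :: nat
    have "(\<lambda>n. emeasure lborel (A n)) \<longlonglongrightarrow> emeasure lborel (\<Inter>n. A n)"
    proof (rule Lim_emeasure_decseq)
      have "A n \<in> sets borel" for n
        unfolding A_def using \<Omega>(1) by (intro sets.Diff borel_open) auto
      then show "range A \<subseteq> sets lborel" by auto
      show "decseq A" unfolding A_def by (rule decseq_SucI) auto
      fix n
      have "emeasure lborel (A n) \<le> emeasure lborel \<Omega>"
        unfolding A_def using \<Omega>(1) by (intro emeasure_mono) auto
      then show "emeasure lborel (A n) \<noteq> \<infinity>"
        using emeasure_bounded_finite[OF \<Omega>(2)] by auto
    qed
    moreover have "(\<Inter>n. A n) = \<Omega> - (\<Union>i\<in>C. ?b i)"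
      unfolding A_def c[symmetric] by auto
    ultimately have "(\<lambda>n. emeasure lborel (A n)) \<longlonglongrightarrow> 0" using null by simp
    then have "eventually (\<lambda>n. emeasure lborel (A n) < ennreal e) sequentially"
      using e by (intro order_tendstoD) auto
    then obtain n where n: "emeasure lborel (A n) < ennreal e"
      by (auto simp: eventually_sequentially)
    show ?thesis
    proof (rule that[of "c ` {..<n}"])
      have sub: "c ` {..<n} \<subseteq> C" using c by blast
      show "0 < r \<and> r < \<delta> \<and> ball a r \<subseteq> \<Omega>" if "(a, r) \<in> c ` {..<n}" for a r
        using inC sub that by blast
      show "pairwise (\<lambda>i j. disjnt (?b i) (?b j)) (c ` {..<n})"
        using C(3) sub by (rule pairwise_subset)
      show "emeasure lborel (\<Omega> - (\<Union>i\<in>c ` {..<n}. ?b i)) < ennreal e"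
        using n by (simp add: A_def)
    qed simp
  qed
qed

text \<open>
  A Poincare constant for balls of radius \<open>r \<ge> \<tau>\<close>: \<open>3\<^bsup>p+d\<^esup>\<close> comes from chains of at most \<open>3 r / \<tau>\<close> steps.
  The type argument only carries the dimension.
\<close>
definition osc_const :: "real \<Rightarrow> 'a::euclidean_space itself \<Rightarrow> real" where
  "osc_const p _ = 3 powr (p + DIM('a)) / unit_ball_vol (DIM('a))"

lemma osc_const_pos: "osc_const p TYPE('a::euclidean_space) > 0"
  by (simp add: osc_const_def)

text \<open>
  The Poincare inequality on a ball.  Two points of the ball are less than \<open>2 r\<close> apart, so that
  chains of \<open>\<lceil>2 r / \<tau>\<rceil>\<close> steps join them.
\<close>
lemma ball_oscillation_powr:
  fixes f :: "'a::euclidean_space \<Rightarrow> real" and p \<tau> r M :: real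
  assumes [measurable]: "f \<in> borel_measurable borel" and bd: "\<And>x. \<bar>f x\<bar> \<le> M" and p: "p \<ge> 1"
    and \<tau>: "0 < \<tau>" "\<tau> \<le> r"
  shows "power_integral p (ball a r) (\<lambda>x. f x - mean f (ball a r))
    \<le> ennreal (osc_const p TYPE('a) * r powr p * \<tau> powr - (p + DIM('a))) * pair_energy p \<tau> f (ball a r)"
    (is "?I \<le> _")
proof -
  let ?B = "ball a r" and ?d = "DIM('a)"
  have [measurable]: "?B \<in> sets borel" by simp
  define v where "v = unit_ball_vol (real ?d)"
  have v: "v > 0" by (simp add: v_def)
  have r: "r > 0" using \<tau> by simp
  have em: "emeasure lborel ?B = ennreal (v * r ^ ?d)" using r by (simp add: emeasure_ball v_def)
  define N where "N = nat \<lceil>2 * r / \<tau>\<rceil>"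
  have N2: "2 * r / \<tau> \<le> real N" unfolding N_def by linarith
  have N3: "real N \<le> 3 * r / \<tau>"
  proof -
    have "real N \<le> 2 * r / \<tau> + 1" unfolding N_def using r \<tau> by (simp add: of_nat_nat)
    also have "\<dots> \<le> 3 * r / \<tau>" using \<tau> by (simp add: field_simps)
    finally show ?thesis .
  qed
  have "2 * r / \<tau> > 0" using r \<tau> by simp
  then have N0: "N > 0" using N2 by (intro gr0I) auto
  have diam: "norm (z - x) < real N * \<tau>" if "x \<in> ?B" "z \<in> ?B" for x z
  proof -
    have "dist z x \<le> dist a z + dist a x" using dist_triangle[of z x a] by (simp add: dist_commute)
    also have "\<dots> < 2 * r" using that by simp
    also have "\<dots> \<le> real N * \<tau>" using N2 \<tau> by (simp add: field_simps)
    finally show ?thesis by (simp add: dist_norm)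
  qed
  have "ennreal (v * r ^ ?d) * ?I
    = (\<integral>\<^sup>+x. indicator ?B x * (emeasure lborel ?B * ennreal (\<bar>f x - mean f ?B\<bar> powr p)) \<partial>lborel)"
    unfolding em
  proof (subst nn_integral_cmult[symmetric])
    define m where "m = mean f ?B"
    show "(\<lambda>x. indicator ?B x * ennreal (\<bar>f x - mean f ?B\<bar> powr p)) \<in> borel_measurable lborel"
      unfolding m_def[symmetric] by measurable
  qed (simp only: mult.left_commute)
  also have "\<dots> \<le> (\<integral>\<^sup>+x. indicator ?B x * power_integral p ?B (\<lambda>z. f x - f z) \<partial>lborel)"
    using r v by (intro nn_integral_mono mult_left_mono mean_diff_powr_le[where M=M] bd p) (auto simp: em)
  also have "\<dots> \<le> pair_energy p (real N * \<tau>) f ?B"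
    unfolding pair_energy_def
  proof (rule nn_integral_mono)
    fix x
    have "indicator ?B x * power_integral p ?B (\<lambda>z. f x - f z)
      = (\<integral>\<^sup>+z. indicator ?B x * (indicator ?B z * ennreal (\<bar>f x - f z\<bar> powr p)) \<partial>lborel)"
      by (rule nn_integral_cmult[symmetric]) measurable
    also have "\<dots> \<le> (\<integral>\<^sup>+z. indicator ?B x * indicator ?B z * indicator {v. norm v < real N * \<tau>} (z - x) * ennreal (\<bar>f x - f z\<bar> powr p) \<partial>lborel)"
      using diam by (intro nn_integral_mono) (auto simp: indicator_def)
    finally show "indicator ?B x * power_integral p ?B (\<lambda>z. f x - f z)
      \<le> \<dots>" .
  qed
  also have "\<dots> \<le> ennreal (real N powr p * real N ^ ?d) * pair_energy p \<tau> f ?B"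
    by (intro pair_energy_chain p N0) auto
  also have "real N powr p * real N ^ ?d = real N powr (p + ?d)"
    using N0 by (simp add: powr_add powr_realpow)
  also have "ennreal (real N powr (p + ?d)) * pair_energy p \<tau> f ?B
     \<le> ennreal ((3 * r / \<tau>) powr (p + ?d)) * pair_energy p \<tau> f ?B"
    using N3 p by (intro mult_right_mono ennreal_leI powr_mono2) auto
  finally have le: "ennreal (v * r ^ ?d) * ?I \<le> ennreal ((3 * r / \<tau>) powr (p + ?d)) * pair_energy p \<tau> f ?B" .
  have "?I = ennreal (1 / (v * r ^ ?d)) * (ennreal (v * r ^ ?d) * ?I)"
    using v r by (simp add: mult.assoc[symmetric] ennreal_mult[symmetric])
  also have "\<dots> \<le> ennreal (1 / (v * r ^ ?d)) * (ennreal ((3 * r / \<tau>) powr (p + ?d)) * pair_energy p \<tau> f ?B)"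
    by (intro mult_left_mono le) simp
  also have "\<dots> = ennreal (1 / (v * r ^ ?d) * (3 * r / \<tau>) powr (p + ?d)) * pair_energy p \<tau> f ?B"
    by (simp only: ennreal_mult'' powr_ge_zero mult.assoc)
  also have "1 / (v * r ^ ?d) * (3 * r / \<tau>) powr (p + ?d) = osc_const p TYPE('a) * r powr p * \<tau> powr - (p + ?d)"
  proof -
    have "\<tau> powr - (p + ?d) = 1 / \<tau> powr (p + ?d)" by (rule powr_minus_divide)
    moreover have "r powr (p + ?d) = r powr p * r ^ ?d" using r by (simp add: powr_add powr_realpow)
    ultimately show ?thesis
      using v r \<tau> by (simp add: osc_const_def v_def[symmetric] powr_mult powr_divide)
  qed
  finally show ?thesis .
qed

lemma le_add_powr:
  fixes a \<delta> p :: real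
  assumes "a \<ge> 0" "\<delta> > 0" "p \<ge> 1"
  shows "a \<le> \<delta> + \<delta> powr (1 - p) * a powr p"
proof (cases "a \<le> \<delta>")
  case True
  then show ?thesis by (simp add: add_increasing2)
next
  case False
  then have "a powr (1 - p) \<le> \<delta> powr (1 - p)" using assms by (intro powr_mono2') auto
  then have "a powr (1 - p) * a powr p \<le> \<delta> powr (1 - p) * a powr p" by (rule mult_right_mono) simp
  moreover have "a powr (1 - p) * a powr p = a" using assms False by (simp add: powr_add[symmetric])
  ultimately show ?thesis using assms by linarith
qed

text \<open>
  The \<open>L\<^sup>1\<close> form follows from \<open>a \<le> \<delta> + \<delta>\<^bsup>1-p\<^esup> a\<^sup>p\<close>, which makes both terms small with the radius.
\<close>
lemma ball_oscillation:
  fixes f :: "'a::euclidean_space \<Rightarrow> real" and p \<tau> r M \<delta> :: real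
  assumes [measurable]: "f \<in> borel_measurable borel" and bd: "\<And>x. \<bar>f x\<bar> \<le> M" and p: "p \<ge> 1"
    and \<tau>: "0 < \<tau>" "\<tau> \<le> r" and \<delta>: "r \<le> \<delta>"
  shows "abs_integral (ball a r) (\<lambda>x. f x - mean f (ball a r))
    \<le> ennreal \<delta> * emeasure lborel (ball a r)
      + ennreal (\<delta> * osc_const p TYPE('a) * \<tau> powr - (p + DIM('a))) * pair_energy p \<tau> f (ball a r)"
proof -
  let ?B = "ball a r" and ?d = "DIM('a)"
  have [measurable]: "?B \<in> sets borel" by simp
  have \<delta>0: "\<delta> > 0" using \<tau> \<delta> by simp
  have "abs_integral ?B (\<lambda>x. f x - mean f ?B)
    \<le> (\<integral>\<^sup>+x. ennreal \<delta> * indicator ?B x + ennreal (\<delta> powr (1 - p)) *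
        (indicator ?B x * ennreal (\<bar>f x - mean f ?B\<bar> powr p)) \<partial>lborel)"
  proof (rule nn_integral_mono)
    fix x
    have "ennreal \<bar>f x - mean f ?B\<bar> \<le> ennreal (\<delta> + \<delta> powr (1 - p) * \<bar>f x - mean f ?B\<bar> powr p)"
      using \<delta>0 p by (intro ennreal_leI le_add_powr) auto
    also have "\<dots> = ennreal \<delta> + ennreal (\<delta> powr (1 - p)) * ennreal (\<bar>f x - mean f ?B\<bar> powr p)"
      using \<delta>0 by (simp add: ennreal_mult')
    finally show "indicator ?B x * ennreal \<bar>f x - mean f ?B\<bar>
      \<le> ennreal \<delta> * indicator ?B x + ennreal (\<delta> powr (1 - p)) * (indicator ?B x * ennreal (\<bar>f x - mean f ?B\<bar> powr p))"
      by (cases "x \<in> ?B") auto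
  qed
  also have "\<dots> = ennreal \<delta> * emeasure lborel ?B + ennreal (\<delta> powr (1 - p)) *
        power_integral p ?B (\<lambda>x. f x - mean f ?B)"
  proof -
    define m where "m = mean f ?B"
    show ?thesis unfolding m_def[symmetric]
      by (subst nn_integral_add) (simp_all add: nn_integral_cmult nn_integral_cmult_indicator)
  qed
  also have "\<dots> \<le> ennreal \<delta> * emeasure lborel ?B + ennreal (\<delta> powr (1 - p)) *
        (ennreal (osc_const p TYPE('a) * r powr p * \<tau> powr - (p + ?d)) * pair_energy p \<tau> f ?B)"
    by (intro add_left_mono mult_left_mono ball_oscillation_powr[where M=M] assms) auto
  also have "\<dots> \<le> ennreal \<delta> * emeasure lborel ?B
      + ennreal (\<delta> * osc_const p TYPE('a) * \<tau> powr - (p + ?d)) * pair_energy p \<tau> f ?B"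
  proof -
    have "\<delta> powr (1 - p) * r powr p \<le> \<delta> powr (1 - p) * \<delta> powr p"
      using \<tau> \<delta> p by (intro mult_left_mono powr_mono2) auto
    also have "\<dots> = \<delta>" using \<delta>0 by (simp add: powr_add[symmetric])
    finally have "(\<delta> powr (1 - p) * r powr p) * (osc_const p TYPE('a) * \<tau> powr - (p + ?d))
       \<le> \<delta> * (osc_const p TYPE('a) * \<tau> powr - (p + ?d))"
      using osc_const_pos[where p=p and 'a='a] by (intro mult_right_mono) (auto simp: less_imp_le)
    then have "ennreal (\<delta> powr (1 - p) * (osc_const p TYPE('a) * r powr p * \<tau> powr - (p + ?d)))
        * pair_energy p \<tau> f ?B
      \<le> ennreal (\<delta> * osc_const p TYPE('a) * \<tau> powr - (p + ?d)) * pair_energy p \<tau> f ?B"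
      by (intro mult_right_mono ennreal_leI) (simp_all only: mult_ac zero_le)
    then show ?thesis
      by (intro add_left_mono) (simp only: ennreal_mult' powr_ge_zero mult.assoc)
  qed
  finally show ?thesis .
qed

lemma sum_pair_energy_le:
  fixes f :: "'a::euclidean_space \<Rightarrow> real"
  assumes [measurable]: "f \<in> borel_measurable borel" "\<Omega> \<in> sets borel" and F: "finite F"
    and B: "\<And>i. i \<in> F \<Longrightarrow> B i \<in> sets borel" "\<And>i. i \<in> F \<Longrightarrow> B i \<subseteq> \<Omega>"
    and disj: "pairwise (\<lambda>i j. disjnt (B i) (B j)) F"
  shows "(\<Sum>i\<in>F. pair_energy p \<tau> f (B i)) \<le> pair_energy p \<tau> f \<Omega>"
proof -
  have [measurable]: "B i \<in> sets borel" if "i \<in> F" for i using B(1) that .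
  define w where "w x y = indicator {v. norm v < \<tau>} (y - x) * ennreal (\<bar>f x - f y\<bar> powr p)" for x y
  have [measurable]: "case_prod w \<in> borel_measurable (borel \<Otimes>\<^sub>M borel)" unfolding w_def by measurable
  have pe: "pair_energy p \<tau> f Q = (\<integral>\<^sup>+x. \<integral>\<^sup>+y. indicator Q x * indicator Q y * w x y \<partial>lborel \<partial>lborel)" for Q
    unfolding pair_energy_def w_def by (simp add: mult_ac)
  have "(\<Sum>i\<in>F. pair_energy p \<tau> f (B i))
     = (\<integral>\<^sup>+x. \<integral>\<^sup>+y. (\<Sum>i\<in>F. indicator (B i) x * indicator (B i) y * w x y) \<partial>lborel \<partial>lborel)"
    unfolding pe by (simp add: nn_integral_sum)
  also have "\<dots> \<le> pair_energy p \<tau> f \<Omega>"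
    unfolding pe
  proof (intro nn_integral_mono)
    fix x y
    show "(\<Sum>i\<in>F. indicator (B i) x * indicator (B i) y * w x y) \<le> indicator \<Omega> x * indicator \<Omega> y * w x y"
    proof (cases "\<exists>i\<in>F. x \<in> B i \<and> y \<in> B i")
      case True
      then obtain i where i: "i \<in> F" "x \<in> B i" "y \<in> B i" by blast
      have "x \<notin> B j" if "j \<in> F" "j \<noteq> i" for j
        using disj i that unfolding pairwise_def disjnt_def by blast
      then have "(\<Sum>j\<in>F. indicator (B j) x * indicator (B j) y * w x y)
          = (\<Sum>j\<in>{i}. indicator (B j) x * indicator (B j) y * w x y)"
        using F i by (intro sum.mono_neutral_right) auto
      moreover have "x \<in> \<Omega>" "y \<in> \<Omega>" using i B(2)[OF i(1)] by auto
      ultimately show ?thesis using i by simp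
    next
      case False
      then have "(\<Sum>i\<in>F. indicator (B i) x * indicator (B i) y * w x y) = 0"
        by (intro sum.neutral) (auto simp: indicator_def)
      then show ?thesis by simp
    qed
  qed
  finally show ?thesis .
qed

lemma sum_ball_oscillation:
  fixes f :: "'a::euclidean_space \<Rightarrow> real" and p \<tau> M \<delta> E :: real
  assumes f: "f \<in> borel_measurable borel" and bd: "\<And>x. \<bar>f x\<bar> \<le> M" and p: "p \<ge> 1"
    and \<tau>: "0 < \<tau>" and \<Omega>: "open \<Omega>" "bounded \<Omega>" and E0: "E \<ge> 0" and \<delta>: "\<delta> > 0"
    and F: "finite F" "\<And>a r. (a, r) \<in> F \<Longrightarrow> 0 < r \<and> r < \<delta> \<and> ball a r \<subseteq> \<Omega>"
    and disj: "pairwise (\<lambda>i j. disjnt (ball (fst i) (snd i)) (ball (fst j) (snd j))) F"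
    and \<tau>F: "\<And>a r. (a, r) \<in> F \<Longrightarrow> \<tau> \<le> r"
    and E: "pair_energy p \<tau> f \<Omega> \<le> ennreal (E * \<tau> powr (p + DIM('a)))"
  shows "(\<Sum>(a, r)\<in>F. abs_integral (ball a r) (\<lambda>x. f x - mean f (ball a r)))
    \<le> ennreal (\<delta> * (measure lborel \<Omega> + osc_const p TYPE('a) * E))"
proof -
  let ?d = "DIM('a)"
  let ?b = "\<lambda>i :: 'a \<times> real. ball (fst i) (snd i)"
  define c where "c = osc_const p TYPE('a)"
  have c: "c > 0" unfolding c_def by (rule osc_const_pos)
  have em\<Omega>: "emeasure lborel \<Omega> = ennreal (measure lborel \<Omega>)"
    using emeasure_bounded_finite[OF \<Omega>(2)] by (simp add: emeasure_eq_ennreal_measure)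
  have "(\<Sum>(a, r)\<in>F. abs_integral (ball a r) (\<lambda>x. f x - mean f (ball a r)))
    \<le> (\<Sum>i\<in>F. ennreal \<delta> * emeasure lborel (?b i) + ennreal (\<delta> * c * \<tau> powr - (p + ?d)) * pair_energy p \<tau> f (?b i))"
    unfolding c_def case_prod_beta using F(2) \<tau>F \<tau>
    by (intro sum_mono ball_oscillation[where M=M] f bd p) (auto simp: less_imp_le)
  also have "\<dots> = ennreal \<delta> * (\<Sum>i\<in>F. emeasure lborel (?b i))
      + ennreal (\<delta> * c * \<tau> powr - (p + ?d)) * (\<Sum>i\<in>F. pair_energy p \<tau> f (?b i))"
    by (simp add: sum.distrib sum_distrib_left)
  also have "\<dots> \<le> ennreal \<delta> * ennreal (measure lborel \<Omega>)
      + ennreal (\<delta> * c * \<tau> powr - (p + ?d)) * ennreal (E * \<tau> powr (p + ?d))"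
  proof (intro add_mono mult_left_mono)
    have "disjoint_family_on ?b F"
      using disj by (auto simp: disjoint_family_on_def pairwise_def disjnt_def)
    then have "(\<Sum>i\<in>F. emeasure lborel (?b i)) = emeasure lborel (\<Union>i\<in>F. ?b i)"
      using F(1) by (intro sum_emeasure) auto
    also have "\<dots> \<le> emeasure lborel \<Omega>"
      using F(2) \<Omega>(1) by (intro emeasure_mono) fastforce+
    finally show "(\<Sum>i\<in>F. emeasure lborel (?b i)) \<le> ennreal (measure lborel \<Omega>)" by (simp add: em\<Omega>)
    have "(\<Sum>i\<in>F. pair_energy p \<tau> f (?b i)) \<le> pair_energy p \<tau> f \<Omega>"
      using F \<Omega>(1) disj by (intro sum_pair_energy_le f) auto
    then show "(\<Sum>i\<in>F. pair_energy p \<tau> f (?b i)) \<le> ennreal (E * \<tau> powr (p + ?d))"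
      using E by (rule order.trans)
  qed auto
  also have "\<dots> = ennreal (\<delta> * measure lborel \<Omega> + \<delta> * c * \<tau> powr - (p + ?d) * (E * \<tau> powr (p + ?d)))"
    using c \<delta> E0 by (simp add: ennreal_mult'[symmetric] ennreal_plus[symmetric] del: ennreal_plus)
  also have "\<delta> * c * \<tau> powr - (p + ?d) * (E * \<tau> powr (p + ?d)) = \<delta> * (c * E)"
  proof -
    have "\<tau> powr - (p + ?d) * \<tau> powr (p + ?d) = 1"
      unfolding powr_add[symmetric] using \<tau> by simp
    then have "\<delta> * c * E * (\<tau> powr - (p + ?d) * \<tau> powr (p + ?d)) = \<delta> * c * E" by simp
    then show ?thesis by (simp only: mult_ac)
  qed
  finally show ?thesis by (simp add: c_def distrib_left)
qed

lemma nn_integral_ball_diff_le: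
  fixes f g :: "'a::euclidean_space \<Rightarrow> real"
  assumes f [measurable]: "f \<in> borel_measurable borel" and g [measurable]: "g \<in> borel_measurable borel"
    and r: "r > 0"
  shows "abs_integral (ball a r) (\<lambda>x. f x - g x)
    \<le> abs_integral (ball a r) (\<lambda>x. f x - mean f (ball a r))
     + abs_integral (ball a r) (\<lambda>x. g x - mean g (ball a r))
     + ennreal \<bar>(\<integral>x. indicator (ball a r) x * f x \<partial>lborel) - (\<integral>x. indicator (ball a r) x * g x \<partial>lborel)\<bar>"
proof -
  let ?B = "ball a r"
  have [measurable]: "?B \<in> sets borel" by simp
  define mf mg where "mf = mean f ?B" and "mg = mean g ?B"
  have m: "measure lborel ?B > 0" using r by simp
  have em: "emeasure lborel ?B = ennreal (measure lborel ?B)"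
    using emeasure_lborel_ball_finite[of a r] by (simp add: emeasure_eq_ennreal_measure)
  have "abs_integral ?B (\<lambda>x. f x - g x)
    \<le> (\<integral>\<^sup>+x. (indicator ?B x * ennreal \<bar>f x - mf\<bar> + indicator ?B x * ennreal \<bar>g x - mg\<bar>)
        + ennreal \<bar>mf - mg\<bar> * indicator ?B x \<partial>lborel)"
  proof (rule nn_integral_mono)
    fix x
    have "ennreal \<bar>f x - g x\<bar> \<le> ennreal (\<bar>f x - mf\<bar> + \<bar>g x - mg\<bar> + \<bar>mf - mg\<bar>)"
      by (intro ennreal_leI) linarith
    then show "indicator ?B x * ennreal \<bar>f x - g x\<bar>
      \<le> (indicator ?B x * ennreal \<bar>f x - mf\<bar> + indicator ?B x * ennreal \<bar>g x - mg\<bar>) + ennreal \<bar>mf - mg\<bar> * indicator ?B x"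
      by (cases "x \<in> ?B") auto
  qed
  also have "\<dots> = abs_integral ?B (\<lambda>x. f x - mf)
     + abs_integral ?B (\<lambda>x. g x - mg) + ennreal \<bar>mf - mg\<bar> * emeasure lborel ?B"
    by (simp add: nn_integral_add nn_integral_cmult_indicator)
  also have "ennreal \<bar>mf - mg\<bar> * emeasure lborel ?B
    = ennreal \<bar>(\<integral>x. indicator ?B x * f x \<partial>lborel) - (\<integral>x. indicator ?B x * g x \<partial>lborel)\<bar>"
  proof -
    have "\<bar>mf - mg\<bar> * measure lborel ?B
        = \<bar>(\<integral>x. indicator ?B x * f x \<partial>lborel) - (\<integral>x. indicator ?B x * g x \<partial>lborel)\<bar>"
      using m by (simp add: mf_def mg_def mean_def diff_divide_distrib[symmetric])
    then show ?thesis unfolding em by (simp add: ennreal_mult'[symmetric])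
  qed
  finally show ?thesis by (simp add: mf_def mg_def)
qed

text \<open>
  The second term is small for large \<open>M\<close> once the \<open>s\<close>-th powers are bounded in the mean; the first one is
  controlled by the measure of bad sets and by the \<open>L\<^sup>1\<close> norm on good ones.
\<close>
lemma powr_le_truncated:
  fixes g M r s :: real
  assumes "g \<ge> 0" "M > 0" "1 \<le> r" "r \<le> s"
  shows "g powr r \<le> M powr (r - 1) * min g M + M powr (r - s) * g powr s"
proof (cases "g \<le> M")
  case True
  have "g powr r = g powr (r - 1) * g"
    using assms by (cases "g = 0") (simp_all add: powr_diff)
  also have "\<dots> \<le> M powr (r - 1) * g" using True assms by (intro mult_right_mono powr_mono2) auto
  finally show ?thesis using True by (simp add: min_def add_increasing2)
next
  case False
  have "g powr r = g powr (r - s) * g powr s" by (simp add: powr_add[symmetric])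
  also have "\<dots> \<le> M powr (r - s) * g powr s"
    using False assms by (intro mult_right_mono powr_mono2') auto
  finally show ?thesis using assms False by (simp add: min_def add_increasing)
qed

lemma nn_integral_truncated_le:
  fixes h :: "'a::euclidean_space \<Rightarrow> real"
  assumes h [measurable]: "h \<in> borel_measurable borel" and \<Omega>: "open \<Omega>"
    and F: "finite F" and e: "emeasure lborel (\<Omega> - (\<Union>i\<in>F. ball (fst i) (snd i))) \<le> ennreal e"
    and M: "M \<ge> 0"
  shows "(\<integral>\<^sup>+x. indicator \<Omega> x * ennreal (min \<bar>h x\<bar> M) \<partial>lborel)
    \<le> ennreal M * ennreal e
     + (\<Sum>(a, r)\<in>F. abs_integral (ball a r) h)"
proof -
  let ?b = "\<lambda>i :: 'a \<times> real. ball (fst i) (snd i)"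
  define U where "U = \<Omega> - (\<Union>i\<in>F. ?b i)"
  have "open (\<Union>i\<in>F. ?b i)" by auto
  with \<Omega> have [measurable]: "U \<in> sets borel" unfolding U_def by (intro sets.Diff) auto
  have [measurable]: "?b i \<in> sets borel" for i by simp
  have "(\<integral>\<^sup>+x. indicator \<Omega> x * ennreal (min \<bar>h x\<bar> M) \<partial>lborel)
    \<le> (\<integral>\<^sup>+x. ennreal M * indicator U x + (\<Sum>i\<in>F. indicator (?b i) x * ennreal \<bar>h x\<bar>) \<partial>lborel)"
  proof (rule nn_integral_mono)
    fix x
    consider "x \<notin> \<Omega>" | "x \<in> U" | i where "i \<in> F" "x \<in> ?b i" unfolding U_def by blast
    then show "indicator \<Omega> x * ennreal (min \<bar>h x\<bar> M)
       \<le> ennreal M * indicator U x + (\<Sum>i\<in>F. indicator (?b i) x * ennreal \<bar>h x\<bar>)"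
    proof cases
      case 1 then show ?thesis by simp
    next
      case 2
      then have "indicator \<Omega> x * ennreal (min \<bar>h x\<bar> M) \<le> ennreal M * indicator U x"
        by (auto simp: indicator_def U_def intro!: ennreal_leI)
      then show ?thesis by (rule add_increasing2[rotated]) simp
    next
      case 3
      have "indicator \<Omega> x * ennreal (min \<bar>h x\<bar> M) \<le> indicator (?b i) x * ennreal \<bar>h x\<bar>"
        using 3 by (auto simp: indicator_def intro!: ennreal_leI)
      also have "\<dots> \<le> (\<Sum>i\<in>F. indicator (?b i) x * ennreal \<bar>h x\<bar>)"
        using 3 F by (intro member_le_sum) auto
      finally show ?thesis by (rule add_increasing[rotated]) simp
    qed
  qed
  also have "\<dots> = ennreal M * emeasure lborel U + (\<Sum>i\<in>F. abs_integral (?b i) h)"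
    by (simp add: nn_integral_add nn_integral_sum nn_integral_cmult_indicator)
  also have "\<dots> \<le> ennreal M * ennreal e + (\<Sum>i\<in>F. abs_integral (?b i) h)"
    using e unfolding U_def by (intro add_right_mono mult_left_mono) auto
  finally show ?thesis by (simp add: case_prod_beta)
qed

lemma nn_integral_diff_powr_le:
  fixes f g :: "'a::euclidean_space \<Rightarrow> real"
  assumes [measurable]: "f \<in> borel_measurable borel" "g \<in> borel_measurable borel" "\<Omega> \<in> sets borel"
    and s: "s \<ge> 1" and C: "C \<ge> 0"
    and fC: "power_integral s \<Omega> f \<le> ennreal C"
    and gC: "power_integral s \<Omega> g \<le> ennreal C"
  shows "power_integral s \<Omega> (\<lambda>x. f x - g x) \<le> ennreal (2 powr s * C)"
proof -
  have "power_integral s \<Omega> (\<lambda>x. f x - g x)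
    \<le> (\<integral>\<^sup>+x. ennreal (2 powr (s - 1)) * (indicator \<Omega> x * ennreal (\<bar>f x\<bar> powr s) + indicator \<Omega> x * ennreal (\<bar>g x\<bar> powr s)) \<partial>lborel)"
  proof (rule nn_integral_mono)
    fix x
    define h where "h b = (if b then f x else - g x)" for b
    have "\<bar>f x - g x\<bar> powr s \<le> 2 powr (s - 1) * (\<bar>f x\<bar> powr s + \<bar>g x\<bar> powr s)"
      using abs_sum_powr_le_card[of "UNIV :: bool set" s h] s by (simp add: h_def UNIV_bool add.commute)
    then show "indicator \<Omega> x * ennreal (\<bar>f x - g x\<bar> powr s)
      \<le> ennreal (2 powr (s - 1)) * (indicator \<Omega> x * ennreal (\<bar>f x\<bar> powr s) + indicator \<Omega> x * ennreal (\<bar>g x\<bar> powr s))"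
      by (cases "x \<in> \<Omega>") (auto simp: ennreal_plus[symmetric] ennreal_mult'[symmetric] simp del: ennreal_plus intro!: ennreal_leI)
  qed
  also have "\<dots> = ennreal (2 powr (s - 1)) * (power_integral s \<Omega> f
      + power_integral s \<Omega> g)"
    by (simp add: nn_integral_cmult nn_integral_add)
  also have "\<dots> \<le> ennreal (2 powr (s - 1)) * (ennreal C + ennreal C)"
    by (intro mult_left_mono add_mono fC gC) auto
  also have "\<dots> = ennreal (2 powr s * C)"
    using C by (simp add: ennreal_plus[symmetric] ennreal_mult'[symmetric] powr_diff del: ennreal_plus)
  finally show ?thesis .
qed

section \<open>Compactness of the pulled back functions\<close>

lemma abs_integral_indicator_le:
  fixes f :: "'a::euclidean_space \<Rightarrow> real"
  assumes [measurable]: "f \<in> borel_measurable borel" "A \<in> sets borel" "\<Omega> \<in> sets borel"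
    and bd: "\<And>x. \<bar>f x\<bar> \<le> M" and sub: "A \<subseteq> \<Omega>" and fin: "emeasure lborel \<Omega> = ennreal L" "L \<ge> 0"
    and s: "s \<ge> 1" and C: "C \<ge> 0"
    and fC: "power_integral s \<Omega> f \<le> ennreal C"
  shows "\<bar>\<integral>x. indicator A x * f x \<partial>lborel\<bar> \<le> L + C"
proof -
  have "emeasure lborel A \<le> emeasure lborel \<Omega>" using sub by (intro emeasure_mono) auto
  then have "emeasure lborel A < \<infinity>" unfolding fin by (simp add: le_less_trans)
  then have int: "integrable lborel (\<lambda>x. indicator A x * f x)"
    using bd by (intro integrable_indicator_bounded[where M=M]) auto
  have "ennreal \<bar>\<integral>x. indicator A x * f x \<partial>lborel\<bar> \<le> (\<integral>\<^sup>+x. ennreal \<bar>indicator A x * f x\<bar> \<partial>lborel)"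
    using integral_norm_bound_ennreal[OF int] by simp
  also have "\<dots> \<le> (\<integral>\<^sup>+x. indicator \<Omega> x + indicator \<Omega> x * ennreal (\<bar>f x\<bar> powr s) \<partial>lborel)"
  proof (rule nn_integral_mono)
    fix x
    have "ennreal \<bar>f x\<bar> \<le> ennreal (1 + \<bar>f x\<bar> powr s)"
      using le_add_powr[of "\<bar>f x\<bar>" 1 s] s by (intro ennreal_leI) simp
    then show "ennreal \<bar>indicator A x * f x\<bar> \<le> indicator \<Omega> x + indicator \<Omega> x * ennreal (\<bar>f x\<bar> powr s)"
      using sub by (cases "x \<in> A") (auto simp: indicator_def)
  qed
  also have "\<dots> = ennreal L + power_integral s \<Omega> f"
    by (simp add: nn_integral_add fin)
  also have "\<dots> \<le> ennreal L + ennreal C" by (intro add_left_mono fC)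
  also have "\<dots> = ennreal (L + C)" using fin C by simp
  finally show ?thesis using fin C by (subst (asm) ennreal_le_iff) auto
qed

text \<open>
  Only the integrals over the countably many balls of all the packings have to converge along the
  subsequence, and these are bounded.  The choice does not depend on \<open>r\<close>, so the same subsequence is
  Cauchy in \<open>L\<^sup>1\<close>, which is used to find an almost everywhere limit, and in the space \<open>L\<^sup>r\<close> of interest.
\<close>
lemma Lr_Cauchy_subsequence:
  fixes f :: "nat \<Rightarrow> 'a::euclidean_space \<Rightarrow> real" and p s E C :: real and \<tau> Mb :: "nat \<Rightarrow> real"
  assumes f [measurable]: "\<And>n. f n \<in> borel_measurable borel" and bd: "\<And>n x. \<bar>f n x\<bar> \<le> Mb n"
    and p: "p \<ge> 1" and \<tau>: "\<And>n. 0 < \<tau> n" "\<tau> \<longlonglongrightarrow> 0"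
    and \<Omega>: "open \<Omega>" "bounded \<Omega>" and E0: "E \<ge> 0" and C0: "C \<ge> 0" and s: "s \<ge> 1"
    and E: "\<And>n. pair_energy p (\<tau> n) (f n) \<Omega> \<le> ennreal (E * \<tau> n powr (p + DIM('a)))"
    and C: "\<And>n. power_integral s \<Omega> (f n) \<le> ennreal C"
  obtains k where "strict_mono (k :: nat \<Rightarrow> nat)"
    "\<And>r e. 1 \<le> r \<Longrightarrow> r < s \<Longrightarrow> 0 < e \<Longrightarrow>
      \<exists>N. \<forall>m\<ge>N. \<forall>n\<ge>N. power_integral r \<Omega> (\<lambda>x. f (k m) x - f (k n) x) \<le> ennreal e"
proof -
  have [measurable]: "\<Omega> \<in> sets borel" using \<Omega> by simp
  define L where "L = measure lborel \<Omega>"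
  have L: "emeasure lborel \<Omega> = ennreal L" "L \<ge> 0"
    using emeasure_bounded_finite[OF \<Omega>(2)] by (simp_all add: L_def emeasure_eq_ennreal_measure)
  define A where "A = L + osc_const p TYPE('a) * E"
  have A: "A \<ge> 0" using L E0 osc_const_pos[where p=p and 'a='a] by (simp add: A_def)
  define \<delta> where "\<delta> j = 1 / real (Suc j)" for j
  have \<delta>: "\<delta> j > 0" for j by (simp add: \<delta>_def)
  define packing where "packing j F \<longleftrightarrow> finite F
      \<and> (\<forall>a r. (a, r) \<in> F \<longrightarrow> 0 < r \<and> r < \<delta> j \<and> ball a r \<subseteq> \<Omega>)
      \<and> pairwise (\<lambda>i j. disjnt (ball (fst i) (snd i)) (ball (fst j) (snd j))) F
      \<and> emeasure lborel (\<Omega> - (\<Union>i\<in>F. ball (fst i) (snd i))) \<le> ennreal (\<delta> j)"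
    for j and F :: "('a \<times> real) set"
  have "\<exists>F. packing j F" for j
    unfolding packing_def
    by (rule finite_ball_packing[OF \<Omega> \<delta>[of j] \<delta>[of j]]) (blast intro: less_imp_le)
  then obtain F where packing: "\<And>j. packing j (F j)" by metis
  have F: "finite (F j)"
      "(a, r) \<in> F j \<Longrightarrow> 0 < r \<and> r < \<delta> j \<and> ball a r \<subseteq> \<Omega>"
      "pairwise (\<lambda>i j. disjnt (ball (fst i) (snd i)) (ball (fst j) (snd j))) (F j)"
      "emeasure lborel (\<Omega> - (\<Union>i\<in>F j. ball (fst i) (snd i))) \<le> ennreal (\<delta> j)" for j a r
    using packing[of j] unfolding packing_def by auto
  \<comment> \<open>The integral of \<open>f\<^sub>n\<close> over the ball with index \<open>i = (centre, radius)\<close>.\<close>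
  define \<phi> where "\<phi> n i = (\<integral>x. indicator (ball (fst i) (snd i)) x * f n x \<partial>lborel)" for n and i :: "'a \<times> real"
  have \<phi>_bd: "norm (\<phi> n i) \<le> L + C" if "i \<in> (\<Union>j. F j)" for n i
  proof -
    from that obtain j where "i \<in> F j" by blast
    then have "ball (fst i) (snd i) \<subseteq> \<Omega>" using F(2)[of "fst i" "snd i" j] by simp
    then show ?thesis
      unfolding \<phi>_def real_norm_def
      using bd L C0 s C[of n] by (intro abs_integral_indicator_le[where M="Mb n" and \<Omega>=\<Omega> and s=s]) auto
  qed
  have "countable (\<Union>j. F j)" using F(1) by (auto intro: countable_finite)
  then have "\<exists>k. strict_mono (k :: nat \<Rightarrow> nat) \<and> (\<forall>i\<in>\<Union>j. F j. \<exists>l. (\<lambda>n. \<phi> (k n) i) \<longlonglongrightarrow> l)"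
    by (rule function_convergent_subsequence[where f=\<phi> and S="\<Union>j. F j" and M="L + C"]) (use \<phi>_bd in blast)+
  then obtain k where k: "strict_mono (k :: nat \<Rightarrow> nat)"
      and conv: "\<And>i. i \<in> (\<Union>j. F j) \<Longrightarrow> \<exists>l. (\<lambda>n. \<phi> (k n) i) \<longlonglongrightarrow> l"
    by (elim exE conjE) (rule that, assumption, erule bspec)
  show ?thesis
  proof (rule that[OF k])
    fix r e :: real assume r: "1 \<le> r" "r < s" and e: "0 < e"
    define D where "D = 2 powr s * C"
    have D: "D \<ge> 0" using C0 by (simp add: D_def)
    \<comment> \<open>The truncation level makes the tail at most \<open>e / 2\<close>.  The packing then leaves \<open>e / 4\<close> for the
       uncovered part and the oscillations, and the integrals over its balls take the last \<open>e / 4\<close>.\<close>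
    define M where "M = (2 * D / e + 1) powr (1 / (s - r))"
    have b: "2 * D / e + 1 > 0" using D e by (intro add_nonneg_pos) auto
    have M: "M > 0" using b by (simp add: M_def)
    have tail: "M powr (r - s) * D \<le> e / 2"
    proof -
      have "1 / (s - r) * (r - s) = - 1" using r by (simp add: field_simps)
      then have "M powr (r - s) = (2 * D / e + 1) powr (- 1)" by (simp add: M_def powr_powr)
      also have "\<dots> = 1 / (2 * D / e + 1)" using b by (simp add: powr_minus_divide)
      finally have "M powr (r - s) = 1 / (2 * D / e + 1)" .
      moreover have "1 / (2 * D / e + 1) * D \<le> e / 2" using D e b by (simp add: field_simps)
      ultimately show ?thesis by simp
    qed
    define G where "G = M powr (r - 1)"
    have G: "G > 0" using M by (simp add: G_def)
    obtain j where j: "G * (M + 2 * A) * \<delta> j \<le> e / 4"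
    proof -
      obtain j where "G * (M + 2 * A) / (e / 4) < real j" using reals_Archimedean2 by blast
      then have "G * (M + 2 * A) < real (Suc j) * (e / 4)" using e by (simp add: field_simps)
      then have "G * (M + 2 * A) * \<delta> j \<le> e / 4" by (simp add: \<delta>_def field_simps)
      then show ?thesis by (rule that)
    qed
    define \<eta> where "\<eta> = e / (4 * G * (real (card (F j)) + 1))"
    have \<eta>: "\<eta> > 0" using e G by (simp add: \<eta>_def add_nonneg_pos)
    have card\<eta>: "G * (real (card (F j)) * \<eta>) \<le> e / 4"
    proof -
      have "G * ((real (card (F j)) + 1) * \<eta>) = e / 4"
        using G by (simp add: \<eta>_def divide_simps add_nonneg_eq_0_iff)
      moreover have "G * (real (card (F j)) * \<eta>) \<le> G * ((real (card (F j)) + 1) * \<eta>)"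
        using G \<eta> by (intro mult_left_mono mult_right_mono) auto
      ultimately show ?thesis by simp
    qed
    have ev: "eventually (\<lambda>n. \<tau> (k n) \<le> snd i) sequentially" if "i \<in> F j" for i
    proof -
      have "snd i > 0" using F(2)[of "fst i" "snd i" j] that by simp
      moreover have "(\<lambda>n. \<tau> (k n)) \<longlonglongrightarrow> 0" using LIMSEQ_subseq_LIMSEQ[OF \<tau>(2) k] by (simp add: o_def)
      ultimately have "eventually (\<lambda>n. \<tau> (k n) < snd i) sequentially" by (intro order_tendstoD)
      then show ?thesis by eventually_elim simp
    qed
    \<comment> \<open>The packing is finite, so the interaction radius eventually drops below all of its radii.\<close>
    then have "eventually (\<lambda>n. \<forall>i\<in>F j. \<tau> (k n) \<le> snd i) sequentially"
      using F(1) by (simp add: eventually_ball_finite_distrib)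
    then obtain N1 where N1: "\<And>n i. n \<ge> N1 \<Longrightarrow> i \<in> F j \<Longrightarrow> \<tau> (k n) \<le> snd i"
      by (auto simp: eventually_sequentially)
    have "\<forall>i\<in>F j. \<exists>N. \<forall>m\<ge>N. \<forall>n\<ge>N. \<bar>\<phi> (k m) i - \<phi> (k n) i\<bar> < \<eta>"
    proof
      fix i assume "i \<in> F j"
      then have "Cauchy (\<lambda>n. \<phi> (k n) i)" using conv[of i] LIMSEQ_imp_Cauchy by blast
      then show "\<exists>N. \<forall>m\<ge>N. \<forall>n\<ge>N. \<bar>\<phi> (k m) i - \<phi> (k n) i\<bar> < \<eta>"
        using CauchyD[OF _ \<eta>] by fastforce
    qed
    from bchoice[OF this] obtain N2 where
      N2: "\<And>i m n. i \<in> F j \<Longrightarrow> m \<ge> N2 i \<Longrightarrow> n \<ge> N2 i \<Longrightarrow> \<bar>\<phi> (k m) i - \<phi> (k n) i\<bar> < \<eta>" by blast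
    define N where "N = Max (insert N1 (N2 ` F j))"
    have N: "N \<ge> N1" "\<And>i. i \<in> F j \<Longrightarrow> N \<ge> N2 i" using F(1)[of j] by (auto simp: N_def)
    show "\<exists>N. \<forall>m\<ge>N. \<forall>n\<ge>N. power_integral r \<Omega> (\<lambda>x. f (k m) x - f (k n) x) \<le> ennreal e"
    proof (intro exI[of _ N] allI impI)
      fix m n assume mn: "m \<ge> N" "n \<ge> N"
      let ?f = "f (k m)" and ?g = "f (k n)"
      have osc: "(\<Sum>(a, r)\<in>F j. abs_integral (ball a r) (\<lambda>x. f (k l) x - mean (f (k l)) (ball a r)))
          \<le> ennreal (\<delta> j * A)" if "l \<ge> N" for l
        unfolding A_def L_def
        using bd p \<tau>(1) \<Omega> E0 \<delta> F N1[of l] N(1) that E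
        by (intro sum_ball_oscillation[where M="Mb (k l)" and \<tau>="\<tau> (k l)"]) fastforce+
      have balls: "(\<Sum>(a, r)\<in>F j. abs_integral (ball a r) (\<lambda>x. ?f x - ?g x))
          \<le> ennreal (2 * (\<delta> j * A) + real (card (F j)) * \<eta>)"
      proof -
        have "(\<Sum>(a, r)\<in>F j. abs_integral (ball a r) (\<lambda>x. ?f x - ?g x))
          \<le> (\<Sum>(a, r)\<in>F j. abs_integral (ball a r) (\<lambda>x. ?f x - mean ?f (ball a r))
            + abs_integral (ball a r) (\<lambda>x. ?g x - mean ?g (ball a r)) + ennreal \<eta>)"
        proof (rule sum_mono, clarify)
          fix a \<rho> assume i: "(a, \<rho>) \<in> F j"
          have "\<bar>\<phi> (k m) (a, \<rho>) - \<phi> (k n) (a, \<rho>)\<bar> \<le> \<eta>"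
            using N2[OF i, of m n] N(2)[OF i] mn by simp
          then have "ennreal \<bar>(\<integral>x. indicator (ball a \<rho>) x * ?f x \<partial>lborel) - (\<integral>x. indicator (ball a \<rho>) x * ?g x \<partial>lborel)\<bar> \<le> ennreal \<eta>"
            unfolding \<phi>_def by (intro ennreal_leI) simp
          then show "abs_integral (ball a \<rho>) (\<lambda>x. ?f x - ?g x)
            \<le> abs_integral (ball a \<rho>) (\<lambda>x. ?f x - mean ?f (ball a \<rho>))
            + abs_integral (ball a \<rho>) (\<lambda>x. ?g x - mean ?g (ball a \<rho>)) + ennreal \<eta>"
            using F(2)[OF i] by (intro order.trans[OF nn_integral_ball_diff_le] add_left_mono f) auto
        qed
        also have "\<dots> = (\<Sum>(a, r)\<in>F j. abs_integral (ball a r) (\<lambda>x. ?f x - mean ?f (ball a r)))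
            + (\<Sum>(a, r)\<in>F j. abs_integral (ball a r) (\<lambda>x. ?g x - mean ?g (ball a r)))
            + of_nat (card (F j)) * ennreal \<eta>"
          by (simp add: case_prod_beta sum.distrib)
        also have "\<dots> \<le> ennreal (\<delta> j * A) + ennreal (\<delta> j * A) + of_nat (card (F j)) * ennreal \<eta>"
          by (intro add_mono osc mn order.refl)
        also have "\<dots> = ennreal (2 * (\<delta> j * A) + real (card (F j)) * \<eta>)"
          using A \<delta>[of j] \<eta>
          by (simp add: ennreal_of_nat_eq_real_of_nat ennreal_mult'[symmetric] ennreal_plus[symmetric] del: ennreal_plus)
        finally show ?thesis .
      qed
      have "power_integral r \<Omega> (\<lambda>x. ?f x - ?g x)
        \<le> (\<integral>\<^sup>+x. ennreal G * (indicator \<Omega> x * ennreal (min \<bar>?f x - ?g x\<bar> M))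
             + ennreal (M powr (r - s)) * (indicator \<Omega> x * ennreal (\<bar>?f x - ?g x\<bar> powr s)) \<partial>lborel)"
      proof (rule nn_integral_mono)
        fix x
        have "\<bar>?f x - ?g x\<bar> powr r \<le> G * min \<bar>?f x - ?g x\<bar> M + M powr (r - s) * \<bar>?f x - ?g x\<bar> powr s"
          unfolding G_def using M r by (intro powr_le_truncated) auto
        then have "ennreal (\<bar>?f x - ?g x\<bar> powr r)
            \<le> ennreal G * ennreal (min \<bar>?f x - ?g x\<bar> M) + ennreal (M powr (r - s)) * ennreal (\<bar>?f x - ?g x\<bar> powr s)"
          using G M by (simp add: ennreal_mult'[symmetric] ennreal_plus[symmetric] ennreal_leI del: ennreal_plus)
        then show "indicator \<Omega> x * ennreal (\<bar>?f x - ?g x\<bar> powr r)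
            \<le> ennreal G * (indicator \<Omega> x * ennreal (min \<bar>?f x - ?g x\<bar> M))
             + ennreal (M powr (r - s)) * (indicator \<Omega> x * ennreal (\<bar>?f x - ?g x\<bar> powr s))"
          by (cases "x \<in> \<Omega>") auto
      qed
      also have "\<dots> = ennreal G * (\<integral>\<^sup>+x. indicator \<Omega> x * ennreal (min \<bar>?f x - ?g x\<bar> M) \<partial>lborel)
             + ennreal (M powr (r - s)) * power_integral s \<Omega> (\<lambda>x. ?f x - ?g x)"
        by (simp add: nn_integral_add nn_integral_cmult)
      also have "\<dots> \<le> ennreal G * (ennreal M * ennreal (\<delta> j) + ennreal (2 * (\<delta> j * A) + real (card (F j)) * \<eta>))
             + ennreal (M powr (r - s)) * ennreal D"
      proof (intro add_mono mult_left_mono)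
        show "(\<integral>\<^sup>+x. indicator \<Omega> x * ennreal (min \<bar>?f x - ?g x\<bar> M) \<partial>lborel)
          \<le> ennreal M * ennreal (\<delta> j) + ennreal (2 * (\<delta> j * A) + real (card (F j)) * \<eta>)"
          using M F(1,4) \<Omega> by (intro order.trans[OF nn_integral_truncated_le[where F="F j" and e="\<delta> j"]] add_left_mono balls) auto
        show "power_integral s \<Omega> (\<lambda>x. ?f x - ?g x) \<le> ennreal D"
          unfolding D_def using s C C0 by (intro nn_integral_diff_powr_le) auto
      qed auto
      also have "\<dots> = ennreal (G * (M * \<delta> j + (2 * (\<delta> j * A) + real (card (F j)) * \<eta>)) + M powr (r - s) * D)"
        using G M A D \<delta>[of j] \<eta> by (simp add: ennreal_mult'[symmetric] ennreal_plus[symmetric] del: ennreal_plus)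
      also have "\<dots> \<le> ennreal e"
      proof (rule ennreal_leI)
        have "G * (M * \<delta> j + (2 * (\<delta> j * A) + real (card (F j)) * \<eta>))
           = G * (M + 2 * A) * \<delta> j + G * (real (card (F j)) * \<eta>)" by (simp add: algebra_simps)
        then show "G * (M * \<delta> j + (2 * (\<delta> j * A) + real (card (F j)) * \<eta>)) + M powr (r - s) * D \<le> e"
          using j card\<eta> tail by linarith
      qed
      finally show "power_integral r \<Omega> (\<lambda>x. ?f x - ?g x) \<le> ennreal e" .
    qed
  qed
qed

text \<open>
  A subsequence converges almost everywhere by the \<open>L\<^sup>1\<close> Cauchy property, and Fatou's lemma, applied to
  \<open>\<bar>f\<^sub>n - f\<^bsub>k i\<^esub>\<bar>\<^sup>r\<close> as \<open>i\<close> grows, transfers the \<open>L\<^sup>r\<close> Cauchy property to the limit.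
\<close>
lemma Lr_limit:
  fixes f :: "nat \<Rightarrow> 'a::euclidean_space \<Rightarrow> real" and r :: real and Mb :: "nat \<Rightarrow> real"
  assumes f [measurable]: "\<And>n. f n \<in> borel_measurable borel" and bd: "\<And>n x. \<bar>f n x\<bar> \<le> Mb n"
    and \<Omega>: "open \<Omega>" "bounded \<Omega>" and r: "r \<ge> 1"
    and cau1: "\<And>e. 0 < e \<Longrightarrow>
      \<exists>N. \<forall>m\<ge>N. \<forall>n\<ge>N. abs_integral \<Omega> (\<lambda>x. f m x - f n x) \<le> ennreal e"
    and cau: "\<And>e. 0 < e \<Longrightarrow>
      \<exists>N. \<forall>m\<ge>N. \<forall>n\<ge>N. power_integral r \<Omega> (\<lambda>x. f m x - f n x) \<le> ennreal e"
  obtains g where "g \<in> borel_measurable borel"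
    "\<And>e. 0 < e \<Longrightarrow> \<exists>N. \<forall>n\<ge>N. power_integral r \<Omega> (\<lambda>x. f n x - g x) \<le> ennreal e"
proof -
  have [measurable]: "\<Omega> \<in> sets borel" using \<Omega> by simp
  define h where "h n x = indicator \<Omega> x * f n x" for n x
  have [measurable]: "h n \<in> borel_measurable borel" for n unfolding h_def by measurable
  have int: "integrable lborel (h n)" for n
    unfolding h_def using bd emeasure_bounded_finite[OF \<Omega>(2)]
    by (intro integrable_indicator_bounded[where M="Mb n"]) auto
  have "\<exists>N. \<forall>i\<ge>N. \<forall>j\<ge>N. (LINT x|lborel. norm (h i x - h j x)) < e" if e: "e > 0" for e
  proof -
    obtain N where N: "\<And>m n. m \<ge> N \<Longrightarrow> n \<ge> N \<Longrightarrow>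
       abs_integral \<Omega> (\<lambda>x. f m x - f n x) \<le> ennreal (e / 2)"
      using cau1[of "e / 2"] e by auto
    have "(LINT x|lborel. norm (h i x - h j x)) < e" if ij: "i \<ge> N" "j \<ge> N" for i j
    proof -
      have "ennreal (LINT x|lborel. norm (h i x - h j x)) = (\<integral>\<^sup>+x. ennreal (norm (h i x - h j x)) \<partial>lborel)"
        using int by (intro nn_integral_eq_integral[symmetric]) auto
      also have "\<dots> = abs_integral \<Omega> (\<lambda>x. f i x - f j x)"
        by (intro nn_integral_cong) (auto simp: h_def indicator_def)
      also have "\<dots> \<le> ennreal (e / 2)" using N ij by blast
      finally have "(LINT x|lborel. norm (h i x - h j x)) \<le> e / 2"
        using \<open>e > 0\<close> by (simp add: ennreal_le_iff)
      then show ?thesis using \<open>e > 0\<close> by simp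
    qed
    then show ?thesis by blast
  qed
  then have "\<exists>k. strict_mono k \<and> (AE x in lborel. Cauchy (\<lambda>i. h (k i) x))"
    by (rule cauchy_L1_AE_cauchy_subseq[where s=h, OF int]) blast+
  then obtain k where k: "strict_mono k" and AE_Cauchy: "AE x in lborel. Cauchy (\<lambda>i. h (k i) x)"
    by blast
  define g where "g x = lim (\<lambda>i. h (k i) x)" for x
  have g [measurable]: "g \<in> borel_measurable borel" unfolding g_def by measurable
  show ?thesis
  proof (rule that[OF g])
    fix e :: real assume "e > 0"
    then obtain N where N: "\<And>m n. m \<ge> N \<Longrightarrow> n \<ge> N \<Longrightarrow>
       power_integral r \<Omega> (\<lambda>x. f m x - f n x) \<le> ennreal e"
      using cau by blast
    show "\<exists>N. \<forall>n\<ge>N. power_integral r \<Omega> (\<lambda>x. f n x - g x) \<le> ennreal e"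
    proof (intro exI[of _ N] allI impI)
      fix n assume n: "n \<ge> N"
      have "power_integral r \<Omega> (\<lambda>x. f n x - g x)
        = (\<integral>\<^sup>+x. liminf (\<lambda>i. indicator \<Omega> x * ennreal (\<bar>f n x - f (k i) x\<bar> powr r)) \<partial>lborel)"
      proof (intro nn_integral_cong_AE)
        from AE_Cauchy
        show "AE x in lborel. indicator \<Omega> x * ennreal (\<bar>f n x - g x\<bar> powr r)
           = liminf (\<lambda>i. indicator \<Omega> x * ennreal (\<bar>f n x - f (k i) x\<bar> powr r))"
        proof eventually_elim
          case (elim x)
          show ?case
          proof (cases "x \<in> \<Omega>")
            case True
            have "(\<lambda>i. h (k i) x) \<longlonglongrightarrow> g x"
              using elim unfolding g_def by (simp add: Cauchy_convergent_iff convergent_LIMSEQ_iff)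
            then have "(\<lambda>i. f (k i) x) \<longlonglongrightarrow> g x" using True by (simp add: h_def)
            then have "(\<lambda>i. \<bar>f n x - f (k i) x\<bar> powr r) \<longlonglongrightarrow> \<bar>f n x - g x\<bar> powr r"
              using r by (intro tendsto_powr' tendsto_intros) auto
            then have "(\<lambda>i. ennreal (\<bar>f n x - f (k i) x\<bar> powr r)) \<longlonglongrightarrow> ennreal (\<bar>f n x - g x\<bar> powr r)"
              by (intro tendsto_ennrealI)
            then have "liminf (\<lambda>i. ennreal (\<bar>f n x - f (k i) x\<bar> powr r)) = ennreal (\<bar>f n x - g x\<bar> powr r)"
              by (intro lim_imp_Liminf) auto
            then show ?thesis using True by simp
          qed (simp add: Liminf_const)
        qed
      qed
      also have "\<dots> \<le> liminf (\<lambda>i. \<integral>\<^sup>+x. indicator \<Omega> x * ennreal (\<bar>f n x - f (k i) x\<bar> powr r) \<partial>lborel)"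
        by (rule nn_integral_liminf) measurable
      also have "\<dots> \<le> limsup (\<lambda>i. \<integral>\<^sup>+x. indicator \<Omega> x * ennreal (\<bar>f n x - f (k i) x\<bar> powr r) \<partial>lborel)"
        by (rule Liminf_le_Limsup) simp
      also have "\<dots> \<le> ennreal e"
      proof (rule Limsup_bounded)
        show "eventually (\<lambda>i. power_integral r \<Omega> (\<lambda>x. f n x - f (k i) x) \<le> ennreal e) sequentially"
          unfolding eventually_sequentially
          using N n seq_suble[OF k] by (intro exI[of _ N]) (blast intro: le_trans)
      qed
      finally show "power_integral r \<Omega> (\<lambda>x. f n x - g x) \<le> ennreal e" .
    qed
  qed
qed

section \<open>From the weighted graph to the domain\<close>

text \<open>
  The integral of \<open>g\<close> against the discrete measure, kept as a finite sum of reals to match the graph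
  functionals.
\<close>
definition weight_sum :: "'a set \<Rightarrow> 'a measure \<Rightarrow> ('a \<Rightarrow> real) \<Rightarrow> real" where
  "weight_sum V m g = (\<Sum>v\<in>V. g v * measure m {v})"

lemma weight_sum_nonneg: "(\<And>v. v \<in> V \<Longrightarrow> g v \<ge> 0) \<Longrightarrow> weight_sum V m g \<ge> 0"
  unfolding weight_sum_def by (intro sum_nonneg) auto

lemma extend_zero_borel [measurable]:
  assumes "finite V"
  shows "extend_zero V u \<in> borel_measurable borel"
proof -
  have "extend_zero V u = (\<lambda>x. \<Sum>v\<in>V. u v * indicator {v} x)"
  proof
    fix x
    show "extend_zero V u x = (\<Sum>v\<in>V. u v * indicator {v} x)"
      using assms by (cases "x \<in> V") (auto simp: extend_zero_def indicator_def if_distrib sum.delta cong: if_cong)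
  qed
  then show ?thesis by simp
qed

lemma abs_extend_zero_le:
  assumes "finite V"
  shows "\<bar>extend_zero V u x\<bar> \<le> (\<Sum>v\<in>V. \<bar>u v\<bar>)"
proof (cases "x \<in> V")
  case True
  then show ?thesis
    using assms member_le_sum[of x V "\<lambda>v. \<bar>u v\<bar>"] by (simp add: extend_zero_def)
qed (simp add: extend_zero_def sum_nonneg)

text \<open>
  A single graph of the sequence.  Here \<open>m\<close> is the discrete measure on \<open>V\<close>, pushed forward from \<open>\<mu>\<close> by \<open>T\<close>.
  The density bounds make \<open>\<mu>\<close> and Lebesgue measure on \<open>\<Omega>\<close> comparable with constant \<open>D\<close>.
\<close>
locale transported_density =
  fixes \<Omega> :: "(real ^ 'd) set" and \<rho> :: "real ^ 'd \<Rightarrow> real" and \<mu> m :: "(real ^ 'd) measure"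
    and V :: "(real ^ 'd) set" and T :: "real ^ 'd \<Rightarrow> real ^ 'd" and D :: real
  assumes open_\<Omega>: "open \<Omega>" and bounded_\<Omega>: "bounded \<Omega>"
    and cont_\<rho>: "continuous_on \<Omega> \<rho>"
    and \<mu>_def: "\<mu> = density (restrict_space lborel \<Omega>) (\<lambda>x. ennreal (\<rho> x))"
    and prob_\<mu>: "prob_space \<mu>"
    and D_pos: "D > 0" and \<rho>_bounds: "\<And>x. x \<in> \<Omega> \<Longrightarrow> 1 / D \<le> \<rho> x \<and> \<rho> x \<le> D"
    and V: "finite V" "V \<subseteq> \<Omega>"
    and prob_m: "prob_space m" and sets_m: "sets m = sets (borel_on \<Omega>)"
    and T: "T \<in> borel_on \<Omega> \<rightarrow>\<^sub>M borel_on V" and push: "distr \<mu> (borel_on \<Omega>) T = m"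
begin

lemma \<Omega>_borel [measurable, simp]: "\<Omega> \<in> sets borel"
  using open_\<Omega> by simp

lemma T_in: "x \<in> \<Omega> \<Longrightarrow> T x \<in> V"
  using T by (auto simp: measurable_restrict_space2_iff space_restrict_space)

lemma sets_\<mu> [measurable_cong]: "sets \<mu> = sets (borel_on \<Omega>)"
  by (simp add: \<mu>_def sets_restrict_space)

lemma space_\<mu>: "space \<mu> = \<Omega>"
  using sets_eq_imp_space_eq[OF sets_\<mu>] by (simp add: space_restrict_space)

lemma T_measurable [measurable]: "T \<in> borel_on \<Omega> \<rightarrow>\<^sub>M borel_on \<Omega>"
  using T V(2) T_in by (auto simp: measurable_restrict_space2_iff space_restrict_space)

lemma \<rho>_measurable [measurable]: "\<rho> \<in> borel_measurable (borel_on \<Omega>)"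
  using cont_\<rho> by (rule borel_measurable_continuous_on_restrict)

lemma nn_integral_\<mu>:
  assumes [measurable]: "g \<in> borel_measurable (borel_on \<Omega>)"
  shows "(\<integral>\<^sup>+x. g x \<partial>\<mu>) = (\<integral>\<^sup>+x. indicator \<Omega> x * (ennreal (\<rho> x) * g x) \<partial>lborel)"
proof -
  have eq: "borel_measurable (restrict_space lborel \<Omega>) = (borel_measurable (borel_on \<Omega>) :: (real ^ 'd \<Rightarrow> ennreal) set)"
    by (rule measurable_cong_sets) (simp_all add: sets_restrict_space)
  have "(\<integral>\<^sup>+x. g x \<partial>\<mu>) = (\<integral>\<^sup>+x. ennreal (\<rho> x) * g x \<partial>restrict_space lborel \<Omega>)"
    unfolding \<mu>_def by (rule nn_integral_density) (simp_all add: eq)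
  also have "\<dots> = (\<integral>\<^sup>+x. (ennreal (\<rho> x) * g x) * indicator \<Omega> x \<partial>lborel)"
    by (rule nn_integral_restrict_space) simp
  finally show ?thesis by (simp add: mult.commute)
qed

lemma restrict_ennreal_measurable [measurable]:
  fixes g :: "real ^ 'd \<Rightarrow> ennreal"
  assumes "g \<in> borel_measurable (borel_on \<Omega>)"
  shows "(\<lambda>x. indicator \<Omega> x * g x) \<in> borel_measurable borel"
  using assms by (subst (asm) borel_measurable_restrict_space_iff_ennreal) (simp_all add: mult.commute)

lemma lborel_le_\<mu>:
  assumes [measurable]: "g \<in> borel_measurable (borel_on \<Omega>)"
  shows "(\<integral>\<^sup>+x. indicator \<Omega> x * g x \<partial>lborel) \<le> ennreal D * (\<integral>\<^sup>+x. g x \<partial>\<mu>)"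
proof -
  have "(\<integral>\<^sup>+x. indicator \<Omega> x * g x \<partial>lborel)
     \<le> (\<integral>\<^sup>+x. ennreal D * (indicator \<Omega> x * (ennreal (\<rho> x) * g x)) \<partial>lborel)"
  proof (rule nn_integral_mono)
    fix x
    show "indicator \<Omega> x * g x \<le> ennreal D * (indicator \<Omega> x * (ennreal (\<rho> x) * g x))"
    proof (cases "x \<in> \<Omega>")
      case True
      have "1 \<le> D * \<rho> x" using \<rho>_bounds[OF True] D_pos by (simp add: field_simps)
      then have "1 * g x \<le> ennreal (D * \<rho> x) * g x" by (intro mult_right_mono) auto
      then show ?thesis using True D_pos by (simp add: ennreal_mult' mult.assoc)
    qed simp
  qed
  also have "\<dots> = ennreal D * (\<integral>\<^sup>+x. g x \<partial>\<mu>)"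
    unfolding nn_integral_\<mu>[OF assms] by (rule nn_integral_cmult) measurable
  finally show ?thesis .
qed

lemma \<mu>_le_lborel:
  assumes [measurable]: "g \<in> borel_measurable (borel_on \<Omega>)"
  shows "(\<integral>\<^sup>+x. g x \<partial>\<mu>) \<le> ennreal D * (\<integral>\<^sup>+x. indicator \<Omega> x * g x \<partial>lborel)"
proof -
  have "(\<integral>\<^sup>+x. g x \<partial>\<mu>) \<le> (\<integral>\<^sup>+x. ennreal D * (indicator \<Omega> x * g x) \<partial>lborel)"
    unfolding nn_integral_\<mu>[OF assms]
  proof (rule nn_integral_mono)
    fix x
    show "indicator \<Omega> x * (ennreal (\<rho> x) * g x) \<le> ennreal D * (indicator \<Omega> x * g x)"
      using \<rho>_bounds[of x] by (cases "x \<in> \<Omega>") (auto intro!: mult_right_mono ennreal_leI)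
  qed
  also have "\<dots> = ennreal D * (\<integral>\<^sup>+x. indicator \<Omega> x * g x \<partial>lborel)"
    by (rule nn_integral_cmult) measurable
  finally show ?thesis .
qed

text \<open>
  Lebesgue measure on \<open>\<Omega>\<close> is at most \<open>D \<mu>\<close>, and \<open>\<mu>\<close> transports to \<open>m\<close>.  The function \<open>g\<close> is arbitrary: on the
  finite set \<open>V\<close> measurability is automatic.
\<close>
lemma nn_integral_transport_le:
  fixes g :: "real ^ 'd \<Rightarrow> real"
  assumes g: "\<And>v. v \<in> V \<Longrightarrow> g v \<ge> 0"
  shows "(\<integral>\<^sup>+x. indicator \<Omega> x * ennreal (g (T x)) \<partial>lborel) \<le> ennreal (D * weight_sum V m g)"
proof -
  interpret m: prob_space m by (rule prob_m)
  let ?g = "\<lambda>x. ennreal (extend_zero V g x)"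
  have gm: "?g \<in> borel_measurable (borel_on \<Omega>)"
    using V(1) by (intro measurable_restrict_space1) measurable
  have Tb: "T \<in> \<mu> \<rightarrow>\<^sub>M borel_on \<Omega>" using T_measurable by simp
  have "(\<integral>\<^sup>+x. indicator \<Omega> x * ennreal (g (T x)) \<partial>lborel) = (\<integral>\<^sup>+x. indicator \<Omega> x * ?g (T x) \<partial>lborel)"
    using T_in by (intro nn_integral_cong) (auto simp: indicator_def extend_zero_def)
  also have "\<dots> \<le> ennreal D * (\<integral>\<^sup>+x. ?g (T x) \<partial>\<mu>)"
    by (rule lborel_le_\<mu>) (rule measurable_compose[OF T_measurable gm])
  also have "(\<integral>\<^sup>+x. ?g (T x) \<partial>\<mu>) = (\<integral>\<^sup>+v. ?g v \<partial>m)"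
    unfolding push[symmetric] using gm by (intro nn_integral_distr[symmetric] Tb) simp
  also have "\<dots> = (\<integral>\<^sup>+v. ennreal (g v) * indicator V v \<partial>m)"
    by (intro nn_integral_cong) (auto simp: extend_zero_def indicator_def)
  also have "\<dots> = (\<Sum>v\<in>V. ennreal (g v) * emeasure m {v})"
  proof (rule nn_integral_indicator_finite[OF V(1)])
    fix v assume "v \<in> V"
    then show "{v} \<in> sets m" using V(2) by (auto simp: sets_m sets_restrict_space_iff)
  qed
  also have "\<dots> = (\<Sum>v\<in>V. ennreal (g v * measure m {v}))"
    using g by (intro sum.cong refl) (simp add: m.emeasure_eq_measure ennreal_mult)
  also have "\<dots> = ennreal (weight_sum V m g)"
    unfolding weight_sum_def using g by (intro sum_ennreal) auto
  finally show ?thesis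
    using D_pos by (simp add: ennreal_mult')
qed

definition pullback :: "(real ^ 'd \<Rightarrow> real) \<Rightarrow> real ^ 'd \<Rightarrow> real" where
  "pullback u x = indicator \<Omega> x * extend_zero V u (T x)"

lemma pullback_in: "x \<in> \<Omega> \<Longrightarrow> pullback u x = u (T x)"
  using T_in by (simp add: pullback_def extend_zero_def)

lemma pullback_borel [measurable]: "pullback u \<in> borel_measurable borel"
proof -
  have "extend_zero V u \<in> borel_measurable (borel_on \<Omega>)"
    using extend_zero_borel[OF V(1)] by (rule measurable_restrict_space1)
  then have "(\<lambda>x. extend_zero V u (T x)) \<in> borel_measurable (borel_on \<Omega>)"
    by (rule measurable_compose[OF T_measurable])
  then show ?thesis
    unfolding pullback_def[abs_def]
    by (subst (asm) borel_measurable_restrict_space_iff) simp_all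
qed

lemma pullback_bounded: "\<bar>pullback u x\<bar> \<le> (\<Sum>v\<in>V. \<bar>u v\<bar>)"
  using abs_extend_zero_le[OF V(1), of u "T x"] by (auto simp: pullback_def indicator_def intro: sum_nonneg)

lemma pullback_Lp:
  assumes p: "p \<ge> 1"
  shows "power_integral p \<Omega> (pullback u)
    \<le> ennreal (D * graph_Lp_norm p V m u powr p)"
proof -
  have "power_integral p \<Omega> (pullback u)
    = (\<integral>\<^sup>+x. indicator \<Omega> x * ennreal ((\<lambda>v. \<bar>u v\<bar> powr p) (T x)) \<partial>lborel)"
    by (intro nn_integral_cong) (auto simp: indicator_def pullback_in)
  also have "\<dots> \<le> ennreal (D * weight_sum V m (\<lambda>v. \<bar>u v\<bar> powr p))"
    by (rule nn_integral_transport_le) simp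
  also have "weight_sum V m (\<lambda>v. \<bar>u v\<bar> powr p) = graph_Lp_norm p V m u powr p"
    using p by (simp add: graph_Lp_norm_def weight_sum_def powr_powr sum_nonneg)
  finally show ?thesis .
qed

end

text \<open>
  Two points of \<open>\<Omega>\<close> less than \<open>b / 2 \<sqdot> \<epsilon>\<close> apart have images at most \<open>b \<epsilon>\<close> apart, as each of them moves by
  at most \<open>b / 4 \<sqdot> \<epsilon>\<close>.  At such distances the scaled kernel is bounded below.
\<close>
locale transported_kernel = transported_density \<Omega> \<rho> \<mu> m V T D
  for \<Omega> :: "(real ^ 'd) set" and \<rho> \<mu> m V T D +
  fixes \<eta> :: "real \<Rightarrow> real" and a b \<epsilon> p :: real and u :: "real ^ 'd \<Rightarrow> real"
  assumes \<eta>_nonneg: "\<And>r. r \<ge> 0 \<Longrightarrow> \<eta> r \<ge> 0" and ab: "a > 0" "b > 0"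
    and \<eta>_lower: "\<And>r. 0 \<le> r \<Longrightarrow> r \<le> b \<Longrightarrow> a \<le> \<eta> r"
    and \<epsilon>: "\<epsilon> > 0" and displacement: "\<And>x. x \<in> \<Omega> \<Longrightarrow> norm (T x - x) \<le> b / 4 * \<epsilon>"
    and p_ge: "p \<ge> 1"
begin

text \<open>
  The integrand of the graph energy, normalised so that it dominates \<open>\<bar>u v - u w\<bar>\<^sup>p\<close> whenever
  \<open>\<bar>v - w\<bar> \<le> b \<epsilon>\<close>.
\<close>
definition interaction :: "real ^ 'd \<Rightarrow> real ^ 'd \<Rightarrow> real" where
  "interaction v w = \<eta> (norm (v - w) / \<epsilon>) / a * \<bar>u v - u w\<bar> powr p"

lemma interaction_nonneg: "interaction v w \<ge> 0"
  using \<eta>_nonneg ab \<epsilon> by (simp add: interaction_def)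

lemma pullback_le_interaction:
  assumes xy: "x \<in> \<Omega>" "y \<in> \<Omega>" "norm (y - x) < b / 2 * \<epsilon>"
  shows "\<bar>pullback u x - pullback u y\<bar> powr p \<le> interaction (T x) (T y)"
proof -
  have "norm (T x - T y) \<le> norm (T x - x) + norm (y - x) + norm (T y - y)"
    using norm_triangle_ineq4[of "(T x - x) - (y - x)" "T y - y"] norm_triangle_ineq4[of "T x - x" "y - x"]
    by (simp add: algebra_simps)
  also have "\<dots> \<le> b * \<epsilon>"
    using displacement[OF xy(1)] displacement[OF xy(2)] xy(3) by (simp add: field_simps)
  finally have "norm (T x - T y) / \<epsilon> \<le> b" using \<epsilon> by (simp add: field_simps)
  then have "1 \<le> \<eta> (norm (T x - T y) / \<epsilon>) / a" using \<eta>_lower \<epsilon> ab by (simp add: field_simps)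
  then have "1 * \<bar>u (T x) - u (T y)\<bar> powr p \<le> interaction (T x) (T y)"
    unfolding interaction_def by (intro mult_right_mono) auto
  then show ?thesis using xy by (simp add: pullback_in)
qed

lemma sum_interaction:
  "weight_sum V m (\<lambda>v. weight_sum V m (interaction v)) = \<epsilon> powr (p + CARD('d)) * graph_energy \<eta> p \<epsilon> V m u / a"
proof -
  have "graph_energy \<eta> p \<epsilon> V m u * (\<epsilon> powr p * \<epsilon> ^ CARD('d) / a)
    = (\<Sum>v\<in>V. \<Sum>w\<in>V. interaction v w * measure m {w} * measure m {v})"
    using \<epsilon> unfolding graph_energy_def scaled_kernel_def interaction_def sum_distrib_left sum_distrib_right
    by (intro sum.cong refl) (simp add: field_simps)
  also have "\<dots> = weight_sum V m (\<lambda>v. weight_sum V m (interaction v))"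
    unfolding weight_sum_def by (simp add: sum_distrib_right)
  finally show ?thesis using \<epsilon> by (simp add: powr_add powr_realpow mult_ac)
qed

lemma point_energy_pullback_le:
  assumes "x \<in> \<Omega>"
  shows "point_energy p (b / 2 * \<epsilon>) (pullback u) \<Omega> x
    \<le> ennreal (D * weight_sum V m (interaction (T x)))"
proof -
  have "point_energy p (b / 2 * \<epsilon>) (pullback u) \<Omega> x
    \<le> (\<integral>\<^sup>+y. indicator \<Omega> y * ennreal (interaction (T x) (T y)) \<partial>lborel)"
    using pullback_le_interaction[OF assms]
    by (intro nn_integral_mono) (auto simp: indicator_def intro!: ennreal_leI)
  also have "\<dots> \<le> ennreal (D * weight_sum V m (interaction (T x)))"
    using interaction_nonneg by (intro nn_integral_transport_le) auto
  finally show ?thesis .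
qed

lemma pullback_pair_energy:
  "pair_energy p (b / 2 * \<epsilon>) (pullback u) \<Omega>
     \<le> ennreal (D\<^sup>2 / a * graph_energy \<eta> p \<epsilon> V m u * \<epsilon> powr (p + CARD('d)))"
proof -
  have "pair_energy p (b / 2 * \<epsilon>) (pullback u) \<Omega>
    \<le> (\<integral>\<^sup>+x. indicator \<Omega> x * ennreal ((\<lambda>v. D * weight_sum V m (interaction v)) (T x)) \<partial>lborel)"
    unfolding pair_energy_def
  proof (rule nn_integral_mono)
    fix x
    show "(\<integral>\<^sup>+y. indicator \<Omega> x * indicator \<Omega> y * indicator {v. norm v < b / 2 * \<epsilon>} (y - x)
        * ennreal (\<bar>pullback u x - pullback u y\<bar> powr p) \<partial>lborel)
      \<le> indicator \<Omega> x * ennreal ((\<lambda>v. D * weight_sum V m (interaction v)) (T x))"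
      using point_energy_pullback_le[of x] by (cases "x \<in> \<Omega>") auto
  qed
  also have "\<dots> \<le> ennreal (D * weight_sum V m (\<lambda>v. D * weight_sum V m (interaction v)))"
    using D_pos interaction_nonneg by (intro nn_integral_transport_le mult_nonneg_nonneg weight_sum_nonneg) auto
  also have "weight_sum V m (\<lambda>v. D * weight_sum V m (interaction v))
      = D * weight_sum V m (\<lambda>v. weight_sum V m (interaction v))"
    by (simp add: weight_sum_def sum_distrib_left mult_ac)
  finally show ?thesis
    unfolding sum_interaction by (simp add: power2_eq_square mult_ac)
qed

text \<open>
  The mass of the vertex \<open>T x\<close> is at least the minimal weight, hence the interactions of this single vertex
  account for at most the total energy divided by the minimal weight.
\<close>
lemma pullback_pointwise:
  assumes x: "x \<in> \<Omega>" and \<Lambda>: "min_weight V m > 0"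
  shows "point_energy p (b / 2 * \<epsilon>) (pullback u) \<Omega> x
    \<le> ennreal (D / a * graph_energy \<eta> p \<epsilon> V m u * \<epsilon> powr (p + CARD('d)) / min_weight V m)"
proof -
  let ?S = "\<lambda>v. weight_sum V m (interaction v)"
  have S: "?S v \<ge> 0" for v using interaction_nonneg by (intro weight_sum_nonneg)
  have Tx: "T x \<in> V" using x by (rule T_in)
  have "min_weight V m \<le> measure m {T x}"
    unfolding min_weight_def using V(1) Tx by (intro Min_le) auto
  then have "min_weight V m * ?S (T x) \<le> ?S (T x) * measure m {T x}"
    using mult_right_mono[OF _ S[of "T x"]] by (simp add: mult.commute)
  also have "\<dots> \<le> weight_sum V m ?S"
    unfolding weight_sum_def[of V m ?S] using V(1) Tx S by (intro member_le_sum) auto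
  finally have "?S (T x) \<le> weight_sum V m ?S / min_weight V m"
    using \<Lambda> by (simp add: field_simps)
  then have "D * ?S (T x) \<le> D * (weight_sum V m ?S / min_weight V m)"
    using D_pos by (intro mult_left_mono) auto
  also have "\<dots> = D / a * graph_energy \<eta> p \<epsilon> V m u * \<epsilon> powr (p + CARD('d)) / min_weight V m"
    unfolding sum_interaction by simp
  finally show ?thesis using point_energy_pullback_le[OF x] by (meson ennreal_leI order.trans)
qed

end

section \<open>Transport couplings and the TL distance\<close>

lemma TL_dist_nonneg:
  assumes "couplings \<Omega> \<nu> \<kappa> \<noteq> {}"
  shows "TL_dist r \<Omega> (f, \<nu>) (g, \<kappa>) \<ge> 0"
  unfolding TL_dist_def prod.case using assms by (intro cINF_greatest) auto

lemma TL_dist_le_coupling: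
  assumes "\<gamma> \<in> couplings \<Omega> \<nu> \<kappa>"
  shows "TL_dist r \<Omega> (f, \<nu>) (g, \<kappa>)
    \<le> (\<integral>(x, y). norm (x - y) powr r + \<bar>f x - g y\<bar> powr r \<partial>\<gamma>) powr (1 / r)"
  unfolding TL_dist_def prod.case
  by (rule cINF_lower[OF _ assms]) (auto intro!: bdd_belowI[of _ 0])

lemma integrable_norm_powr_bounded:
  fixes \<Omega> :: "(real ^ 'd) set"
  assumes "bounded \<Omega>" "r \<ge> 0" "prob_space \<nu>" "sets \<nu> = sets (borel_on \<Omega>)"
  shows "integrable \<nu> (\<lambda>x. norm x powr r)"
proof -
  interpret prob_space \<nu> by fact
  have space: "space \<nu> = \<Omega>" using sets_eq_imp_space_eq[OF assms(4)] by (simp add: space_restrict_space)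
  obtain B where B: "\<And>x. x \<in> \<Omega> \<Longrightarrow> norm x \<le> B" using assms(1) by (auto simp: bounded_iff)
  show ?thesis
  proof (rule integrable_const_bound[where B="B powr r"])
    show "AE x in \<nu>. norm (norm x powr r) \<le> B powr r"
      using B assms(2) by (intro AE_I2) (auto simp: space intro!: powr_mono2)
    have "(\<lambda>x. norm x powr r) \<in> borel_measurable (borel_on \<Omega>)"
      by (rule measurable_restrict_space1) measurable
    then show "(\<lambda>x. norm x powr r) \<in> borel_measurable \<nu>"
      by (simp add: measurable_cong_sets[OF assms(4) refl])
  qed
qed

context transported_density
begin

lemma discrete_in_TL_space:
  assumes r: "r \<ge> 1"
  shows "(extend_zero V u, m) \<in> TL_space r \<Omega>"
proof -
  interpret m: prob_space m by (rule prob_m)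
  have meas: "extend_zero V u \<in> borel_measurable m"
    using measurable_restrict_space1[OF extend_zero_borel[OF V(1), of u], of \<Omega>]
    by (simp add: measurable_cong_sets[OF sets_m refl])
  have "integrable m (\<lambda>x. \<bar>extend_zero V u x\<bar> powr r)"
  proof (rule m.integrable_const_bound[where B="(\<Sum>v\<in>V. \<bar>u v\<bar>) powr r"])
    show "AE x in m. norm (\<bar>extend_zero V u x\<bar> powr r) \<le> (\<Sum>v\<in>V. \<bar>u v\<bar>) powr r"
      using abs_extend_zero_le[OF V(1), of u] r by (intro AE_I2) (auto intro!: powr_mono2)
  qed (use meas in measurable)
  then show ?thesis
    using meas prob_m sets_m integrable_norm_powr_bounded[OF bounded_\<Omega> _ prob_m sets_m, of r] r
    by (simp add: TL_space_def)
qed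

lemma continuum_in_TL_space:
  assumes r: "r \<ge> 1" and g: "g \<in> borel_measurable borel"
    and fin: "power_integral r \<Omega> g < \<infinity>"
  shows "(g, \<mu>) \<in> TL_space r \<Omega>"
proof -
  have g': "g \<in> borel_measurable (borel_on \<Omega>)" using g by (rule measurable_restrict_space1)
  then have meas: "g \<in> borel_measurable \<mu>" by (simp add: measurable_cong_sets[OF sets_\<mu> refl])
  have "(\<integral>\<^sup>+x. ennreal (\<bar>g x\<bar> powr r) \<partial>\<mu>) \<le> ennreal D * power_integral r \<Omega> g"
    using g' by (intro \<mu>_le_lborel) measurable
  also have "\<dots> < \<infinity>" using fin by (simp add: ennreal_mult_less_top)
  finally have "integrable \<mu> (\<lambda>x. \<bar>g x\<bar> powr r)"
    using meas by (intro integrableI_nonneg) auto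
  then show ?thesis
    using meas prob_\<mu> sets_\<mu> integrable_norm_powr_bounded[OF bounded_\<Omega> _ prob_\<mu> sets_\<mu>, of r] r
    by (simp add: TL_space_def)
qed

definition transport_coupling :: "((real ^ 'd) \<times> (real ^ 'd)) measure" where
  "transport_coupling = distr \<mu> (borel_on \<Omega> \<Otimes>\<^sub>M borel_on \<Omega>) (\<lambda>x. (T x, x))"

lemma graph_measurable: "(\<lambda>x. (T x, x)) \<in> \<mu> \<rightarrow>\<^sub>M borel_on \<Omega> \<Otimes>\<^sub>M borel_on \<Omega>"
  by measurable

lemma transport_coupling: "transport_coupling \<in> couplings \<Omega> m \<mu>"
proof -
  interpret \<mu>: prob_space \<mu> by (rule prob_\<mu>)
  have "prob_space transport_coupling"
    unfolding transport_coupling_def by (rule \<mu>.prob_space_distr[OF graph_measurable])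
  moreover have "distr transport_coupling (borel_on \<Omega>) fst = m"
    unfolding transport_coupling_def push[symmetric]
    by (subst distr_distr[OF measurable_fst graph_measurable]) (simp add: comp_def)
  moreover have "distr transport_coupling (borel_on \<Omega>) snd = \<mu>"
    unfolding transport_coupling_def
    by (subst distr_distr[OF measurable_snd graph_measurable])
       (simp add: comp_def distr_id2 sets_\<mu>)
  ultimately show ?thesis
    by (simp add: couplings_def transport_coupling_def)
qed

text \<open>
  The transport coupling bounds the infimum; its cost is the displacement plus the distance of the pulled back
  function to \<open>g\<close> in \<open>L\<^sup>r(\<mu>)\<close>.
\<close>
lemma TL_dist_le:
  assumes r: "r \<ge> 1" and g: "g \<in> borel_measurable borel"
    and disp: "\<And>x. x \<in> \<Omega> \<Longrightarrow> norm (T x - x) \<le> \<delta>" and e: "e \<ge> 0"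
    and diff: "power_integral r \<Omega> (\<lambda>x. pullback u x - g x) \<le> ennreal e"
  shows "TL_dist r \<Omega> (extend_zero V u, m) (g, \<mu>) \<le> (\<delta> powr r + D * e) powr (1 / r)"
proof -
  interpret \<mu>: prob_space \<mu> by (rule prob_\<mu>)
  let ?c = "\<lambda>(x, y). norm (x - y) powr r + \<bar>extend_zero V u x - g y\<bar> powr r"
  have u_meas: "extend_zero V u \<in> borel_measurable (borel_on \<Omega>)"
    using extend_zero_borel[OF V(1)] by (rule measurable_restrict_space1)
  have g_meas: "g \<in> borel_measurable (borel_on \<Omega>)" using g by (rule measurable_restrict_space1)
  have id_meas: "(\<lambda>x. x) \<in> borel_on \<Omega> \<rightarrow>\<^sub>M (borel :: (real ^ 'd) measure)"
    by (rule measurable_restrict_space1) simp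
  have fst_b: "fst \<in> borel_on \<Omega> \<Otimes>\<^sub>M borel_on \<Omega> \<rightarrow>\<^sub>M (borel :: (real ^ 'd) measure)"
    by (rule measurable_compose[OF measurable_fst id_meas])
  have snd_b: "snd \<in> borel_on \<Omega> \<Otimes>\<^sub>M borel_on \<Omega> \<rightarrow>\<^sub>M (borel :: (real ^ 'd) measure)"
    by (rule measurable_compose[OF measurable_snd id_meas])
  have c_meas: "?c \<in> borel_measurable (borel_on \<Omega> \<Otimes>\<^sub>M borel_on \<Omega>)"
    unfolding case_prod_beta
  proof (rule borel_measurable_add)
    have [measurable]: "(\<lambda>v :: real ^ 'd. norm v powr r) \<in> borel_measurable borel" by measurable
    show "(\<lambda>z. norm (fst z - snd z) powr r) \<in> borel_measurable (borel_on \<Omega> \<Otimes>\<^sub>M borel_on \<Omega>)"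
      by (rule measurable_compose[OF borel_measurable_diff[OF fst_b snd_b]]) measurable
    have [measurable]: "(\<lambda>t :: real. \<bar>t\<bar> powr r) \<in> borel_measurable borel" by measurable
    show "(\<lambda>z. \<bar>extend_zero V u (fst z) - g (snd z)\<bar> powr r) \<in> borel_measurable (borel_on \<Omega> \<Otimes>\<^sub>M borel_on \<Omega>)"
      by (rule measurable_compose[OF borel_measurable_diff[OF
            measurable_compose[OF measurable_fst u_meas] measurable_compose[OF measurable_snd g_meas]]])
        measurable
  qed
  have "(\<integral>z. ?c z \<partial>transport_coupling) = (\<integral>x. ?c (T x, x) \<partial>\<mu>)"
    unfolding transport_coupling_def by (rule integral_distr[OF graph_measurable c_meas])
  also have "\<dots> \<le> \<delta> powr r + D * e"
  proof -
    have m2: "(\<lambda>x. ?c (T x, x)) \<in> borel_measurable \<mu>"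
      by (rule measurable_compose[OF graph_measurable c_meas])
    have d_meas: "(\<lambda>x. ennreal (\<bar>pullback u x - g x\<bar> powr r)) \<in> borel_measurable (borel_on \<Omega>)"
      using g by (intro measurable_restrict_space1) measurable
    then have d_meas': "(\<lambda>x. ennreal (\<bar>pullback u x - g x\<bar> powr r)) \<in> borel_measurable \<mu>"
      by (simp add: measurable_cong_sets[OF sets_\<mu> refl])
    have "(\<integral>\<^sup>+x. ennreal (?c (T x, x)) \<partial>\<mu>)
      \<le> (\<integral>\<^sup>+x. ennreal (\<delta> powr r) + ennreal (\<bar>pullback u x - g x\<bar> powr r) \<partial>\<mu>)"
    proof (rule nn_integral_mono)
      fix x assume "x \<in> space \<mu>"
      then have x: "x \<in> \<Omega>" by (simp add: space_\<mu>)
      have "norm (T x - x) powr r \<le> \<delta> powr r" using disp[OF x] r by (intro powr_mono2) auto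
      then show "ennreal (?c (T x, x)) \<le> ennreal (\<delta> powr r) + ennreal (\<bar>pullback u x - g x\<bar> powr r)"
        using x by (simp add: pullback_def ennreal_plus[symmetric] ennreal_leI del: ennreal_plus)
    qed
    also have "\<dots> = ennreal (\<delta> powr r) + (\<integral>\<^sup>+x. ennreal (\<bar>pullback u x - g x\<bar> powr r) \<partial>\<mu>)"
      using d_meas' by (subst nn_integral_add) (simp_all add: \<mu>.emeasure_space_1)
    also have "\<dots> \<le> ennreal (\<delta> powr r) + ennreal D * ennreal e"
      using order.trans[OF \<mu>_le_lborel[OF d_meas] mult_left_mono[OF diff]] by (intro add_left_mono) auto
    also have "\<dots> = ennreal (\<delta> powr r + D * e)"
      using D_pos e by (simp add: ennreal_mult'[symmetric] ennreal_plus[symmetric] del: ennreal_plus)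
    finally have le: "(\<integral>\<^sup>+x. ennreal (?c (T x, x)) \<partial>\<mu>) \<le> ennreal (\<delta> powr r + D * e)" .
    have "(\<integral>x. ?c (T x, x) \<partial>\<mu>) = enn2real (\<integral>\<^sup>+x. ennreal (?c (T x, x)) \<partial>\<mu>)"
      using m2 by (intro integral_eq_nn_integral) auto
    also have "\<dots> \<le> \<delta> powr r + D * e"
      using le D_pos e by (intro enn2real_leI) auto
    finally show ?thesis .
  qed
  finally have "(\<integral>z. ?c z \<partial>transport_coupling) powr (1 / r) \<le> (\<delta> powr r + D * e) powr (1 / r)"
    using r by (intro powr_mono2) (auto intro!: Bochner_Integration.integral_nonneg)
  with TL_dist_le_coupling[OF transport_coupling, of r "extend_zero V u" g] show ?thesis by linarith
qed

lemma TL_dist_transport_nonneg: "TL_dist r \<Omega> (extend_zero V u, m) (g, \<mu>) \<ge> 0"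
  using transport_coupling by (intro TL_dist_nonneg) auto

end

section \<open>Relative compactness\<close>

text \<open>
  All weights are at most \<open>1\<close>, so the condition for \<open>q\<close> implies the one for any smaller \<open>s\<close>, and as
  \<open>L \<le> U\<close> it gives \<open>\<epsilon> L\<^bsup>1/s-1/p\<^esup> \<le> H\<close>.  Raised to the power \<open>s\<close>, this is the growth allowed for the
  energy at a single point.
\<close>
lemma weight_condition:
  fixes L U \<epsilon> p q s H :: real
  assumes L: "0 < L" "L \<le> U" "L \<le> 1" and \<epsilon>: "\<epsilon> > 0" and pqs: "1 \<le> p" "p \<le> s" "s \<le> q"
    and H: "\<epsilon> * U powr (1 / q + 1 / p) / L powr (2 / p) \<le> H"
  shows "\<epsilon> powr s * (1 / L) powr ((s - p) / p) \<le> H powr s"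
proof -
  have "L powr (1 / s - 1 / p) \<le> L powr (1 / q - 1 / p)"
    using L pqs by (intro powr_mono') (auto simp: frac_le)
  also have "\<dots> = L powr (1 / q + 1 / p) / L powr (2 / p)"
    using L by (simp add: powr_diff[symmetric])
  also have "\<dots> \<le> U powr (1 / q + 1 / p) / L powr (2 / p)"
    using L pqs by (intro divide_right_mono powr_mono2) auto
  finally have "\<epsilon> * L powr (1 / s - 1 / p) \<le> \<epsilon> * (U powr (1 / q + 1 / p) / L powr (2 / p))"
    using \<epsilon> by (intro mult_left_mono) auto
  also have "\<dots> \<le> H" using H by simp
  finally have "(\<epsilon> * L powr (1 / s - 1 / p)) powr s \<le> H powr s"
    using \<epsilon> pqs by (intro powr_mono2) auto
  moreover have "(\<epsilon> * L powr (1 / s - 1 / p)) powr s = \<epsilon> powr s * (1 / L) powr ((s - p) / p)"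
  proof -
    have "(1 / s - 1 / p) * s = - ((s - p) / p)" using pqs by (simp add: field_simps)
    moreover have "(1 / L) powr ((s - p) / p) = L powr - ((s - p) / p)"
      using L by (simp add: powr_divide powr_minus_divide)
    ultimately show ?thesis using L \<epsilon> by (simp add: powr_mult powr_powr)
  qed
  ultimately show ?thesis by simp
qed

lemma min_weight_bounds:
  fixes V :: "(real ^ 'd) set"
  assumes "finite V" "V \<noteq> {}" "prob_space m"
  shows "min_weight V m \<le> max_weight V m" "min_weight V m \<le> 1"
proof -
  interpret prob_space m by fact
  obtain v where v: "v \<in> V" using assms(2) by blast
  have 1: "min_weight V m \<le> measure m {v}"
    unfolding min_weight_def using assms(1) v by (intro Min_le) auto
  also have "\<dots> \<le> max_weight V m"
    unfolding max_weight_def using assms(1) v by (intro Max_ge) auto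
  finally show "min_weight V m \<le> max_weight V m" .
  show "min_weight V m \<le> 1" using 1 prob_le_1[of "{v}"] by linarith
qed

text \<open>
  If \<open>r < p\<close>, then \<open>s = p\<close> works and the bound in \<open>L\<^sup>p\<close> is all that is used.  Otherwise \<open>s\<close> is chosen strictly
  between \<open>r\<close> and \<open>q\<close>, hence below the Sobolev exponent; the last condition says precisely that.
\<close>
lemma intermediate_exponent:
  fixes p q r d :: real
  assumes "1 \<le> p" "p < d" "p \<le> q" "q \<le> d * p / (d - p)" "r < q"
  obtains s where "p \<le> s" "r < s" "s \<le> q" "(p - d) * ((s - p) / p) + p > 0"
proof (cases "r < p")
  case True
  show ?thesis by (rule that[of p]) (use True assms in auto)
next
  case False
  define s where "s = (r + q) / 2"
  have s: "r < s" "s < q" using assms by (auto simp: s_def)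
  then have "s < d * p / (d - p)" using assms by linarith
  then have "s * (d - p) < d * p" using assms by (simp add: pos_less_divide_eq)
  then have "(d - p) * (s - p) < p * p" by (simp add: algebra_simps)
  then have "(d - p) * ((s - p) / p) < p" using assms by (simp add: field_simps)
  moreover have "(p - d) * ((s - p) / p) = - ((d - p) * ((s - p) / p))"
    unfolding minus_mult_left by simp
  ultimately have "(p - d) * ((s - p) / p) + p > 0" by linarith
  then show ?thesis using s False by (intro that[of s]) auto
qed

text \<open>
  The constants \<open>E\<close>, \<open>B\<close>, \<open>B0\<close> below are the uniform bounds that make the higher integrability and the
  compactness statements applicable to the pulled back functions \<open>f\<^sub>n\<close> with interaction radius
  \<open>\<tau>\<^sub>n = b / 2 \<sqdot> \<epsilon>\<^sub>n\<close>.
\<close>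
theorem energy_bounded_relatively_compact:
  fixes \<Omega> :: "(real ^ 'd) set" and \<epsilon> :: "nat \<Rightarrow> real" and u :: "nat \<Rightarrow> real ^ 'd \<Rightarrow> real"
    and p q r a b D G H Nu :: real
  assumes lip: "lipschitz_boundary \<Omega>"
    and pq: "1 \<le> p" "p < CARD('d)" "p \<le> q" "q \<le> CARD('d) * p / (CARD('d) - p)"
    and kernel: "\<And>n. transported_kernel \<Omega> \<rho> \<mu> (m n) (V n) (T n) D \<eta> a b (\<epsilon> n) p"
    and \<epsilon>: "\<epsilon> \<longlonglongrightarrow> 0"
    and \<Lambda>: "\<And>n. min_weight (V n) (m n) > 0"
    and H: "\<And>n. \<epsilon> n * max_weight (V n) (m n) powr (1 / q + 1 / p) / min_weight (V n) (m n) powr (2 / p) \<le> H"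
    and Nu: "\<And>n. graph_Lp_norm p (V n) (m n) (u n) \<le> Nu"
    and G: "G \<ge> 0" "\<And>n. graph_energy \<eta> p (\<epsilon> n) (V n) (m n) (u n) \<le> G"
    and r: "1 \<le> r" "r < q"
  shows "TL_relatively_compact r \<Omega> (\<lambda>n. (extend_zero (V n) (u n), m n))"
  unfolding TL_relatively_compact_def
proof (intro allI impI)
  fix \<sigma> :: "nat \<Rightarrow> nat" assume \<sigma>: "strict_mono \<sigma>"
  interpret K: transported_kernel \<Omega> \<rho> \<mu> "m n" "V n" "T n" D \<eta> a b "\<epsilon> n" p "u n" for n
    by (rule kernel)
  note [measurable] = K.pullback_borel
  have \<Omega>: "open \<Omega>" "bounded \<Omega>" using K.open_\<Omega> K.bounded_\<Omega> .
  have D: "D > 0" and a: "a > 0" and b: "b > 0" using K.D_pos K.ab by auto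
  have \<Omega>_ne: "\<Omega> \<noteq> {}" using prob_space.not_empty[OF K.prob_\<mu>] K.space_\<mu> by simp
  have V_ne: "V n \<noteq> {}" for n using K.T_in[of _ n] \<Omega>_ne by blast
  obtain s where s: "p \<le> s" "r < s" "s \<le> q" "(p - CARD('d)) * ((s - p) / p) + p > 0"
    using intermediate_exponent[OF pq r(2)] by blast
  let ?d = "CARD('d)"
  define f where "f n = K.pullback n (u n)" for n
  have f [measurable]: "f n \<in> borel_measurable borel" for n
    unfolding f_def by (rule K.pullback_borel)
  define Mb where "Mb n = (\<Sum>v\<in>V n. \<bar>u n v\<bar>)" for n
  have bd: "\<bar>f n x\<bar> \<le> Mb n" for n x unfolding f_def Mb_def by (rule K.pullback_bounded)
  define \<tau> where "\<tau> n = b / 2 * \<epsilon> n" for n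
  have \<tau>: "\<tau> n > 0" for n using b K.\<epsilon>[of n] by (simp add: \<tau>_def)
  have \<tau>0: "\<tau> \<longlonglongrightarrow> 0" unfolding \<tau>_def[abs_def] using tendsto_mult_right_zero[OF \<epsilon>, of "b / 2"] by simp

  define E where "E = D\<^sup>2 / a * G / (b / 2) powr (p + ?d)"
  define B where "B = D * \<bar>Nu\<bar> powr p"
  define c0 where "c0 = D / a * G / (b / 2) ^ ?d"
  define B0 where "B0 = c0 powr ((s - p) / p) * (b / 2) powr p * \<bar>H\<bar> powr s"
  define A where "A n = c0 * (\<epsilon> n powr p * (1 / min_weight (V n) (m n)))" for n
  have nonneg: "E \<ge> 0" "B \<ge> 0" "B0 \<ge> 0" "c0 \<ge> 0" using D a b G by (auto simp: E_def B_def B0_def c0_def)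
  have A0: "A n \<ge> 0" for n using nonneg \<Lambda>[of n] by (simp add: A_def less_imp_le)
  have pair: "pair_energy p (\<tau> n) (f n) \<Omega> \<le> ennreal (E * \<tau> n powr (p + ?d))" for n
  proof -
    have "pair_energy p (\<tau> n) (f n) \<Omega>
       \<le> ennreal (D\<^sup>2 / a * graph_energy \<eta> p (\<epsilon> n) (V n) (m n) (u n) * \<epsilon> n powr (p + ?d))"
      unfolding \<tau>_def f_def by (rule K.pullback_pair_energy)
    also have "\<dots> \<le> ennreal (D\<^sup>2 / a * G * \<epsilon> n powr (p + ?d))"
      using D a G by (intro ennreal_leI mult_right_mono mult_left_mono) auto
    also have "D\<^sup>2 / a * G * \<epsilon> n powr (p + ?d) = E * \<tau> n powr (p + ?d)"
    proof -
      have "\<tau> n powr (p + ?d) = (b / 2) powr (p + ?d) * \<epsilon> n powr (p + ?d)"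
        unfolding \<tau>_def by (rule powr_mult)
      moreover have "(b / 2) powr (p + ?d) \<noteq> 0" using b by simp
      ultimately show ?thesis by (simp add: E_def)
    qed
    finally show ?thesis .
  qed
  have Lp: "power_integral p \<Omega> (f n) \<le> ennreal B" for n
  proof -
    have "graph_Lp_norm p (V n) (m n) (u n) powr p \<le> \<bar>Nu\<bar> powr p"
      using Nu[of n] pq by (intro powr_mono2) (auto simp: graph_Lp_norm_def)
    then have "D * graph_Lp_norm p (V n) (m n) (u n) powr p \<le> B"
      unfolding B_def using D by (intro mult_left_mono) auto
    then show ?thesis unfolding f_def using K.pullback_Lp[OF pq(1), of n "u n"]
      by (meson ennreal_leI order.trans)
  qed
  have pointwise: "point_energy p (\<tau> n) (f n) \<Omega> x
      \<le> ennreal (A n * \<tau> n ^ ?d)" if x: "x \<in> \<Omega>" for n x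
  proof -
    have "point_energy p (\<tau> n) (f n) \<Omega> x
      \<le> ennreal (D / a * graph_energy \<eta> p (\<epsilon> n) (V n) (m n) (u n) * \<epsilon> n powr (p + ?d) / min_weight (V n) (m n))"
      unfolding \<tau>_def f_def by (rule K.pullback_pointwise[OF x \<Lambda>])
    also have "\<dots> \<le> ennreal (D / a * G * \<epsilon> n powr (p + ?d) / min_weight (V n) (m n))"
      using D a G \<Lambda>[of n] by (intro ennreal_leI divide_right_mono mult_right_mono mult_left_mono) auto
    also have "D / a * G * \<epsilon> n powr (p + ?d) / min_weight (V n) (m n) = A n * \<tau> n ^ ?d"
      using b K.\<epsilon>[of n] by (simp add: A_def c0_def \<tau>_def powr_add powr_realpow power_mult_distrib power_divide)
    finally show ?thesis .
  qed
  have weights: "A n powr ((s - p) / p) * \<tau> n powr p \<le> B0" for n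
  proof -
    let ?\<theta> = "(s - p) / p" and ?L = "min_weight (V n) (m n)"
    have e: "\<epsilon> n powr s = (\<epsilon> n powr p) powr ?\<theta> * \<epsilon> n powr p"
      using pq by (simp add: powr_powr powr_add[symmetric])
    have "A n powr ?\<theta> * \<tau> n powr p
      = c0 powr ?\<theta> * (b / 2) powr p * (\<epsilon> n powr s * (1 / ?L) powr ?\<theta>)"
      using nonneg b K.\<epsilon>[of n] \<Lambda>[of n] unfolding e A_def \<tau>_def by (simp only: powr_mult) (simp add: mult_ac)
    also have "\<dots> \<le> c0 powr ?\<theta> * (b / 2) powr p * \<bar>H\<bar> powr s"
      using min_weight_bounds[OF K.V(1) V_ne K.prob_m, of n] \<Lambda>[of n] K.\<epsilon>[of n] pq s H[of n]
      by (intro mult_left_mono weight_condition[where U="max_weight (V n) (m n)" and q=q]) auto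
    finally show ?thesis by (simp add: B0_def)
  qed

  have dim: "DIM(real ^ 'd) = ?d" by simp
  have bounds: "nonlocal_bounds p s E B B0 \<Omega> (f n) (\<tau> n)" for n
    unfolding nonlocal_bounds_def dim
    by (intro conjI exI[of _ "Mb n"] exI[of _ "A n"] allI ballI f bd \<tau> pair Lp A0 weights pointwise)
  obtain C \<tau>1 where C: "C \<ge> 0" "\<tau>1 > 0" and
    bound: "\<And>f \<tau>. nonlocal_bounds p s E B B0 \<Omega> f \<tau> \<Longrightarrow> \<tau> \<le> \<tau>1 \<Longrightarrow>
      power_integral s \<Omega> f \<le> ennreal C"
    using nonlocal_higher_integrability[OF \<Omega> lip pq(1) s(1,4) nonneg(1-3)] by blast
  have "(\<lambda>n. \<tau> (\<sigma> n)) \<longlonglongrightarrow> 0" using LIMSEQ_subseq_LIMSEQ[OF \<tau>0 \<sigma>] by (simp add: o_def)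
  then have "eventually (\<lambda>n. \<tau> (\<sigma> n) < \<tau>1) sequentially" using C by (intro order_tendstoD)
  then obtain n0 where n0: "\<And>n. n \<ge> n0 \<Longrightarrow> \<tau> (\<sigma> n) < \<tau>1" by (auto simp: eventually_sequentially)
  \<comment> \<open>The \<open>L\<^sup>s\<close> bound is uniform only for small interaction radii, so finitely many members are dropped.\<close>
  define \<sigma>' where "\<sigma>' n = \<sigma> (n + n0)" for n
  have \<sigma>'_mono: "strict_mono \<sigma>'" using \<sigma> by (simp add: strict_mono_def \<sigma>'_def)
  have \<tau>\<sigma>': "(\<lambda>n. \<tau> (\<sigma>' n)) \<longlonglongrightarrow> 0" using LIMSEQ_subseq_LIMSEQ[OF \<tau>0 \<sigma>'_mono] by (simp add: o_def)
  have s1: "s \<ge> 1" using pq s by linarith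
  have Ls': "power_integral s \<Omega> (f (\<sigma>' n)) \<le> ennreal C" for n
    using n0[of "n + n0"] by (intro bound[OF bounds]) (simp add: \<sigma>'_def)
  have "\<exists>k :: nat \<Rightarrow> nat. strict_mono k \<and> (\<forall>r e. 1 \<le> r \<longrightarrow> r < s \<longrightarrow> 0 < e \<longrightarrow>
      (\<exists>N. \<forall>i\<ge>N. \<forall>j\<ge>N. power_integral r \<Omega> (\<lambda>x. f (\<sigma>' (k i)) x - f (\<sigma>' (k j)) x) \<le> ennreal e))"
    by (rule Lr_Cauchy_subsequence[where f="\<lambda>n. f (\<sigma>' n)" and Mb="\<lambda>n. Mb (\<sigma>' n)" and \<tau>="\<lambda>n. \<tau> (\<sigma>' n)",
          OF f bd pq(1) \<tau> \<tau>\<sigma>' \<Omega> nonneg(1) C(1) s1 _ Ls', unfolded dim, OF pair]) blast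
  then obtain k :: "nat \<Rightarrow> nat" where k: "strict_mono k" and cau: "\<And>r e. 1 \<le> r \<Longrightarrow> r < s \<Longrightarrow> 0 < e \<Longrightarrow>
      \<exists>N. \<forall>i\<ge>N. \<forall>j\<ge>N. power_integral r \<Omega> (\<lambda>x. f (\<sigma>' (k i)) x - f (\<sigma>' (k j)) x) \<le> ennreal e"
    by blast
  define \<kappa> where "\<kappa> n = \<sigma>' (k n)" for n
  have cau1: "\<exists>N. \<forall>i\<ge>N. \<forall>j\<ge>N. abs_integral \<Omega> (\<lambda>x. f (\<kappa> i) x - f (\<kappa> j) x) \<le> ennreal e"
    if "0 < e" for e
    using cau[of 1 e] that r s by (simp add: \<kappa>_def)
  have cau_r: "\<exists>N. \<forall>i\<ge>N. \<forall>j\<ge>N. power_integral r \<Omega> (\<lambda>x. f (\<kappa> i) x - f (\<kappa> j) x) \<le> ennreal e"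
    if "0 < e" for e
    using cau[of r e] that r s by (simp add: \<kappa>_def)
  have "\<exists>g. g \<in> borel_measurable borel \<and>
    (\<forall>e>0. \<exists>N. \<forall>n\<ge>N. power_integral r \<Omega> (\<lambda>x. f (\<kappa> n) x - g x) \<le> ennreal e)"
    by (rule Lr_limit[where f="\<lambda>n. f (\<kappa> n)" and Mb="\<lambda>n. Mb (\<kappa> n)", OF f bd \<Omega> r(1) cau1 cau_r]) blast+
  then obtain g where g [measurable]: "g \<in> borel_measurable borel" and
    lim: "\<And>e. e > 0 \<Longrightarrow> \<exists>N. \<forall>n\<ge>N. power_integral r \<Omega> (\<lambda>x. f (\<kappa> n) x - g x) \<le> ennreal e"
    by blast

  have g_fin: "power_integral r \<Omega> g < \<infinity>"
  proof -
    obtain N where N: "power_integral r \<Omega> (\<lambda>x. f (\<kappa> N) x - g x) \<le> ennreal 1"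
      using lim[of 1] by auto
    let ?h = "f (\<kappa> N)"
    define M where "M = Mb (\<kappa> N) powr r * measure lborel \<Omega>"
    have M: "M \<ge> 0" by (simp add: M_def)
    have "power_integral r \<Omega> ?h
       \<le> (\<integral>\<^sup>+x. ennreal (Mb (\<kappa> N) powr r) * indicator \<Omega> x \<partial>lborel)"
      using bd[of "\<kappa> N"] r by (intro nn_integral_mono) (auto simp: indicator_def intro!: ennreal_leI powr_mono2)
    also have "\<dots> = ennreal M"
      using emeasure_bounded_finite[OF \<Omega>(2)] \<Omega>(1)
      by (simp add: nn_integral_cmult_indicator emeasure_eq_ennreal_measure M_def ennreal_mult)
    finally have h: "power_integral r \<Omega> ?h \<le> ennreal M" .
    have "power_integral r \<Omega> (\<lambda>x. ?h x - (?h x - g x)) \<le> ennreal (2 powr r * (M + 1))"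
    proof (rule nn_integral_diff_powr_le)
      show "power_integral r \<Omega> ?h \<le> ennreal (M + 1)"
        by (rule order.trans[OF h]) (simp add: ennreal_leI)
      show "power_integral r \<Omega> (\<lambda>x. ?h x - g x) \<le> ennreal (M + 1)"
        by (rule order.trans[OF N]) (use M in \<open>simp add: ennreal_leI del: ennreal_1\<close>)
    qed (use \<Omega>(1) r M in auto)
    then show ?thesis by (simp add: le_less_trans)
  qed

  let ?X = "\<lambda>n. (extend_zero (V n) (u n), m n)"
  have dist0: "(\<lambda>n. TL_dist r \<Omega> (?X (\<kappa> n)) (g, \<mu>)) \<longlonglongrightarrow> 0"
  proof (rule LIMSEQ_I)
    fix e :: real assume e: "0 < e"
    \<comment> \<open>Displacement and \<open>L\<^sup>r\<close> distance each contribute at most \<open>e1\<close>, and \<open>(e1 + e1)\<^bsup>1/r\<^esup> = e / 2\<close>.\<close>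
    define e1 where "e1 = (e / 2) powr r / 2"
    have e1: "e1 > 0" using e by (simp add: e1_def)
    obtain N1 where N1: "\<And>n. n \<ge> N1 \<Longrightarrow>
       power_integral r \<Omega> (\<lambda>x. f (\<kappa> n) x - g x) \<le> ennreal (e1 / D)"
      using lim[of "e1 / D"] e1 D by auto
    have "strict_mono \<kappa>" using \<sigma>'_mono k by (simp add: strict_mono_def \<kappa>_def)
    then have displ: "(\<lambda>n. b / 4 * \<epsilon> (\<kappa> n)) \<longlonglongrightarrow> 0"
      using tendsto_mult_right_zero[OF LIMSEQ_subseq_LIMSEQ[OF \<epsilon>], of \<kappa> "b / 4"] by (simp add: o_def)
    have "eventually (\<lambda>n. b / 4 * \<epsilon> (\<kappa> n) < e1 powr (1 / r)) sequentially"
      by (rule order_tendstoD(2)[OF displ]) (use e1 in simp)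
    then obtain N2 where N2: "\<And>n. n \<ge> N2 \<Longrightarrow> b / 4 * \<epsilon> (\<kappa> n) < e1 powr (1 / r)"
      by (auto simp: eventually_sequentially)
    show "\<exists>N. \<forall>n\<ge>N. norm (TL_dist r \<Omega> (?X (\<kappa> n)) (g, \<mu>) - 0) < e"
    proof (intro exI[of _ "max N1 N2"] allI impI)
      fix n assume n: "max N1 N2 \<le> n"
      have "TL_dist r \<Omega> (?X (\<kappa> n)) (g, \<mu>) \<le> ((b / 4 * \<epsilon> (\<kappa> n)) powr r + D * (e1 / D)) powr (1 / r)"
        using N1[of n] n D e1 K.displacement[where n="\<kappa> n"] r g unfolding f_def
        by (intro K.TL_dist_le) auto
      also have "\<dots> \<le> (e1 + e1) powr (1 / r)"
      proof (intro powr_mono2 add_mono)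
        have "(b / 4 * \<epsilon> (\<kappa> n)) powr r \<le> (e1 powr (1 / r)) powr r"
          using N2[of n] n b K.\<epsilon>[of "\<kappa> n"] r by (intro powr_mono2) (auto simp: less_imp_le)
        then show "(b / 4 * \<epsilon> (\<kappa> n)) powr r \<le> e1" using e1 r by (simp add: powr_powr)
      qed (use r D e1 in auto)
      also have "\<dots> = e / 2" using e r by (simp add: e1_def powr_powr)
      also have "\<dots> < e" using e by simp
      finally show "norm (TL_dist r \<Omega> (?X (\<kappa> n)) (g, \<mu>) - 0) < e"
        using K.TL_dist_transport_nonneg[of r "\<kappa> n"] by simp
    qed
  qed
  show "\<exists>s' l. strict_mono (s' :: nat \<Rightarrow> nat) \<and> TL_converges r \<Omega> (?X \<circ> \<sigma> \<circ> s') l"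
  proof (intro exI conjI)
    show "strict_mono (\<lambda>n. k n + n0)" using k by (simp add: strict_mono_def)
    have "?X \<circ> \<sigma> \<circ> (\<lambda>n. k n + n0) = (\<lambda>n. ?X (\<kappa> n))" by (simp add: fun_eq_iff \<kappa>_def \<sigma>'_def)
    then show "TL_converges r \<Omega> (?X \<circ> \<sigma> \<circ> (\<lambda>n. k n + n0)) (g, \<mu>)"
      using dist0 K.discrete_in_TL_space[OF r(1)] K.continuum_in_TL_space[OF r(1) g g_fin]
      by (simp add: TL_converges_def)
  qed
qed

theorem corollary5p12:
  fixes \<Omega> :: "(real ^ 'd) set" and \<eta> :: "real \<Rightarrow> real"
  assumes "open \<Omega>" "bounded \<Omega>" "lipschitz_boundary \<Omega>"
    and "\<forall>r\<ge>0. \<eta> r \<ge> 0"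
  shows "\<exists>S>0. \<forall>(p::real) (q::real)
      (\<rho> :: real ^ 'd \<Rightarrow> real) (\<mu> :: (real ^ 'd) measure)
      (V :: nat \<Rightarrow> (real ^ 'd) set) (\<mu>n :: nat \<Rightarrow> (real ^ 'd) measure)
      (\<epsilon> :: nat \<Rightarrow> real) (u :: nat \<Rightarrow> real ^ 'd \<Rightarrow> real).
    1 \<le> p \<and> p < real CARD('d) \<and> p \<le> q \<and> q \<le> real CARD('d) * p / (real CARD('d) - p) \<longrightarrow>
    continuous_on \<Omega> \<rho> \<and> \<mu> = density (restrict_space lborel \<Omega>) (\<lambda>x. ennreal (\<rho> x)) \<and>
      prob_space \<mu> \<longrightarrow>
    (\<forall>n. finite (V n) \<and> V n \<subseteq> \<Omega> \<and> prob_space (\<mu>n n) \<and>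
      sets (\<mu>n n) = sets (borel_on \<Omega>) \<and> measure (\<mu>n n) (V n) = 1) \<longrightarrow>
    (\<forall>n. \<epsilon> n > 0) \<and> \<epsilon> \<longlonglongrightarrow> 0 \<longrightarrow>
    (\<exists>K>0. K \<le> S \<and> (\<exists>T :: nat \<Rightarrow> real ^ 'd \<Rightarrow> real ^ 'd. \<forall>n.
      T n \<in> borel_on \<Omega> \<rightarrow>\<^sub>M borel_on (V n) \<and>
      distr \<mu> (borel_on \<Omega>) (T n) = \<mu>n n \<and>
      (\<forall>x\<in>\<Omega>. norm (T n x - x) \<le> K * \<epsilon> n))) \<longrightarrow>
    continuous (at 0 within {0..}) \<eta> \<and> antimono_on {0..} \<eta> \<and> \<eta> 0 > 0 \<longrightarrow>
    (\<exists>D>0. \<forall>x\<in>\<Omega>. 1 / D \<le> \<rho> x \<and> \<rho> x \<le> D) \<longrightarrow>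
    (\<exists>t>q. kernel_moment CARD('d) \<eta> t < \<infinity>) \<longrightarrow>
    (\<forall>n. min_weight (V n) (\<mu>n n) > 0) \<and>
      Bseq (\<lambda>n. \<epsilon> n * max_weight (V n) (\<mu>n n) powr (1 / q + 1 / p) /
        min_weight (V n) (\<mu>n n) powr (2 / p)) \<longrightarrow>
    Bseq (\<lambda>n. graph_Lp_norm p (V n) (\<mu>n n) (u n)) \<and>
      Bseq (\<lambda>n. graph_energy \<eta> p (\<epsilon> n) (V n) (\<mu>n n) (u n)) \<longrightarrow>
    (\<forall>r. 1 \<le> r \<and> r < q \<longrightarrow>
      TL_relatively_compact r \<Omega> (\<lambda>n. (extend_zero (V n) (u n), \<mu>n n)))"
proof -
  define admissible where "admissible b \<longleftrightarrow> b > 0 \<and> (\<forall>r. 0 \<le> r \<and> r \<le> b \<longrightarrow> \<eta> 0 / 2 \<le> \<eta> r)" for b :: real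
  \<comment> \<open>The constant has to be chosen before \<open>\<eta>\<close> is known to be continuous and positive at \<open>0\<close>.  The value \<open>1\<close>
     is taken if no radius is admissible, a case that these two conditions exclude.\<close>
  define b where "b = (if \<exists>b. admissible b then SOME b. admissible b else 1)"
  have b_pos: "b > 0"
  proof (cases "\<exists>b. admissible b")
    case True
    then have "admissible b" unfolding b_def by (auto intro: someI_ex)
    then show ?thesis by (simp add: admissible_def)
  qed (simp add: b_def)
  have b_lower: "\<eta> 0 / 2 \<le> \<eta> r"
    if cont: "continuous (at 0 within {0..}) \<eta>" and pos: "\<eta> 0 > 0" and r: "0 \<le> r" "r \<le> b" for r
  proof -
    obtain \<delta> where \<delta>: "\<delta> > 0" "\<And>x. x \<in> {0..} \<Longrightarrow> dist x 0 < \<delta> \<Longrightarrow> dist (\<eta> x) (\<eta> 0) < \<eta> 0 / 2"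
      using cont[unfolded continuous_within_eps_delta, rule_format, of "\<eta> 0 / 2"] pos by auto
    have "admissible (\<delta> / 2)"
      unfolding admissible_def
    proof (intro conjI allI impI)
      fix x assume x: "0 \<le> x \<and> x \<le> \<delta> / 2"
      then have "dist (\<eta> x) (\<eta> 0) < \<eta> 0 / 2" using \<delta> by (intro \<delta>(2)) auto
      then show "\<eta> 0 / 2 \<le> \<eta> x" unfolding dist_real_def by linarith
    qed (use \<delta> in auto)
    then have "admissible b" unfolding b_def by (auto intro: someI_ex)
    then show ?thesis using r by (simp add: admissible_def)
  qed
  show ?thesis
  proof (intro exI[of _ "b / 4"] conjI allI impI)
    show "b / 4 > 0" using b_pos by simp
    fix p q :: real and \<rho> :: "real ^ 'd \<Rightarrow> real" and \<mu> :: "(real ^ 'd) measure"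
      and V :: "nat \<Rightarrow> (real ^ 'd) set" and \<mu>n :: "nat \<Rightarrow> (real ^ 'd) measure"
      and \<epsilon> :: "nat \<Rightarrow> real" and u :: "nat \<Rightarrow> real ^ 'd \<Rightarrow> real" and r :: real
    assume pq: "1 \<le> p \<and> p < real CARD('d) \<and> p \<le> q \<and> q \<le> real CARD('d) * p / (real CARD('d) - p)"
      and \<mu>: "continuous_on \<Omega> \<rho> \<and> \<mu> = density (restrict_space lborel \<Omega>) (\<lambda>x. ennreal (\<rho> x)) \<and> prob_space \<mu>"
      and V: "\<forall>n. finite (V n) \<and> V n \<subseteq> \<Omega> \<and> prob_space (\<mu>n n) \<and>
        sets (\<mu>n n) = sets (borel_on \<Omega>) \<and> measure (\<mu>n n) (V n) = 1"
      and \<epsilon>: "(\<forall>n. \<epsilon> n > 0) \<and> \<epsilon> \<longlonglongrightarrow> 0"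
      and maps: "\<exists>K>0. K \<le> b / 4 \<and> (\<exists>T :: nat \<Rightarrow> real ^ 'd \<Rightarrow> real ^ 'd. \<forall>n.
        T n \<in> borel_on \<Omega> \<rightarrow>\<^sub>M borel_on (V n) \<and> distr \<mu> (borel_on \<Omega>) (T n) = \<mu>n n \<and>
        (\<forall>x\<in>\<Omega>. norm (T n x - x) \<le> K * \<epsilon> n))"
      and \<eta>: "continuous (at 0 within {0..}) \<eta> \<and> antimono_on {0..} \<eta> \<and> \<eta> 0 > 0"
      and \<rho>: "\<exists>D>0. \<forall>x\<in>\<Omega>. 1 / D \<le> \<rho> x \<and> \<rho> x \<le> D"
      and \<Lambda>: "(\<forall>n. min_weight (V n) (\<mu>n n) > 0) \<and>
        Bseq (\<lambda>n. \<epsilon> n * max_weight (V n) (\<mu>n n) powr (1 / q + 1 / p) / min_weight (V n) (\<mu>n n) powr (2 / p))"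
      and bounds: "Bseq (\<lambda>n. graph_Lp_norm p (V n) (\<mu>n n) (u n)) \<and>
        Bseq (\<lambda>n. graph_energy \<eta> p (\<epsilon> n) (V n) (\<mu>n n) (u n))"
      and r: "1 \<le> r \<and> r < q"
    from maps obtain K where "K > 0 \<and> K \<le> b / 4 \<and> (\<exists>T :: nat \<Rightarrow> real ^ 'd \<Rightarrow> real ^ 'd. \<forall>n.
        T n \<in> borel_on \<Omega> \<rightarrow>\<^sub>M borel_on (V n) \<and> distr \<mu> (borel_on \<Omega>) (T n) = \<mu>n n \<and>
        (\<forall>x\<in>\<Omega>. norm (T n x - x) \<le> K * \<epsilon> n))"
      by (rule exE)
    then have K: "K \<le> b / 4" and ex_T: "\<exists>T :: nat \<Rightarrow> real ^ 'd \<Rightarrow> real ^ 'd. \<forall>n.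
        T n \<in> borel_on \<Omega> \<rightarrow>\<^sub>M borel_on (V n) \<and> distr \<mu> (borel_on \<Omega>) (T n) = \<mu>n n \<and>
        (\<forall>x\<in>\<Omega>. norm (T n x - x) \<le> K * \<epsilon> n)"
      by (rule conjunct1[OF conjunct2], rule conjunct2[OF conjunct2])
    from ex_T obtain T where T: "\<forall>n. T n \<in> borel_on \<Omega> \<rightarrow>\<^sub>M borel_on (V n) \<and>
        distr \<mu> (borel_on \<Omega>) (T n) = \<mu>n n \<and> (\<forall>x\<in>\<Omega>. norm (T n x - x) \<le> K * \<epsilon> n)"
      by (rule exE)
    from \<rho> obtain D where D: "D > 0" "\<forall>x\<in>\<Omega>. 1 / D \<le> \<rho> x \<and> \<rho> x \<le> D"
      by (elim exE conjE) (rule that)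
    from conjunct2[OF \<Lambda>] obtain H where H: "\<forall>n. norm (\<epsilon> n * max_weight (V n) (\<mu>n n) powr (1 / q + 1 / p) /
        min_weight (V n) (\<mu>n n) powr (2 / p)) \<le> H"
      by (rule BseqE)
    from conjunct1[OF bounds] obtain Nu where Nu: "\<forall>n. norm (graph_Lp_norm p (V n) (\<mu>n n) (u n)) \<le> Nu"
      by (rule BseqE)
    from conjunct2[OF bounds] obtain G where G: "G > 0" "\<forall>n. norm (graph_energy \<eta> p (\<epsilon> n) (V n) (\<mu>n n) (u n)) \<le> G"
      by (rule BseqE)
    have density: "transported_density \<Omega> \<rho> \<mu> (\<mu>n n) (V n) (T n) D" for n
      by (rule transported_density.intro)
        (use assms(1,2) \<mu> D V[rule_format, of n] T[rule_format, of n] in blast)+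
    have kernel: "transported_kernel \<Omega> \<rho> \<mu> (\<mu>n n) (V n) (T n) D \<eta> (\<eta> 0 / 2) b (\<epsilon> n) p" for n
    proof (intro transported_kernel.intro transported_kernel_axioms.intro density)
      show "norm (T n x - x) \<le> b / 4 * \<epsilon> n" if "x \<in> \<Omega>" for x
      proof -
        have "norm (T n x - x) \<le> K * \<epsilon> n" using T that by blast
        also have "\<dots> \<le> b / 4 * \<epsilon> n" using K \<epsilon> by (intro mult_right_mono) (auto intro: less_imp_le)
        finally show ?thesis .
      qed
      show "\<eta> 0 / 2 \<le> \<eta> s" if "0 \<le> s" "s \<le> b" for s
        using b_lower \<eta> that by blast
      show "\<eta> s \<ge> 0" if "s \<ge> 0" for s using assms(4) that by blast
      show "\<eta> 0 / 2 > 0" using \<eta> by simp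
      show "b > 0" by (rule b_pos)
      show "\<epsilon> n > 0" using \<epsilon> by blast
      show "1 \<le> p" using pq by blast
    qed
    show "TL_relatively_compact r \<Omega> (\<lambda>n. (extend_zero (V n) (u n), \<mu>n n))"
    proof (rule energy_bounded_relatively_compact[OF assms(3) _ _ _ _ kernel])
      show "\<epsilon> n * max_weight (V n) (\<mu>n n) powr (1 / q + 1 / p) / min_weight (V n) (\<mu>n n) powr (2 / p) \<le> H" for n
        using H[rule_format, of n] by (simp only: real_norm_def abs_le_iff)
      show "graph_Lp_norm p (V n) (\<mu>n n) (u n) \<le> Nu" for n
        using Nu[rule_format, of n] by (simp only: real_norm_def abs_le_iff)
      show "graph_energy \<eta> p (\<epsilon> n) (V n) (\<mu>n n) (u n) \<le> G" for n
        using G(2)[rule_format, of n] by (simp only: real_norm_def abs_le_iff)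
      show "0 \<le> G" using G(1) by simp
    qed (use pq \<epsilon> \<Lambda> r in blast)+
  qed
qed

end
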